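(* Let $f,g:\mathbb{R}\to\mathbb{R}$ be bounded measurable functions with ranges $I$ and $J$ respectively, and suppose $K=i[f(P),g(Q)]\ge 0$ and $K\ne 0$. If $F$ and $G$ are matrix monotone functions defined on open intervals containing the closure of $I$ and the closure of $J$ respectively, then $$i[(F\circ f)(P),(G\circ g)(Q)]\ge 0 .$$
   Context: On $L^2(\mathbb{R})$, $Q$ is multiplication by $x$ and $P=-i\,d/dx$; $f(P)$ and $g(Q)$ are defined by the functional calculus (so $g(Q)$ is multiplication by $g$, and $f(P)=\mathcal{F}^{-1}f(\xi)\mathcal{F}$ with $\mathcal{F}$ the unitary Fourier transform $\hat\psi(\xi)=(2\pi)^{-1/2}\int e^{-i\xi x}\psi(x)\,dx$). $[A,B]=AB-BA$. Positivity of a bounded operator is in the quadratic form sense. A real function $F$ defined on an open interval $U$ is called matrix monotone (on $U$) if for any two self-adjoint operators $A$ and $B$ on a (possibly infinite-dimensional) Hilbert space with spectrum in $U$ and with $A\ge B$, one has $F(A)\ge F(B)$. *)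

theory Defs
  imports "HOL-Analysis.Analysis" "HOL-Algebra.Module"
begin

section \<open>Complex Hilbert spaces\<close>

definition complex_field :: "complex ring" where
  "complex_field = \<lparr>carrier = UNIV, mult = (*), one = 1, zero = 0, add = (+)\<rparr>"

text \<open>
  A Hilbert space is a module record over the field of complex numbers, extended by an inner
  product. The record fields for ring multiplication and its unit play no role in a module.
  The inner product is linear in the second argument.
\<close>

record 'a inner_product_space = "(complex, 'a) module" +
  inprod :: "'a \<Rightarrow> 'a \<Rightarrow> complex"

definition hnorm :: "('a, 'm) inner_product_space_scheme \<Rightarrow> 'a \<Rightarrow> real" where
  "hnorm H x = sqrt (Re (inprod H x x))"

locale hilbert_space = module complex_field H
  for H :: "('a, 'm) inner_product_space_scheme" (structure) +
  assumes inprod_commute: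
      "\<lbrakk>x \<in> carrier H; y \<in> carrier H\<rbrakk> \<Longrightarrow> inprod H y x = cnj (inprod H x y)"
    and inprod_add:
      "\<lbrakk>x \<in> carrier H; y \<in> carrier H; z \<in> carrier H\<rbrakk>
        \<Longrightarrow> inprod H x (y \<oplus> z) = inprod H x y + inprod H x z"
    and inprod_smult:
      "\<lbrakk>x \<in> carrier H; y \<in> carrier H\<rbrakk> \<Longrightarrow> inprod H x (c \<odot> y) = c * inprod H x y"
    and inprod_nonneg: "x \<in> carrier H \<Longrightarrow> inprod H x x \<in> \<real>\<^sub>\<ge>\<^sub>0"
    and inprod_definite: "\<lbrakk>x \<in> carrier H; inprod H x x = 0\<rbrakk> \<Longrightarrow> x = \<zero>"
    and complete:
      "\<lbrakk>\<And>n. s n \<in> carrier H;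
        \<forall>e>0. \<exists>N. \<forall>m\<ge>N. \<forall>n\<ge>N. hnorm H (s m \<ominus> s n) < e\<rbrakk>
        \<Longrightarrow> \<exists>x\<in>carrier H. (\<lambda>n. hnorm H (s n \<ominus> x)) \<longlonglongrightarrow> 0"

section \<open>Bounded operators\<close>

text \<open>Operators are functions of which only the values on the carrier are relevant.\<close>

definition bounded_operator ::
    "('a, 'm) inner_product_space_scheme \<Rightarrow> ('a \<Rightarrow> 'a) \<Rightarrow> bool" where
  "bounded_operator H A \<longleftrightarrow>
     (\<forall>x\<in>carrier H. A x \<in> carrier H) \<and>
     (\<forall>x\<in>carrier H. \<forall>y\<in>carrier H. A (x \<oplus>\<^bsub>H\<^esub> y) = A x \<oplus>\<^bsub>H\<^esub> A y) \<and>
     (\<forall>c. \<forall>x\<in>carrier H. A (c \<odot>\<^bsub>H\<^esub> x) = c \<odot>\<^bsub>H\<^esub> A x) \<and>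
     (\<exists>C. \<forall>x\<in>carrier H. hnorm H (A x) \<le> C * hnorm H x)"

definition self_adjoint ::
    "('a, 'm) inner_product_space_scheme \<Rightarrow> ('a \<Rightarrow> 'a) \<Rightarrow> bool" where
  "self_adjoint H A \<longleftrightarrow>
     bounded_operator H A \<and>
     (\<forall>x\<in>carrier H. \<forall>y\<in>carrier H. inprod H (A x) y = inprod H x (A y))"

definition positive_operator ::
    "('a, 'm) inner_product_space_scheme \<Rightarrow> ('a \<Rightarrow> 'a) \<Rightarrow> bool" where
  "positive_operator H A \<longleftrightarrow> (\<forall>x\<in>carrier H. inprod H x (A x) \<in> \<real>\<^sub>\<ge>\<^sub>0)"

definition operator_le ::
    "('a, 'm) inner_product_space_scheme \<Rightarrow> ('a \<Rightarrow> 'a) \<Rightarrow> ('a \<Rightarrow> 'a) \<Rightarrow> bool" where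
  "operator_le H B A \<longleftrightarrow> positive_operator H (\<lambda>x. A x \<ominus>\<^bsub>H\<^esub> B x)"

definition commutator ::
    "('a, 'm) inner_product_space_scheme \<Rightarrow> ('a \<Rightarrow> 'a) \<Rightarrow> ('a \<Rightarrow> 'a) \<Rightarrow> 'a \<Rightarrow> 'a" where
  "commutator H A B = (\<lambda>x. A (B x) \<ominus>\<^bsub>H\<^esub> B (A x))"

definition operator_spectrum ::
    "('a, 'm) inner_product_space_scheme \<Rightarrow> ('a \<Rightarrow> 'a) \<Rightarrow> complex set" where
  "operator_spectrum H A =
     {z. \<not> (\<exists>R. bounded_operator H R \<and>
              (\<forall>x\<in>carrier H. R (A x \<ominus>\<^bsub>H\<^esub> z \<odot>\<^bsub>H\<^esub> x) = x \<and>
                             A (R x) \<ominus>\<^bsub>H\<^esub> z \<odot>\<^bsub>H\<^esub> R x = x))}"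

section \<open>Borel functional calculus\<close>

definition projection_valued_measure ::
    "('a, 'm) inner_product_space_scheme \<Rightarrow> (real set \<Rightarrow> 'a \<Rightarrow> 'a) \<Rightarrow> bool" where
  "projection_valued_measure H E \<longleftrightarrow>
     (\<forall>S\<in>sets borel. self_adjoint H (E S)) \<and>
     (\<forall>S\<in>sets borel. \<forall>T\<in>sets borel. \<forall>x\<in>carrier H. E (S \<inter> T) x = E S (E T x)) \<and>
     (\<forall>x\<in>carrier H. E UNIV x = x) \<and>
     (\<forall>S :: nat \<Rightarrow> real set. range S \<subseteq> sets borel \<longrightarrow> disjoint_family S \<longrightarrow>
        (\<forall>x\<in>carrier H. (\<lambda>n. inprod H x (E (S n) x)) sums inprod H x (E (\<Union>n. S n) x)))"

definition spectral_measure ::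
    "('a, 'm) inner_product_space_scheme \<Rightarrow> (real set \<Rightarrow> 'a \<Rightarrow> 'a) \<Rightarrow> 'a \<Rightarrow> real measure" where
  "spectral_measure H E x =
     measure_of UNIV (sets borel) (\<lambda>S. ennreal (Re (inprod H x (E S x))))"

text \<open>
  \<open>has_spectral_integral H E U F T\<close> says that \<open>T\<close> is the bounded operator \<open>\<integral>\<^sub>U F dE\<close>,
  which its quadratic form determines by polarization.
\<close>

definition has_spectral_integral ::
    "('a, 'm) inner_product_space_scheme \<Rightarrow> (real set \<Rightarrow> 'a \<Rightarrow> 'a) \<Rightarrow>
     real set \<Rightarrow> (real \<Rightarrow> real) \<Rightarrow> ('a \<Rightarrow> 'a) \<Rightarrow> bool" where
  "has_spectral_integral H E U F T \<longleftrightarrow>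
     bounded_operator H T \<and>
     (\<forall>x\<in>carrier H.
        set_integrable (spectral_measure H E x) U F \<and>
        inprod H x (T x) = of_real (LINT s:U|spectral_measure H E x. F s))"

text \<open>
  \<open>functional_calculus H U F A T\<close> says that \<open>T = F(A)\<close>, where \<open>A\<close> is a self-adjoint operator
  with spectrum in \<open>U\<close>. Values of \<open>F\<close> outside \<open>U\<close> are irrelevant.
\<close>

definition functional_calculus ::
    "('a, 'm) inner_product_space_scheme \<Rightarrow> real set \<Rightarrow> (real \<Rightarrow> real) \<Rightarrow>
     ('a \<Rightarrow> 'a) \<Rightarrow> ('a \<Rightarrow> 'a) \<Rightarrow> bool" where
  "functional_calculus H U F A T \<longleftrightarrow>
     (\<exists>E. projection_valued_measure H E \<and>
          has_spectral_integral H E UNIV (\<lambda>s. s) A \<and>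
          has_spectral_integral H E U F T)"

section \<open>Matrix monotone functions\<close>

text \<open>
  The Hilbert spaces \<open>H\<close> range over all those with carrier in the type of sets of complex-valued
  functions on the line; up to isomorphism these include every Hilbert space of
  cardinality at most that of this type, in particular all separable ones.
  Borel measurability of \<open>F\<close> on \<open>U\<close> is what makes \<open>F(A)\<close> meaningful; it is no restriction, since
  (by the case of a one-dimensional space) a matrix monotone function is increasing on \<open>U\<close>.
\<close>

definition matrix_monotone_on :: "real set \<Rightarrow> (real \<Rightarrow> real) \<Rightarrow> bool" where
  "matrix_monotone_on U F \<longleftrightarrow>
     set_borel_measurable borel U F \<and>
     (\<forall>(H :: (real \<Rightarrow> complex) set inner_product_space) A B FA FB.
        hilbert_space H \<longrightarrow> self_adjoint H A \<longrightarrow> self_adjoint H B \<longrightarrow>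
        operator_spectrum H A \<subseteq> of_real ` U \<longrightarrow> operator_spectrum H B \<subseteq> of_real ` U \<longrightarrow>
        functional_calculus H U F A FA \<longrightarrow> functional_calculus H U F B FB \<longrightarrow>
        operator_le H B A \<longrightarrow> operator_le H FB FA)"

section \<open>The Hilbert space of square-integrable functions on the line\<close>

definition square_integrable :: "(real \<Rightarrow> complex) set" where
  "square_integrable =
     {\<psi>. \<psi> \<in> borel_measurable lebesgue \<and> integrable lebesgue (\<lambda>x. (cmod (\<psi> x))\<^sup>2)}"

definition ae_class :: "(real \<Rightarrow> complex) \<Rightarrow> (real \<Rightarrow> complex) set" where
  "ae_class \<psi> = {\<phi>. \<phi> \<in> borel_measurable lebesgue \<and> (AE x in lebesgue. \<phi> x = \<psi> x)}"

definition ae_rep :: "(real \<Rightarrow> complex) set \<Rightarrow> real \<Rightarrow> complex" where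
  "ae_rep X = (SOME \<psi>. \<psi> \<in> X)"

definition L2 :: "(real \<Rightarrow> complex) set inner_product_space" where
  "L2 = \<lparr>carrier = ae_class ` square_integrable,
         mult = undefined, one = undefined,
         zero = ae_class (\<lambda>x. 0),
         add = (\<lambda>X Y. ae_class (\<lambda>x. ae_rep X x + ae_rep Y x)),
         smult = (\<lambda>c X. ae_class (\<lambda>x. c * ae_rep X x)),
         inprod = (\<lambda>X Y. LINT x|lebesgue. cnj (ae_rep X x) * ae_rep Y x)\<rparr>"

section \<open>Functions of position and momentum\<close>

definition function_of_Q :: "(real \<Rightarrow> real) \<Rightarrow> (real \<Rightarrow> complex) set \<Rightarrow> (real \<Rightarrow> complex) set" where
  "function_of_Q g X = ae_class (\<lambda>x. of_real (g x) * ae_rep X x)"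

definition truncated_fourier :: "nat \<Rightarrow> (real \<Rightarrow> complex) \<Rightarrow> real \<Rightarrow> complex" where
  "truncated_fourier n \<psi> \<xi> =
     of_real (1 / sqrt (2 * pi)) *
     (LINT x:{- real n..real n}|lebesgue. exp (- \<i> * of_real \<xi> * of_real x) * \<psi> x)"

text \<open>
  The Fourier integral of a function in \<open>L2\<close> need not converge absolutely; as usual the unitary
  Fourier transform is the limit in mean of the truncated integrals.
\<close>

definition fourier :: "(real \<Rightarrow> complex) set \<Rightarrow> (real \<Rightarrow> complex) set" where
  "fourier X =
     (THE Y. Y \<in> carrier L2 \<and>
        (\<lambda>n. hnorm L2 (ae_class (truncated_fourier n (ae_rep X)) \<ominus>\<^bsub>L2\<^esub> Y)) \<longlonglongrightarrow> 0)"

definition function_of_P :: "(real \<Rightarrow> real) \<Rightarrow> (real \<Rightarrow> complex) set \<Rightarrow> (real \<Rightarrow> complex) set" where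
  "function_of_P f X = inv_into (carrier L2) fourier (function_of_Q f (fourier X))"

definition i_commutator_PQ ::
    "(real \<Rightarrow> real) \<Rightarrow> (real \<Rightarrow> real) \<Rightarrow> (real \<Rightarrow> complex) set \<Rightarrow> (real \<Rightarrow> complex) set" where
  "i_commutator_PQ f g =
     (\<lambda>X. \<i> \<odot>\<^bsub>L2\<^esub> commutator L2 (function_of_P f) (function_of_Q g) X)"

end

theory Submission
  imports Defs "HOL-Probability.Probability"
begin

text \<open>
  Put \<open>A = f(P)\<close> and \<open>B = g(Q)\<close>, and consider the unitary group \<open>exp (-i t B)\<close>. For a bounded
  operator \<open>T\<close> the derivative in \<open>t\<close> of \<open>exp (i t B) T exp (-i t B)\<close> is
  \<open>- exp (i t B) i[T, B] exp (-i t B)\<close>. So if \<open>i[A, B] \<ge> 0\<close>, then the operators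
  \<open>A\<^sub>t = exp (i t B) A exp (-i t B)\<close> decrease with \<open>t\<close>; in particular \<open>A\<^sub>t \<le> A\<close> for \<open>t \<ge> 0\<close>.
  They are all unitarily equivalent to \<open>A\<close>, so a matrix monotone \<open>F\<close> can be applied to this
  inequality: \<open>exp (i t B) F(A) exp (-i t B) = F(A\<^sub>t) \<le> F(A)\<close>. The two sides agree at \<open>t = 0\<close>, and
  comparing their derivatives there gives \<open>i[F(A), B] \<ge> 0\<close>. Since \<open>[A, B] = [B, -A]\<close>, the same
  argument with the operators exchanged replaces \<open>B\<close> by \<open>G(B)\<close>. This is
  \<open>positive_commutator_matrix_monotone\<close>, stated for all \<open>A\<close> and \<open>B\<close> that
  are unitarily equivalent to multiplications by bounded real functions.

  The rest is what gives this argument a meaning in \<open>L2\<close>. The space is complete (Riesz--Fischer),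
  so it is one of the Hilbert spaces over which matrix monotonicity quantifies. A real
  multiplication operator \<open>h\<close>, conjugated by a unitary, has as spectral projections the conjugated
  multiplications by the indicators of \<open>{t. h t \<in> S}\<close>, so that its function \<open>F\<close> is the
  conjugated multiplication by \<open>F \<circ> h\<close> (\<open>functional_calculus_diag_op\<close>). Finally, Plancherel's theorem
  (\<open>plancherel\<close>, \<open>unitary_fourier_op\<close>) makes the Fourier transform unitary, which puts \<open>f(P)\<close> in this
  form. It is proved by Gaussian regularization: \<open>\<integral> |\<phi>^(\<xi>)|\<^sup>2 exp (-s\<^sup>2 \<xi>\<^sup>2 / 2)\<close> is the mean of the
  autocorrelation of \<open>\<phi>\<close> against a normal density of standard deviation \<open>s\<close>, and as \<open>s\<close> tends to 0
  both sides converge, because translations act continuously on \<open>L2\<close>.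
\<close>

section \<open>Square-integrable functions and their classes\<close>

lemma borel_measurable_cnj [measurable (raw)]:
  "f \<in> borel_measurable M \<Longrightarrow> (\<lambda>x. cnj (f x)) \<in> borel_measurable M"
  by (rule measurable_compose[of f M borel]) (auto intro: borel_measurable_continuous_onI continuous_on_cnj continuous_on_id)

lemma measurable_square_integrable:
  "\<phi> \<in> square_integrable \<Longrightarrow> \<phi> \<in> borel_measurable lebesgue"
  by (simp add: square_integrable_def)

lemma integrable_square_integrable:
  "\<phi> \<in> square_integrable \<Longrightarrow> integrable lebesgue (\<lambda>x. (cmod (\<phi> x))\<^sup>2)"
  by (simp add: square_integrable_def)

lemma square_integrable_bound:
  assumes "\<psi> \<in> borel_measurable lebesgue" "integrable lebesgue h"
    and "AE x in lebesgue. (cmod (\<psi> x))\<^sup>2 \<le> h x"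
  shows "\<psi> \<in> square_integrable"
  unfolding square_integrable_def
proof (safe intro!: assms(1))
  have [measurable]: "\<psi> \<in> borel_measurable lebesgue" by fact
  show "integrable lebesgue (\<lambda>x. (cmod (\<psi> x))\<^sup>2)"
    by (rule Bochner_Integration.integrable_bound[OF assms(2)]) (use assms(3) in auto)
qed

lemma square_integrable_add:
  assumes "\<phi> \<in> square_integrable" "\<psi> \<in> square_integrable"
  shows "(\<lambda>x. \<phi> x + \<psi> x) \<in> square_integrable"
proof (rule square_integrable_bound)
  show "integrable lebesgue (\<lambda>x. 2 * (cmod (\<phi> x))\<^sup>2 + 2 * (cmod (\<psi> x))\<^sup>2)"
    using assms by (auto simp: square_integrable_def)
  have "(cmod (a + b))\<^sup>2 \<le> 2 * (cmod a)\<^sup>2 + 2 * (cmod b)\<^sup>2" for a b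
  proof -
    have "(cmod (a + b))\<^sup>2 \<le> (cmod a + cmod b)\<^sup>2"
      by (intro power_mono norm_triangle_ineq) auto
    also have "\<dots> \<le> 2 * (cmod a)\<^sup>2 + 2 * (cmod b)\<^sup>2"
      using zero_le_power2[of "cmod a - cmod b"] by (simp add: power2_eq_square algebra_simps)
    finally show ?thesis .
  qed
  then show "AE x in lebesgue. (cmod (\<phi> x + \<psi> x))\<^sup>2 \<le> 2 * (cmod (\<phi> x))\<^sup>2 + 2 * (cmod (\<psi> x))\<^sup>2"
    by auto
qed (use assms[THEN measurable_square_integrable] in measurable)

lemma square_integrable_mult:
  assumes "m \<in> borel_measurable lebesgue" "\<And>x. cmod (m x) \<le> C" "\<phi> \<in> square_integrable"
  shows "(\<lambda>x. m x * \<phi> x) \<in> square_integrable"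
proof (rule square_integrable_bound)
  show "integrable lebesgue (\<lambda>x. C\<^sup>2 * (cmod (\<phi> x))\<^sup>2)"
    using assms by (auto simp: square_integrable_def)
  show "AE x in lebesgue. (cmod (m x * \<phi> x))\<^sup>2 \<le> C\<^sup>2 * (cmod (\<phi> x))\<^sup>2"
    using assms(2) by (auto simp: norm_mult power_mult_distrib intro!: mult_right_mono power_mono)
qed (use assms(1) assms(3)[THEN measurable_square_integrable] in measurable)

lemma square_integrable_cmult:
  "\<phi> \<in> square_integrable \<Longrightarrow> (\<lambda>x. c * \<phi> x) \<in> square_integrable"
  by (rule square_integrable_mult[where C="cmod c"]) auto

lemma square_integrable_uminus:
  "\<phi> \<in> square_integrable \<Longrightarrow> (\<lambda>x. - \<phi> x) \<in> square_integrable"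
  using square_integrable_cmult[of \<phi> "-1"] by simp

lemma square_integrable_diff:
  "\<phi> \<in> square_integrable \<Longrightarrow> \<psi> \<in> square_integrable \<Longrightarrow> (\<lambda>x. \<phi> x - \<psi> x) \<in> square_integrable"
  using square_integrable_add[OF _ square_integrable_uminus, of \<phi> \<psi>] by simp

lemma square_integrable_zero: "(\<lambda>x. 0) \<in> square_integrable"
  by (auto simp: square_integrable_def)

lemma square_integrable_cnj:
  "\<phi> \<in> square_integrable \<Longrightarrow> (\<lambda>x. cnj (\<phi> x)) \<in> square_integrable"
  by (auto simp: square_integrable_def)

lemma integrable_cnj_mult:
  assumes "\<phi> \<in> square_integrable" "\<psi> \<in> square_integrable"
  shows "integrable lebesgue (\<lambda>x. cnj (\<phi> x) * \<psi> x)"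
proof (rule Bochner_Integration.integrable_bound)
  show "integrable lebesgue (\<lambda>x. (cmod (\<phi> x))\<^sup>2 + (cmod (\<psi> x))\<^sup>2)"
    using assms by (auto simp: square_integrable_def)
  have "cmod a * cmod b \<le> (cmod a)\<^sup>2 + (cmod b)\<^sup>2" for a b
  proof -
    have "2 * (cmod a * cmod b) \<le> (cmod a)\<^sup>2 + (cmod b)\<^sup>2"
      using sum_squares_bound[of "cmod a" "cmod b"] by (simp add: mult.assoc)
    moreover have "0 \<le> cmod a * cmod b" by simp
    ultimately show ?thesis by linarith
  qed
  then show "AE x in lebesgue. norm (cnj (\<phi> x) * \<psi> x) \<le> norm ((cmod (\<phi> x))\<^sup>2 + (cmod (\<psi> x))\<^sup>2)"
    by (auto simp: norm_mult)
qed (use assms[THEN measurable_square_integrable] in measurable)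

lemma ae_class_eq_iff:
  assumes "\<phi> \<in> borel_measurable lebesgue" "\<psi> \<in> borel_measurable lebesgue"
  shows "ae_class \<phi> = ae_class \<psi> \<longleftrightarrow> (AE x in lebesgue. \<phi> x = \<psi> x)"
proof
  assume "ae_class \<phi> = ae_class \<psi>"
  moreover have "\<phi> \<in> ae_class \<phi>" using assms by (auto simp: ae_class_def)
  ultimately show "AE x in lebesgue. \<phi> x = \<psi> x" by (auto simp: ae_class_def)
next
  assume *: "AE x in lebesgue. \<phi> x = \<psi> x"
  show "ae_class \<phi> = ae_class \<psi>"
    unfolding ae_class_def
  proof (intro Collect_cong conj_cong refl iffI)
    fix \<theta> :: "real \<Rightarrow> complex"
    show "AE x in lebesgue. \<theta> x = \<psi> x" if "AE x in lebesgue. \<theta> x = \<phi> x"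
      using that * by eventually_elim simp
    show "AE x in lebesgue. \<theta> x = \<phi> x" if "AE x in lebesgue. \<theta> x = \<psi> x"
      using that * by eventually_elim simp
  qed
qed

lemma ae_rep_ae_class:
  assumes "\<phi> \<in> borel_measurable lebesgue"
  shows "ae_rep (ae_class \<phi>) \<in> borel_measurable lebesgue"
    and "AE x in lebesgue. ae_rep (ae_class \<phi>) x = \<phi> x"
proof -
  have "\<phi> \<in> ae_class \<phi>" using assms by (auto simp: ae_class_def)
  then have "ae_rep (ae_class \<phi>) \<in> ae_class \<phi>" unfolding ae_rep_def by (rule someI[of "\<lambda>\<psi>. \<psi> \<in> ae_class \<phi>"])
  then show "ae_rep (ae_class \<phi>) \<in> borel_measurable lebesgue"
    and "AE x in lebesgue. ae_rep (ae_class \<phi>) x = \<phi> x" by (auto simp: ae_class_def)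
qed

lemma square_integrable_cong_AE:
  assumes "\<phi> \<in> square_integrable" "\<psi> \<in> borel_measurable lebesgue" "AE x in lebesgue. \<psi> x = \<phi> x"
  shows "\<psi> \<in> square_integrable"
  by (rule square_integrable_bound[OF assms(2) integrable_square_integrable[OF assms(1)]])
     (use assms(3) in auto)

section \<open>The space L2 as a complete inner product space\<close>

text \<open>
  The carrier as a type: instances of \<open>real_inner\<close> and \<open>complete_space\<close> make limits, derivatives and
  the algebra of vectors available, with the real part of the complex inner product as the real one.
\<close>

typedef l2 = "carrier L2"
  by (auto simp: L2_def intro: square_integrable_zero)

definition rep :: "l2 \<Rightarrow> real \<Rightarrow> complex" where
  "rep x = ae_rep (Rep_l2 x)"

definition cls :: "(real \<Rightarrow> complex) \<Rightarrow> l2" where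
  "cls \<phi> = Abs_l2 (ae_class \<phi>)"

lemma Rep_cls: "\<phi> \<in> square_integrable \<Longrightarrow> Rep_l2 (cls \<phi>) = ae_class \<phi>"
  unfolding cls_def by (rule Abs_l2_inverse) (simp add: L2_def)

lemma rep_square_integrable: "rep x \<in> square_integrable"
proof -
  obtain \<phi> where \<phi>: "\<phi> \<in> square_integrable" "Rep_l2 x = ae_class \<phi>"
    using Rep_l2[of x] by (auto simp: L2_def)
  then have "\<phi> \<in> borel_measurable lebesgue" by (simp add: square_integrable_def)
  from ae_rep_ae_class[OF this] \<phi> show ?thesis
    unfolding rep_def by (auto intro: square_integrable_cong_AE)
qed

lemma measurable_rep [measurable]: "rep x \<in> borel_measurable lebesgue"
  using rep_square_integrable by (rule measurable_square_integrable)

lemma cls_rep: "cls (rep x) = x"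
proof -
  obtain \<phi> where \<phi>: "\<phi> \<in> square_integrable" "Rep_l2 x = ae_class \<phi>"
    using Rep_l2[of x] by (auto simp: L2_def)
  then have "\<phi> \<in> borel_measurable lebesgue" by (simp add: square_integrable_def)
  then have "ae_class (rep x) = ae_class \<phi>"
    unfolding rep_def \<phi>(2) using ae_rep_ae_class by (subst ae_class_eq_iff) auto
  then show ?thesis using \<phi>(2) by (metis cls_def Rep_l2_inverse)
qed

lemma l2_cases: obtains \<phi> where "\<phi> \<in> square_integrable" "x = cls \<phi>"
  using cls_rep rep_square_integrable by metis

lemma rep_cls: "\<phi> \<in> square_integrable \<Longrightarrow> AE t in lebesgue. rep (cls \<phi>) t = \<phi> t"
  unfolding rep_def by (simp add: Rep_cls ae_rep_ae_class measurable_square_integrable)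

lemma cls_eq_iff:
  assumes "\<phi> \<in> square_integrable" "\<psi> \<in> square_integrable"
  shows "cls \<phi> = cls \<psi> \<longleftrightarrow> (AE t in lebesgue. \<phi> t = \<psi> t)"
proof -
  have "cls \<phi> = cls \<psi> \<longleftrightarrow> ae_class \<phi> = ae_class \<psi>"
    using assms by (metis Rep_cls cls_def)
  then show ?thesis
    using assms by (simp add: ae_class_eq_iff measurable_square_integrable)
qed

lemma cls_eqI:
  "\<phi> \<in> square_integrable \<Longrightarrow> \<psi> \<in> square_integrable \<Longrightarrow> AE t in lebesgue. \<phi> t = \<psi> t \<Longrightarrow> cls \<phi> = cls \<psi>"
  by (simp add: cls_eq_iff)

definition cinner :: "l2 \<Rightarrow> l2 \<Rightarrow> complex" where
  "cinner x y = (LINT t|lebesgue. cnj (rep x t) * rep y t)"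

definition cscale :: "complex \<Rightarrow> l2 \<Rightarrow> l2" where
  "cscale c x = cls (\<lambda>t. c * rep x t)"

lemma cinner_cls:
  assumes "\<phi> \<in> square_integrable" "\<psi> \<in> square_integrable"
  shows "cinner (cls \<phi>) (cls \<psi>) = (LINT t|lebesgue. cnj (\<phi> t) * \<psi> t)"
  unfolding cinner_def
proof (rule integral_cong_AE)
  show "AE t in lebesgue. cnj (rep (cls \<phi>) t) * rep (cls \<psi>) t = cnj (\<phi> t) * \<psi> t"
    using rep_cls[OF assms(1)] rep_cls[OF assms(2)] by eventually_elim simp
qed (use assms[THEN measurable_square_integrable] in measurable)

instantiation l2 :: real_inner
begin

definition "0 = cls (\<lambda>t. 0)"
definition "x + y = cls (\<lambda>t. rep x t + rep y t)"
definition "x - y = cls (\<lambda>t. rep x t - rep y t)"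
definition "- x = cls (\<lambda>t. - rep x t)"
definition "r *\<^sub>R x = cls (\<lambda>t. complex_of_real r * rep x t)"
definition "inner x y = Re (cinner x y)"
definition "norm (x :: l2) = sqrt (inner x x)"
definition "dist (x :: l2) y = norm (x - y)"
definition "sgn (x :: l2) = inverse (norm x) *\<^sub>R x"
definition [code del]: "(uniformity :: (l2 \<times> l2) filter) = (INF e\<in>{0<..}. principal {(x, y). dist x y < e})"
definition [code del]: "open (S :: l2 set) \<longleftrightarrow> (\<forall>x\<in>S. \<forall>\<^sub>F (x', y) in uniformity. x' = x \<longrightarrow> y \<in> S)"

lemma cls_add:
  assumes "\<phi> \<in> square_integrable" "\<psi> \<in> square_integrable"
  shows "cls \<phi> + cls \<psi> = cls (\<lambda>t. \<phi> t + \<psi> t)"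
  unfolding plus_l2_def
proof (rule cls_eqI)
  show "AE t in lebesgue. rep (cls \<phi>) t + rep (cls \<psi>) t = \<phi> t + \<psi> t"
    using rep_cls[OF assms(1)] rep_cls[OF assms(2)] by eventually_elim simp
qed (intro square_integrable_add rep_square_integrable assms)+

lemma cls_diff:
  assumes "\<phi> \<in> square_integrable" "\<psi> \<in> square_integrable"
  shows "cls \<phi> - cls \<psi> = cls (\<lambda>t. \<phi> t - \<psi> t)"
  unfolding minus_l2_def
proof (rule cls_eqI)
  show "AE t in lebesgue. rep (cls \<phi>) t - rep (cls \<psi>) t = \<phi> t - \<psi> t"
    using rep_cls[OF assms(1)] rep_cls[OF assms(2)] by eventually_elim simp
qed (intro square_integrable_diff rep_square_integrable assms)+

lemma cls_uminus:
  assumes "\<phi> \<in> square_integrable"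
  shows "- cls \<phi> = cls (\<lambda>t. - \<phi> t)"
  unfolding uminus_l2_def
proof (rule cls_eqI)
  show "AE t in lebesgue. - rep (cls \<phi>) t = - \<phi> t"
    using rep_cls[OF assms(1)] by eventually_elim simp
qed (intro square_integrable_uminus rep_square_integrable assms)+

lemma cls_cscale:
  assumes "\<phi> \<in> square_integrable"
  shows "cscale c (cls \<phi>) = cls (\<lambda>t. c * \<phi> t)"
  unfolding cscale_def
proof (rule cls_eqI)
  show "AE t in lebesgue. c * rep (cls \<phi>) t = c * \<phi> t"
    using rep_cls[OF assms(1)] by eventually_elim simp
qed (intro square_integrable_cmult rep_square_integrable assms)+

lemma scaleR_cscale: "r *\<^sub>R x = cscale (complex_of_real r) x"
  by (simp add: scaleR_l2_def cscale_def)

lemmas cls_arith = cls_add cls_diff cls_uminus cls_cscale zero_l2_def scaleR_cscale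
  square_integrable_add square_integrable_diff square_integrable_uminus square_integrable_cmult
  square_integrable_zero

lemma cinner_add_right: "cinner x (y + z) = cinner x y + cinner x z"
proof -
  obtain \<phi> \<psi> \<theta> where "\<phi> \<in> square_integrable" "x = cls \<phi>" "\<psi> \<in> square_integrable" "y = cls \<psi>"
    "\<theta> \<in> square_integrable" "z = cls \<theta>" by (metis l2_cases)
  then show ?thesis
    by (simp add: cls_arith cinner_cls integrable_cnj_mult distrib_left)
qed

lemma cinner_cscale_right: "cinner x (cscale c y) = c * cinner x y"
proof -
  obtain \<phi> \<psi> where "\<phi> \<in> square_integrable" "x = cls \<phi>" "\<psi> \<in> square_integrable" "y = cls \<psi>"
    by (metis l2_cases)
  then show ?thesis
    by (simp add: cls_arith cinner_cls mult.left_commute[of _ c])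
qed

lemma cinner_commute: "cinner y x = cnj (cinner x y)"
  unfolding cinner_def Bochner_Integration.integral_cnj[symmetric] by (simp add: mult.commute)

lemma cinner_self: "cinner x x = complex_of_real (LINT t|lebesgue. (cmod (rep x t))\<^sup>2)"
proof -
  have "cnj z * z = complex_of_real ((cmod z)\<^sup>2)" for z
    using complex_norm_square[of z] by (simp add: mult.commute)
  then show ?thesis by (simp only: cinner_def integral_complex_of_real)
qed

lemma cinner_self_eq_0:
  assumes "cinner x x = 0" shows "x = 0"
proof -
  have "(LINT t|lebesgue. (cmod (rep x t))\<^sup>2) = 0"
    using assms by (simp add: cinner_self)
  then have "AE t in lebesgue. (cmod (rep x t))\<^sup>2 = 0"
    using integral_nonneg_eq_0_iff_AE[OF integrable_square_integrable[OF rep_square_integrable[of x]]]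
    by simp
  then have "cls (rep x) = cls (\<lambda>t. 0)"
    by (intro cls_eqI rep_square_integrable square_integrable_zero) auto
  then show ?thesis by (simp add: cls_rep zero_l2_def)
qed

instance
proof
  fix x y z :: l2 and a b :: real
  obtain \<phi> \<psi> \<theta> where \<phi>: "\<phi> \<in> square_integrable" "x = cls \<phi>"
    and \<psi>: "\<psi> \<in> square_integrable" "y = cls \<psi>"
    and \<theta>: "\<theta> \<in> square_integrable" "z = cls \<theta>" by (metis l2_cases)
  note * = \<phi> \<psi> \<theta> cls_arith
  show "x + y + z = x + (y + z)" by (simp add: * add.assoc)
  show "x + y = y + x" by (simp add: * add.commute)
  show "0 + x = x" "- x + x = 0" "x - y = x + - y" by (simp_all add: *)
  show "a *\<^sub>R (x + y) = a *\<^sub>R x + a *\<^sub>R y" "(a + b) *\<^sub>R x = a *\<^sub>R x + b *\<^sub>R x"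
    "a *\<^sub>R b *\<^sub>R x = (a * b) *\<^sub>R x" "1 *\<^sub>R x = x"
    by (simp_all add: * distrib_left distrib_right mult.assoc)
  show "dist x y = norm (x - y)" "sgn x = scaleR (inverse (norm x)) x"
    by (simp_all add: dist_l2_def sgn_l2_def)
  show "uniformity = (INF e\<in>{0<..}. principal {(x, y). dist (x :: l2) y < e})"
    by (rule uniformity_l2_def)
  show "\<And>S :: l2 set. open S \<longleftrightarrow> (\<forall>x\<in>S. \<forall>\<^sub>F (x', y) in uniformity. x' = x \<longrightarrow> y \<in> S)"
    by (rule open_l2_def)
  show sym: "inner x y = inner y x" for x y :: l2
    unfolding inner_l2_def by (subst cinner_commute) simp
  show "inner (x + y) z = inner x z + inner y z"
    by (simp only: sym[of _ z]) (simp add: inner_l2_def cinner_add_right)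
  show "inner (a *\<^sub>R x) y = a * inner x y"
    by (simp only: sym[of _ y]) (simp add: inner_l2_def scaleR_cscale cinner_cscale_right)
  show "0 \<le> inner x x"
    by (simp add: inner_l2_def cinner_self)
  show "inner x x = 0 \<longleftrightarrow> x = 0"
  proof
    assume "inner x x = 0"
    then have "cinner x x = 0" by (simp add: inner_l2_def cinner_self)
    then show "x = 0" by (rule cinner_self_eq_0)
  next
    assume "x = 0"
    then show "inner x x = 0" by (simp add: inner_l2_def zero_l2_def cinner_cls square_integrable_zero)
  qed
  show "norm x = sqrt (inner x x)" by (rule norm_l2_def)
qed

end

lemma norm_power2: "(norm x)\<^sup>2 = (LINT t|lebesgue. (cmod (rep x t))\<^sup>2)"
  by (simp add: power2_norm_eq_inner inner_l2_def cinner_self)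

lemma norm_cls:
  assumes "\<phi> \<in> square_integrable"
  shows "(norm (cls \<phi>))\<^sup>2 = (LINT t|lebesgue. (cmod (\<phi> t))\<^sup>2)"
  unfolding norm_power2
proof (rule integral_cong_AE)
  show "AE t in lebesgue. (cmod (rep (cls \<phi>) t))\<^sup>2 = (cmod (\<phi> t))\<^sup>2"
    using rep_cls[OF assms] by eventually_elim simp
qed (use assms[THEN measurable_square_integrable] in measurable)

lemma cscale_simps:
  "cscale c (x + y) = cscale c x + cscale c y"
  "cscale (c + d) x = cscale c x + cscale d x"
  "cscale c (cscale d x) = cscale (c * d) x"
  "cscale 1 x = x"
proof -
  obtain \<phi> \<psi> where "\<phi> \<in> square_integrable" "x = cls \<phi>" "\<psi> \<in> square_integrable" "y = cls \<psi>"
    by (metis l2_cases)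
  then show "cscale c (x + y) = cscale c x + cscale c y"
    "cscale (c + d) x = cscale c x + cscale d x"
    "cscale c (cscale d x) = cscale (c * d) x"
    "cscale 1 x = x"
    by (simp_all add: cls_arith distrib_left distrib_right mult.assoc)
qed

lemma cinner_self_norm: "cinner x x = complex_of_real ((norm x)\<^sup>2)"
  by (simp add: norm_power2 cinner_self)

text \<open>
  Riesz--Fischer. A Cauchy sequence has a subsequence whose steps have norm at most \<open>(1/2) ^ k\<close>. The sum of
  the squared steps, weighted by \<open>2 ^ k\<close>, still has a finite integral, so it is finite almost everywhere;
  there the subsequence converges pointwise, and Fatou's lemma turns this into convergence in norm.
\<close>

instance l2 :: complete_space
proof
  fix X :: "nat \<Rightarrow> l2"
  assume X: "Cauchy X"
  have "\<exists>N. \<forall>m\<ge>N. \<forall>n\<ge>N. dist (X m) (X n) < (1/2) ^ k" for k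
    using X by (auto simp: Cauchy_def)
  then obtain N where N: "\<And>k m n. m \<ge> N k \<Longrightarrow> n \<ge> N k \<Longrightarrow> dist (X m) (X n) < (1/2) ^ k"
    by metis
  define r where "r k = (\<Sum>i\<le>k. N i)" for k
  have r_N: "N k \<le> r k" for k unfolding r_def by (rule member_le_sum) auto
  have r_mono: "r k \<le> r (Suc k)" for k unfolding r_def by simp
  define u where "u k = rep (X (r k))" for k
  have u [measurable]: "u k \<in> borel_measurable lebesgue" for k by (simp add: u_def)
  have u_sq: "u k \<in> square_integrable" for k by (simp add: u_def rep_square_integrable)
  have cls_u: "cls (u k) = X (r k)" for k by (simp add: u_def cls_rep)
  have d_int: "integrable lebesgue (\<lambda>t. (cmod (u j t - u k t))\<^sup>2)" for j k
    by (rule integrable_square_integrable[OF square_integrable_diff[OF u_sq u_sq]])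
  have d_norm: "(LINT t|lebesgue. (cmod (u j t - u k t))\<^sup>2) = (dist (X (r j)) (X (r k)))\<^sup>2" for j k
    unfolding dist_norm using norm_cls[OF square_integrable_diff[OF u_sq u_sq], of j k]
    by (simp add: cls_diff[OF u_sq u_sq, symmetric] cls_u)
  have nn: "(\<integral>\<^sup>+ t. ennreal (2 ^ k * (cmod (u (Suc k) t - u k t))\<^sup>2) \<partial>lebesgue) \<le> ennreal ((1/2) ^ k)" for k
  proof -
    have "dist (X (r (Suc k))) (X (r k)) \<le> (1/2) ^ k"
      using N[where k=k, of "r (Suc k)" "r k"] r_N[of k] r_mono[of k] by auto
    then have "(dist (X (r (Suc k))) (X (r k)))\<^sup>2 \<le> ((1/2) ^ k)\<^sup>2"
      by (intro power_mono) auto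
    then have "2 ^ k * (dist (X (r (Suc k))) (X (r k)))\<^sup>2 \<le> 2 ^ k * ((1/2) ^ k)\<^sup>2"
      by simp
    also have "\<dots> = (1/2) ^ k" by (simp add: power2_eq_square power_one_over)
    finally have *: "2 ^ k * (dist (X (r (Suc k))) (X (r k)))\<^sup>2 \<le> (1/2) ^ k" .
    have "(\<integral>\<^sup>+ t. ennreal (2 ^ k * (cmod (u (Suc k) t - u k t))\<^sup>2) \<partial>lebesgue) =
      ennreal (LINT t|lebesgue. 2 ^ k * (cmod (u (Suc k) t - u k t))\<^sup>2)"
      by (rule nn_integral_eq_integral) (auto intro!: integrable_mult_right d_int)
    also have "\<dots> \<le> ennreal ((1/2) ^ k)"
      using * by (intro ennreal_leI) (simp add: d_norm)
    finally show ?thesis .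
  qed
  have "(\<integral>\<^sup>+ t. (\<Sum>k. ennreal (2 ^ k * (cmod (u (Suc k) t - u k t))\<^sup>2)) \<partial>lebesgue) =
     (\<Sum>k. \<integral>\<^sup>+ t. ennreal (2 ^ k * (cmod (u (Suc k) t - u k t))\<^sup>2) \<partial>lebesgue)"
    by (rule nn_integral_suminf) measurable
  also have "\<dots> \<le> (\<Sum>k. ennreal ((1/2) ^ k))"
    by (intro suminf_le nn) auto
  also have "\<dots> = ennreal 2"
  proof (rule suminf_ennreal_eq)
    show "(\<lambda>k. (1/2::real) ^ k) sums 2" using geometric_sums[of "1/2::real"] by simp
  qed simp
  finally have "(\<integral>\<^sup>+ t. (\<Sum>k. ennreal (2 ^ k * (cmod (u (Suc k) t - u k t))\<^sup>2)) \<partial>lebesgue) \<noteq> \<infinity>"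
    by (auto simp: top_unique)
  then have "AE t in lebesgue. (\<Sum>k. ennreal (2 ^ k * (cmod (u (Suc k) t - u k t))\<^sup>2)) \<noteq> \<infinity>"
    by (intro nn_integral_PInf_AE) measurable
  then have conv: "AE t in lebesgue. convergent (\<lambda>k. u k t)"
  proof eventually_elim
    fix t assume "(\<Sum>k. ennreal (2 ^ k * (cmod (u (Suc k) t - u k t))\<^sup>2)) \<noteq> \<infinity>"
    then have s: "summable (\<lambda>k. 2 ^ k * (cmod (u (Suc k) t - u k t))\<^sup>2)"
      by (intro summable_suminf_not_top) auto
    \<comment> \<open>The arithmetic-geometric mean inequality splits the steps into a geometric and a weighted part.\<close>
    have "cmod (u (Suc k) t - u k t) \<le> (1/2) ^ k + 2 ^ k * (cmod (u (Suc k) t - u k t))\<^sup>2" for k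
    proof -
      define c where "c = cmod (u (Suc k) t - u k t)"
      have "2 * c \<le> (1/2) ^ k + 2 ^ k * c\<^sup>2"
      proof -
        have "0 \<le> (1/2::real) ^ k * (2 ^ k * c - 1)\<^sup>2" by simp
        also have "\<dots> = (1/2) ^ k * 2 ^ k * 2 ^ k * c\<^sup>2 - 2 * ((1/2) ^ k * 2 ^ k) * c + (1/2) ^ k"
          by (simp add: power2_eq_square algebra_simps)
        also have "(1/2::real) ^ k * 2 ^ k = 1" by (simp add: power_one_over)
        finally show ?thesis by simp
      qed
      moreover have "0 \<le> c" by (simp add: c_def)
      ultimately show ?thesis unfolding c_def[symmetric] by linarith
    qed
    then have "\<exists>N. \<forall>k\<ge>N. norm (u (Suc k) t - u k t) \<le> (1/2) ^ k + 2 ^ k * (cmod (u (Suc k) t - u k t))\<^sup>2"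
      by blast
    moreover have "summable (\<lambda>k. (1/2) ^ k + 2 ^ k * (cmod (u (Suc k) t - u k t))\<^sup>2)"
      by (rule summable_add[OF summable_geometric s]) simp
    ultimately have "summable (\<lambda>k. u (Suc k) t - u k t)"
      by (rule summable_comparison_test)
    then have "convergent (\<lambda>n. \<Sum>k<n. u (Suc k) t - u k t)"
      by (simp add: summable_iff_convergent)
    then have "convergent (\<lambda>n. u n t - u 0 t)"
      by (simp add: sum_lessThan_telescope[of "\<lambda>k. u k t"])
    then show "convergent (\<lambda>k. u k t)"
      by (simp add: convergent_diff_const_right_iff)
  qed
  define v where "v t = lim (\<lambda>k. u k t)" for t
  have v [measurable]: "v \<in> borel_measurable lebesgue" unfolding v_def by measurable
  have lim: "AE t in lebesgue. (\<lambda>k. u k t) \<longlonglongrightarrow> v t"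
    using conv by eventually_elim (simp add: v_def convergent_LIMSEQ_iff)
  have bound: "(\<integral>\<^sup>+ t. ennreal ((cmod (v t - u k t))\<^sup>2) \<partial>lebesgue) \<le> ennreal (((1/2) ^ k)\<^sup>2)" for k
  proof -
    have "(\<integral>\<^sup>+ t. ennreal ((cmod (v t - u k t))\<^sup>2) \<partial>lebesgue) =
      (\<integral>\<^sup>+ t. liminf (\<lambda>j. ennreal ((cmod (u j t - u k t))\<^sup>2)) \<partial>lebesgue)"
    proof (rule nn_integral_cong_AE)
      show "AE t in lebesgue. ennreal ((cmod (v t - u k t))\<^sup>2) =
        liminf (\<lambda>j. ennreal ((cmod (u j t - u k t))\<^sup>2))"
        using lim
      proof eventually_elim
        fix t assume "(\<lambda>k. u k t) \<longlonglongrightarrow> v t"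
        then have "(\<lambda>j. ennreal ((cmod (u j t - u k t))\<^sup>2)) \<longlonglongrightarrow> ennreal ((cmod (v t - u k t))\<^sup>2)"
          by (intro tendsto_intros tendsto_ennrealI)
        then show "ennreal ((cmod (v t - u k t))\<^sup>2) = liminf (\<lambda>j. ennreal ((cmod (u j t - u k t))\<^sup>2))"
          using lim_imp_Liminf[OF sequentially_bot] by metis
      qed
    qed
    also have "\<dots> \<le> liminf (\<lambda>j. \<integral>\<^sup>+ t. ennreal ((cmod (u j t - u k t))\<^sup>2) \<partial>lebesgue)"
      by (rule nn_integral_liminf) measurable
    also have "\<dots> \<le> liminf (\<lambda>j. ennreal (((1/2) ^ k)\<^sup>2))"
    proof (rule Liminf_mono)
      show "\<forall>\<^sub>F j in sequentially. (\<integral>\<^sup>+ t. ennreal ((cmod (u j t - u k t))\<^sup>2) \<partial>lebesgue) \<le> ennreal (((1/2) ^ k)\<^sup>2)"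
        using eventually_ge_at_top[of k]
      proof eventually_elim
        fix j assume "k \<le> j"
        then have "r k \<le> r j" using r_mono by (simp add: lift_Suc_mono_le)
        then have "dist (X (r j)) (X (r k)) \<le> (1/2) ^ k"
          using N[where k=k, of "r j" "r k"] r_N[of k] by auto
        then have "(dist (X (r j)) (X (r k)))\<^sup>2 \<le> ((1/2) ^ k)\<^sup>2" by (intro power_mono) auto
        then show "(\<integral>\<^sup>+ t. ennreal ((cmod (u j t - u k t))\<^sup>2) \<partial>lebesgue) \<le> ennreal (((1/2) ^ k)\<^sup>2)"
          by (subst nn_integral_eq_integral[OF d_int]) (auto simp: d_norm intro!: ennreal_leI)
      qed
    qed
    finally show ?thesis by (simp add: Liminf_const)
  qed
  have vu_int: "integrable lebesgue (\<lambda>t. (cmod (v t - u k t))\<^sup>2)" for k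
    using bound[of k] by (intro integrableI_bounded) (auto simp: le_less_trans[OF _ ennreal_less_top])
  then have vu: "(\<lambda>t. v t - u k t) \<in> square_integrable" for k
    unfolding square_integrable_def by auto
  have v_sq: "v \<in> square_integrable"
    using square_integrable_add[OF vu[of 0] u_sq[of 0]] by simp
  have d: "dist (cls v) (X (r k)) \<le> (1/2) ^ k" for k
  proof -
    have "(dist (cls v) (X (r k)))\<^sup>2 = (LINT t|lebesgue. (cmod (v t - u k t))\<^sup>2)"
      unfolding dist_norm cls_u[symmetric] by (simp add: cls_diff[OF v_sq u_sq] norm_cls[OF vu])
    also have "\<dots> \<le> ((1/2) ^ k)\<^sup>2"
      using bound[of k] by (simp add: nn_integral_eq_integral[OF vu_int])
    finally show ?thesis by (rule power2_le_imp_le) simp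
  qed
  have "X \<longlonglongrightarrow> cls v"
  proof (rule metric_LIMSEQ_I)
    fix e :: real assume "0 < e"
    then obtain k where k: "(1/2) ^ k < e / 2" using real_arch_pow_inv[of "e/2" "1/2"] by auto
    show "\<exists>no. \<forall>n\<ge>no. dist (X n) (cls v) < e"
    proof (intro exI[of _ "r k"] allI impI)
      fix n assume "r k \<le> n"
      then have "dist (X n) (X (r k)) < (1/2) ^ k"
        using N[where k=k, of n "r k"] r_N[of k] by auto
      with d[of k] k show "dist (X n) (cls v) < e"
        using dist_triangle2[of "X n" "cls v" "X (r k)"] by simp
    qed
  qed
  then show "convergent X" by (auto simp: convergent_def)
qed

section \<open>L2 as a Hilbert space over a record\<close>

lemma L2_simps:
  "carrier L2 = range Rep_l2"
  "Rep_l2 x \<oplus>\<^bsub>L2\<^esub> Rep_l2 y = Rep_l2 (x + y)"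
  "c \<odot>\<^bsub>L2\<^esub> Rep_l2 x = Rep_l2 (cscale c x)"
  "\<zero>\<^bsub>L2\<^esub> = Rep_l2 0"
  "inprod L2 (Rep_l2 x) (Rep_l2 y) = cinner x y"
proof -
  show "carrier L2 = range Rep_l2"
    by (simp add: type_definition.Rep_range[OF type_definition_l2])
  have sq: "(\<lambda>t. rep x t + rep y t) \<in> square_integrable" "(\<lambda>t. c * rep x t) \<in> square_integrable"
    by (intro square_integrable_add square_integrable_cmult rep_square_integrable)+
  show "Rep_l2 x \<oplus>\<^bsub>L2\<^esub> Rep_l2 y = Rep_l2 (x + y)" "c \<odot>\<^bsub>L2\<^esub> Rep_l2 x = Rep_l2 (cscale c x)"
    using sq by (simp_all add: plus_l2_def cscale_def Rep_cls) (simp_all add: L2_def rep_def)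
  show "\<zero>\<^bsub>L2\<^esub> = Rep_l2 0"
    by (simp add: zero_l2_def Rep_cls square_integrable_zero) (simp add: L2_def)
  show "inprod L2 (Rep_l2 x) (Rep_l2 y) = cinner x y"
    by (simp add: L2_def cinner_def rep_def)
qed

lemma abelian_group_L2: "abelian_group L2"
proof (rule abelian_groupI)
  fix X assume "X \<in> carrier L2"
  then obtain x where x: "X = Rep_l2 x" by (auto simp: L2_simps)
  show "\<exists>Y\<in>carrier L2. Y \<oplus>\<^bsub>L2\<^esub> X = \<zero>\<^bsub>L2\<^esub>"
    by (rule bexI[of _ "Rep_l2 (- x)"]) (auto simp: x L2_simps)
qed (auto simp: L2_simps add_ac)

lemma cring_complex_field: "cring complex_field"
proof (rule cringI)
  show "abelian_group complex_field"
  proof (rule abelian_groupI)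
    fix x :: complex
    show "\<exists>y\<in>carrier complex_field. y \<oplus>\<^bsub>complex_field\<^esub> x = \<zero>\<^bsub>complex_field\<^esub>"
      by (rule bexI[of _ "- x"]) (auto simp: complex_field_def)
  qed (auto simp: complex_field_def)
  show "comm_monoid complex_field"
    by (rule comm_monoidI) (auto simp: complex_field_def)
qed (auto simp: complex_field_def distrib_right)

lemma module_L2: "module complex_field L2"
  by (rule moduleI[OF cring_complex_field abelian_group_L2])
     (auto simp: L2_simps complex_field_def cscale_simps)

lemma L2_minus: "Rep_l2 x \<ominus>\<^bsub>L2\<^esub> Rep_l2 y = Rep_l2 (x - y)"
proof -
  interpret abelian_group L2 by (rule abelian_group_L2)
  have "\<ominus>\<^bsub>L2\<^esub> Rep_l2 y = Rep_l2 (- y)"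
    by (rule minus_equality) (auto simp: L2_simps)
  then show ?thesis by (simp add: minus_eq L2_simps)
qed

lemma hnorm_L2: "hnorm L2 (Rep_l2 x) = norm x"
  by (simp add: hnorm_def L2_simps norm_eq_sqrt_inner inner_l2_def)

lemma hilbert_space_L2: "hilbert_space L2"
proof (intro hilbert_space.intro module_L2 hilbert_space_axioms.intro)
  fix s :: "nat \<Rightarrow> (real \<Rightarrow> complex) set"
  assume s: "\<And>n. s n \<in> carrier L2"
    and C: "\<forall>e>0. \<exists>N. \<forall>m\<ge>N. \<forall>n\<ge>N. hnorm L2 (s m \<ominus>\<^bsub>L2\<^esub> s n) < e"
  have "\<forall>n. \<exists>x. s n = Rep_l2 x" using s by (auto simp: L2_simps)
  then obtain x where x: "\<And>n. s n = Rep_l2 (x n)" by metis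
  have "Cauchy x" using C by (simp add: x L2_minus hnorm_L2 Cauchy_def dist_norm)
  then obtain y where "x \<longlonglongrightarrow> y" by (auto simp: Cauchy_convergent_iff convergent_def)
  then have "(\<lambda>n. norm (x n - y)) \<longlonglongrightarrow> 0" by (simp add: LIM_zero tendsto_norm_zero)
  then show "\<exists>X\<in>carrier L2. (\<lambda>n. hnorm L2 (s n \<ominus>\<^bsub>L2\<^esub> X)) \<longlonglongrightarrow> 0"
    by (intro bexI[of _ "Rep_l2 y"]) (auto simp: x L2_minus hnorm_L2 L2_simps)
next
  fix X assume "X \<in> carrier L2"
  then obtain x where x: "X = Rep_l2 x" by (auto simp: L2_simps)
  show "inprod L2 X X \<in> \<real>\<^sub>\<ge>\<^sub>0" by (simp add: x L2_simps cinner_self_norm)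
  show "inprod L2 X X = 0 \<Longrightarrow> X = \<zero>\<^bsub>L2\<^esub>" by (auto simp: x L2_simps dest: cinner_self_eq_0)
next
  fix X Y assume "X \<in> carrier L2" "Y \<in> carrier L2"
  then show "inprod L2 Y X = cnj (inprod L2 X Y)"
    by (auto simp: L2_simps intro: cinner_commute)
qed (auto simp: L2_simps cinner_add_right cinner_cscale_right)

section \<open>Multiplication operators and their unitary conjugates\<close>

definition on_carrier :: "(l2 \<Rightarrow> l2) \<Rightarrow> (real \<Rightarrow> complex) set \<Rightarrow> (real \<Rightarrow> complex) set" where
  "on_carrier T X = Rep_l2 (T (Abs_l2 X))"

lemma on_carrier_Rep [simp]: "on_carrier T (Rep_l2 x) = Rep_l2 (T x)"
  by (simp add: on_carrier_def Rep_l2_inverse)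

definition clinear :: "(l2 \<Rightarrow> l2) \<Rightarrow> bool" where
  "clinear T \<longleftrightarrow> (\<forall>x y. T (x + y) = T x + T y) \<and> (\<forall>c x. T (cscale c x) = cscale c (T x))"

lemma clinearD:
  assumes "clinear T"
  shows "T (x + y) = T x + T y" "T (cscale c x) = cscale c (T x)" "T (x - y) = T x - T y"
    "T (r *\<^sub>R x) = r *\<^sub>R T x" "T 0 = 0"
proof -
  show *: "T (x + y) = T x + T y" "T (cscale c x) = cscale c (T x)" for x y c
    using assms by (auto simp: clinear_def)
  show "T (r *\<^sub>R x) = r *\<^sub>R T x" by (simp add: scaleR_cscale *)
  show "T (x - y) = T x - T y" using *(1)[of "x - y" y] by (simp add: algebra_simps)
  show "T 0 = 0" using *(1)[of 0 0] by simp
qed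

lemma clinear_bounded_linear:
  assumes "clinear T" "\<And>x. norm (T x) \<le> C * norm x"
  shows "bounded_linear T"
  by (rule bounded_linear_intro[of T C]) (auto simp: clinearD[OF assms(1)] assms(2) mult.commute)

lemma bounded_operator_on_carrier:
  assumes "clinear T" "\<And>x. norm (T x) \<le> C * norm x"
  shows "bounded_operator L2 (on_carrier T)"
  unfolding bounded_operator_def
  using assms(2) by (auto simp: L2_simps clinearD[OF assms(1)] hnorm_L2)

lemma cinner_diff_right: "cinner x (y - z) = cinner x y - cinner x z"
  using cinner_add_right[of x "y - z" z] by simp

lemma cinner_cscale_left: "cinner (cscale c x) y = cnj c * cinner x y"
  by (metis cinner_commute cinner_cscale_right complex_cnj_mult)

lemma Im_cinner: "Im (cinner x y) = inner (cscale \<i> x) y"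
  by (simp add: inner_l2_def cinner_cscale_left)

definition multiplier :: "(real \<Rightarrow> complex) \<Rightarrow> bool" where
  "multiplier m \<longleftrightarrow> m \<in> borel_measurable lebesgue \<and> (\<exists>C. \<forall>t. cmod (m t) \<le> C)"

definition mulop :: "(real \<Rightarrow> complex) \<Rightarrow> l2 \<Rightarrow> l2" where
  "mulop m x = cls (\<lambda>t. m t * rep x t)"

lemma multiplierI: "m \<in> borel_measurable lebesgue \<Longrightarrow> (\<And>t. cmod (m t) \<le> C) \<Longrightarrow> multiplier m"
  by (auto simp: multiplier_def)

lemma multiplier_mult:
  assumes "multiplier m" "multiplier n" shows "multiplier (\<lambda>t. m t * n t)"
proof -
  obtain C D where "\<And>t. cmod (m t) \<le> C" "\<And>t. cmod (n t) \<le> D" using assms by (auto simp: multiplier_def)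
  then have "cmod (m t * n t) \<le> C * D" for t
    unfolding norm_mult by (intro mult_mono) (auto intro: order_trans[OF norm_ge_zero])
  moreover have [measurable]: "m \<in> borel_measurable lebesgue" "n \<in> borel_measurable lebesgue"
    using assms by (auto simp: multiplier_def)
  ultimately show ?thesis by (intro multiplierI[where C="C * D"]) auto
qed

lemma multiplier_add:
  assumes "multiplier m" "multiplier n" shows "multiplier (\<lambda>t. m t + n t)"
proof -
  obtain C D where "\<And>t. cmod (m t) \<le> C" "\<And>t. cmod (n t) \<le> D" using assms by (auto simp: multiplier_def)
  then have "cmod (m t + n t) \<le> C + D" for t
    by (intro norm_triangle_le add_mono) auto
  moreover have [measurable]: "m \<in> borel_measurable lebesgue" "n \<in> borel_measurable lebesgue"
    using assms by (auto simp: multiplier_def)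
  ultimately show ?thesis by (intro multiplierI[where C="C + D"]) auto
qed

lemma multiplier_const: "multiplier (\<lambda>t. c)"
  by (rule multiplierI[where C="cmod c"]) auto

lemma multiplier_cnj: "multiplier m \<Longrightarrow> multiplier (\<lambda>t. cnj (m t))"
  by (auto simp: multiplier_def)

lemma multiplier_of_real:
  "h \<in> borel_measurable lebesgue \<Longrightarrow> bounded (range h) \<Longrightarrow> multiplier (\<lambda>t. complex_of_real (h t))"
  by (auto simp: multiplier_def bounded_iff)

lemma sq_mult: "multiplier m \<Longrightarrow> \<phi> \<in> square_integrable \<Longrightarrow> (\<lambda>t. m t * \<phi> t) \<in> square_integrable"
  by (auto simp: multiplier_def intro: square_integrable_mult)

lemma mulop_cls:
  assumes "multiplier m" "\<phi> \<in> square_integrable"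
  shows "mulop m (cls \<phi>) = cls (\<lambda>t. m t * \<phi> t)"
  unfolding mulop_def
proof (rule cls_eqI)
  show "AE t in lebesgue. m t * rep (cls \<phi>) t = m t * \<phi> t"
    using rep_cls[OF assms(2)] by eventually_elim simp
qed (intro sq_mult rep_square_integrable assms)+

lemma mulop_simps:
  assumes "multiplier m"
  shows "mulop m (x + y) = mulop m x + mulop m y"
    "mulop m (cscale c x) = cscale c (mulop m x)"
    "multiplier n \<Longrightarrow> mulop m (mulop n x) = mulop (\<lambda>t. m t * n t) x"
    "multiplier n \<Longrightarrow> mulop (\<lambda>t. m t + n t) x = mulop m x + mulop n x"
    "cinner (mulop m x) y = cinner x (mulop (\<lambda>t. cnj (m t)) y)"
proof -
  obtain \<phi> \<psi> where *: "\<phi> \<in> square_integrable" "x = cls \<phi>" "\<psi> \<in> square_integrable" "y = cls \<psi>"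
    by (metis l2_cases)
  note ** = * assms cls_arith mulop_cls sq_mult multiplier_const multiplier_mult multiplier_add
     multiplier_cnj
  show "mulop m (x + y) = mulop m x + mulop m y"
    "mulop m (cscale c x) = cscale c (mulop m x)"
    by (simp_all add: ** distrib_left mult.left_commute)
  show "multiplier n \<Longrightarrow> mulop m (mulop n x) = mulop (\<lambda>t. m t * n t) x"
    "multiplier n \<Longrightarrow> mulop (\<lambda>t. m t + n t) x = mulop m x + mulop n x"
    by (simp_all add: ** distrib_right mult.assoc)
  show "cinner (mulop m x) y = cinner x (mulop (\<lambda>t. cnj (m t)) y)"
    by (simp add: ** cinner_cls mult.assoc mult.left_commute)
qed

lemma mulop_const: "mulop (\<lambda>t. c) x = cscale c x"
  by (simp add: mulop_def cscale_def)

lemma clinear_mulop: "multiplier m \<Longrightarrow> clinear (mulop m)"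
  by (simp add: clinear_def mulop_simps)

lemma norm_mulop:
  assumes "multiplier m" "\<And>t. cmod (m t) \<le> C"
  shows "norm (mulop m x) \<le> C * norm x"
proof -
  have C: "0 \<le> C" using assms(2)[of 0] norm_ge_zero order_trans by blast
  have "(norm (mulop m x))\<^sup>2 = (LINT t|lebesgue. (cmod (m t * rep x t))\<^sup>2)"
    unfolding mulop_def by (rule norm_cls) (intro sq_mult assms rep_square_integrable)
  also have "\<dots> \<le> (LINT t|lebesgue. C\<^sup>2 * (cmod (rep x t))\<^sup>2)"
  proof (rule integral_mono)
    show "integrable lebesgue (\<lambda>t. (cmod (m t * rep x t))\<^sup>2)"
      by (intro integrable_square_integrable sq_mult assms rep_square_integrable)
    show "integrable lebesgue (\<lambda>t. C\<^sup>2 * (cmod (rep x t))\<^sup>2)"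
      by (intro integrable_mult_right integrable_square_integrable rep_square_integrable)
    show "(cmod (m t * rep x t))\<^sup>2 \<le> C\<^sup>2 * (cmod (rep x t))\<^sup>2" for t
      using assms(2)[of t] by (auto simp: norm_mult power_mult_distrib intro!: mult_right_mono power_mono)
  qed
  also have "\<dots> = (C * norm x)\<^sup>2" by (simp add: norm_power2 power_mult_distrib)
  finally show ?thesis by (rule power2_le_imp_le) (simp add: C)
qed

lemma cinner_mulop_real:
  assumes "k \<in> borel_measurable lebesgue" "bounded (range k)"
  shows "integrable lebesgue (\<lambda>t. (cmod (rep x t))\<^sup>2 * k t)"
    and "cinner x (mulop (\<lambda>t. complex_of_real (k t)) x) = of_real (LINT t|lebesgue. (cmod (rep x t))\<^sup>2 * k t)"
proof -
  have m: "multiplier (\<lambda>t. complex_of_real (k t))" by (rule multiplier_of_real[OF assms])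
  have eq: "cnj z * (complex_of_real r * z) = complex_of_real ((cmod z)\<^sup>2 * r)" for z r
    using complex_norm_square[of z] by (simp add: mult_ac)
  have sq: "(\<lambda>t. complex_of_real (k t) * rep x t) \<in> square_integrable"
    by (intro sq_mult m rep_square_integrable)
  show "integrable lebesgue (\<lambda>t. (cmod (rep x t))\<^sup>2 * k t)"
    using integrable_Re[OF integrable_cnj_mult[OF rep_square_integrable sq, of x, unfolded eq]]
    by (simp only: Re_complex_of_real)
  have "cinner (cls (rep x)) (mulop (\<lambda>t. complex_of_real (k t)) x) =
      of_real (LINT t|lebesgue. (cmod (rep x t))\<^sup>2 * k t)"
    unfolding mulop_def
    by (subst cinner_cls[OF rep_square_integrable sq]) (simp only: eq integral_complex_of_real)
  then show "cinner x (mulop (\<lambda>t. complex_of_real (k t)) x) =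
      of_real (LINT t|lebesgue. (cmod (rep x t))\<^sup>2 * k t)"
    by (simp add: cls_rep)
qed

text \<open>
  The inverse of a unitary operator is its adjoint.
\<close>

abbreviation adj :: "(l2 \<Rightarrow> l2) \<Rightarrow> l2 \<Rightarrow> l2" where
  "adj W \<equiv> inv_into UNIV W"

definition unitary :: "(l2 \<Rightarrow> l2) \<Rightarrow> bool" where
  "unitary W \<longleftrightarrow> clinear W \<and> (\<forall>x y. cinner (W x) (W y) = cinner x y) \<and> surj W"

lemma unitary_id: "unitary (\<lambda>x. x)"
  by (auto simp: unitary_def clinear_def)

lemma unitary_clinear: "unitary W \<Longrightarrow> clinear W"
  by (simp add: unitary_def)

lemma unitary_cinner: "unitary W \<Longrightarrow> cinner (W x) (W y) = cinner x y"
  by (simp add: unitary_def)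

lemma unitary_norm:
  assumes "unitary W" shows "norm (W x) = norm x"
  by (simp add: norm_eq_sqrt_inner inner_l2_def unitary_cinner[OF assms])

lemma unitary_bij:
  assumes "unitary W" shows "bij W"
proof -
  have "x = y" if "W x = W y" for x y
  proof -
    have "norm (x - y) = norm (W x - W y)"
      using unitary_norm[OF assms, of "x - y"] by (simp add: clinearD[OF unitary_clinear[OF assms]])
    with that show ?thesis by simp
  qed
  then show ?thesis using assms by (auto simp: unitary_def bij_def inj_def)
qed

lemma unitary_inv_simps [simp]:
  assumes "unitary W" shows "W (adj W x) = x" "adj W (W x) = x"
  using unitary_bij[OF assms] by (auto simp: bij_def surj_f_inv_f inv_f_f)

lemma unitary_inv:
  assumes "unitary W" shows "unitary (adj W)"
  unfolding unitary_def clinear_def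
proof (intro conjI allI)
  note [simp] = assms
  have eq: "u = v" if "W u = W v" for u v
    using that unitary_bij[OF assms] by (auto simp: bij_def inj_def)
  show "adj W (x + y) = adj W x + adj W y" "adj W (cscale c x) = cscale c (adj W x)" for x y c
    by (rule eq, simp add: clinearD[OF unitary_clinear[OF assms]])+
  show "cinner (adj W x) (adj W y) = cinner x y" for x y
    using unitary_cinner[OF assms, of "adj W x" "adj W y"] by simp
  show "surj (adj W)" using unitary_bij[OF assms] by (simp add: bij_imp_bij_inv bij_is_surj)
qed

lemma unitary_comp:
  assumes "unitary V" "unitary W" shows "unitary (V \<circ> W)"
  using assms comp_surj[of W V] unfolding unitary_def clinear_def by simp

text \<open>
  All operators of the proof have this form: functions of position (with the identity as \<open>W\<close>),
  functions of momentum (with the Fourier transform), the unitary groups generated by them, and the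
  conjugates of the ones by the others.
\<close>

definition diag_op :: "(l2 \<Rightarrow> l2) \<Rightarrow> (real \<Rightarrow> complex) \<Rightarrow> l2 \<Rightarrow> l2" where
  "diag_op W m x = adj W (mulop m (W x))"

lemma diag_op_simps:
  assumes W: "unitary W" and m: "multiplier m"
  shows "diag_op W m (x + y) = diag_op W m x + diag_op W m y"
    "diag_op W m (cscale c x) = cscale c (diag_op W m x)"
    "multiplier n \<Longrightarrow> diag_op W m (diag_op W n x) = diag_op W (\<lambda>t. m t * n t) x"
    "multiplier n \<Longrightarrow> diag_op W (\<lambda>t. m t + n t) x = diag_op W m x + diag_op W n x"
    "cinner (diag_op W m x) y = cinner x (diag_op W (\<lambda>t. cnj (m t)) y)"
proof -
  note * = diag_op_def mulop_simps m W clinearD[OF unitary_clinear[OF W]]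
      clinearD[OF unitary_clinear[OF unitary_inv[OF W]]]
  show "diag_op W m (x + y) = diag_op W m x + diag_op W m y"
    "diag_op W m (cscale c x) = cscale c (diag_op W m x)"
    "multiplier n \<Longrightarrow> diag_op W m (diag_op W n x) = diag_op W (\<lambda>t. m t * n t) x"
    "multiplier n \<Longrightarrow> diag_op W (\<lambda>t. m t + n t) x = diag_op W m x + diag_op W n x"
    by (simp_all add: *)
  show "cinner (diag_op W m x) y = cinner x (diag_op W (\<lambda>t. cnj (m t)) y)"
    using unitary_cinner[OF W, of "diag_op W m x" y]
      unitary_cinner[OF W, of x "diag_op W (\<lambda>t. cnj (m t)) y"] by (simp add: *)
qed

lemma diag_op_const: "unitary W \<Longrightarrow> diag_op W (\<lambda>t. c) x = cscale c x"
  by (simp add: diag_op_def mulop_const clinearD[OF unitary_clinear[OF unitary_inv]])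

lemma clinear_diag_op: "unitary W \<Longrightarrow> multiplier m \<Longrightarrow> clinear (diag_op W m)"
  by (simp add: clinear_def diag_op_simps)

lemma norm_diag_op:
  assumes "unitary W" "multiplier m" "\<And>t. cmod (m t) \<le> C"
  shows "norm (diag_op W m x) \<le> C * norm x"
  using norm_mulop[OF assms(2,3), of "W x"]
  by (simp add: diag_op_def unitary_norm[OF assms(1)] unitary_norm[OF unitary_inv[OF assms(1)]])

lemma bounded_linear_diag_op:
  assumes "unitary W" "multiplier m" shows "bounded_linear (diag_op W m)"
proof -
  obtain C where "\<And>t. cmod (m t) \<le> C" using assms(2) by (auto simp: multiplier_def)
  from clinear_bounded_linear[OF clinear_diag_op[OF assms] norm_diag_op[OF assms this]] show ?thesis .
qed

lemma bounded_operator_diag_op: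
  assumes "unitary W" "multiplier m" shows "bounded_operator L2 (on_carrier (diag_op W m))"
proof -
  obtain C where "\<And>t. cmod (m t) \<le> C" using assms(2) by (auto simp: multiplier_def)
  from bounded_operator_on_carrier[OF clinear_diag_op[OF assms] norm_diag_op[OF assms this]] show ?thesis .
qed

lemma diag_op_unimodular:
  assumes W: "unitary W" and m: "multiplier m" "\<And>t. cmod (m t) = 1"
  shows "unitary (diag_op W m)" "adj (diag_op W m) = diag_op W (\<lambda>t. cnj (m t))"
proof -
  have mm: "m t * cnj (m t) = 1" for t
    using complex_norm_square[of "m t"] m(2)[of t] by simp
  have inv: "diag_op W m (diag_op W (\<lambda>t. cnj (m t)) x) = x"
    "diag_op W (\<lambda>t. cnj (m t)) (diag_op W m x) = x" for x
    using mm by (simp_all add: diag_op_simps diag_op_const W m multiplier_cnj cscale_simps mult.commute)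
  show "adj (diag_op W m) = diag_op W (\<lambda>t. cnj (m t))"
    using inv by (intro inv_unique_comp ext) auto
  show "unitary (diag_op W m)"
    unfolding unitary_def
  proof (intro conjI allI clinear_diag_op W m)
    show "cinner (diag_op W m x) (diag_op W m y) = cinner x y" for x y
      by (subst diag_op_simps(5)[OF W m(1)]) (simp add: inv)
    show "surj (diag_op W m)" using inv(1) by (metis surjI)
  qed
qed

lemma diag_op_comp:
  assumes "unitary V" "unitary W"
  shows "diag_op (W \<circ> V) m x = adj V (diag_op W m (V x))"
  using assms by (simp add: diag_op_def o_inv_distrib unitary_bij)

section \<open>Functional calculus and matrix monotone functions\<close>

lemma self_adjoint_diag_op:
  assumes "unitary W" "h \<in> borel_measurable lebesgue" "bounded (range h)"
  shows "self_adjoint L2 (on_carrier (diag_op W (\<lambda>t. complex_of_real (h t))))"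
  using assms bounded_operator_diag_op[OF assms(1) multiplier_of_real[OF assms(2,3)]]
  unfolding self_adjoint_def by (auto simp: L2_simps diag_op_simps multiplier_of_real)

lemma cinner_diag_op_real:
  assumes "unitary W" "k \<in> borel_measurable lebesgue" "bounded (range k)"
  shows "cinner x (diag_op W (\<lambda>t. complex_of_real (k t)) x) =
    of_real (LINT t|lebesgue. (cmod (rep (W x) t))\<^sup>2 * k t)"
  using unitary_cinner[OF assms(1), of x "diag_op W (\<lambda>t. complex_of_real (k t)) x"]
  by (simp add: diag_op_def assms cinner_mulop_real)

definition spectral_projection :: "(l2 \<Rightarrow> l2) \<Rightarrow> (real \<Rightarrow> real) \<Rightarrow> real set \<Rightarrow>
    (real \<Rightarrow> complex) set \<Rightarrow> (real \<Rightarrow> complex) set" where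
  "spectral_projection W h S = on_carrier (diag_op W (\<lambda>t. complex_of_real (indicator S (h t))))"

lemma indicator_comp:
  assumes [measurable]: "h \<in> borel_measurable lebesgue" and [measurable]: "S \<in> sets borel"
  shows "(\<lambda>t. indicator S (h t) :: real) \<in> borel_measurable lebesgue"
    "bounded (range (\<lambda>t. indicator S (h t) :: real))"
proof -
  show "(\<lambda>t. indicator S (h t) :: real) \<in> borel_measurable lebesgue" by measurable
  show "bounded (range (\<lambda>t. indicator S (h t) :: real))"
    unfolding bounded_iff by (rule exI[of _ 1]) (auto simp: indicator_def)
qed

text \<open>
  The spectral measure of a vector is the distribution of \<open>h\<close> under the density \<open>|W x|\<^sup>2\<close>, so that
  spectral integrals become integrals over the line by substitution.
\<close>

lemma spectral_measure_diag_op: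
  assumes W: "unitary W" and h [measurable]: "h \<in> borel_measurable lebesgue"
  shows "spectral_measure L2 (spectral_projection W h) (Rep_l2 x) =
    distr (density lebesgue (\<lambda>t. ennreal ((cmod (rep (W x) t))\<^sup>2))) borel h" (is "_ = ?D")
proof -
  have "spectral_measure L2 (spectral_projection W h) (Rep_l2 x) =
    measure_of UNIV (sets borel) (emeasure ?D)"
    unfolding spectral_measure_def
  proof (rule measure_of_eq)
    fix S :: "real set" assume "S \<in> sigma_sets UNIV (sets borel)"
    then have S [measurable]: "S \<in> sets borel"
      using sets.sigma_sets_eq[of "borel :: real measure"] by simp
    note i = indicator_comp[OF h S]
    have "emeasure ?D S = (\<integral>\<^sup>+ t. ennreal ((cmod (rep (W x) t))\<^sup>2) * indicator (h -` S \<inter> UNIV) t \<partial>lebesgue)"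
      by (subst emeasure_distr, simp, simp, subst emeasure_density) (simp_all add: measurable_sets_borel[of h] measurable_sets[OF h S, simplified])
    also have "\<dots> = (\<integral>\<^sup>+ t. ennreal ((cmod (rep (W x) t))\<^sup>2 * indicator S (h t)) \<partial>lebesgue)"
      by (rule nn_integral_cong) (auto simp: indicator_def)
    also have "\<dots> = ennreal (LINT t|lebesgue. (cmod (rep (W x) t))\<^sup>2 * indicator S (h t))"
      using cinner_mulop_real(1)[OF i, of "W x"] by (intro nn_integral_eq_integral) auto
    finally show "ennreal (Re (inprod L2 (Rep_l2 x) (spectral_projection W h S (Rep_l2 x)))) = emeasure ?D S"
      by (simp add: spectral_projection_def L2_simps cinner_diag_op_real[OF W i])
  qed simp
  also have "\<dots> = ?D"
    using measure_of_of_measure[of ?D] by simp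
  finally show ?thesis .
qed

lemma has_spectral_integral_diag_op:
  assumes W: "unitary W" and h [measurable]: "h \<in> borel_measurable lebesgue"
    and F: "set_borel_measurable borel U F" and U: "range h \<subseteq> U" and b: "bounded (range (F \<circ> h))"
  shows "(F \<circ> h) \<in> borel_measurable lebesgue"
    and "has_spectral_integral L2 (spectral_projection W h) U F
      (on_carrier (diag_op W (\<lambda>t. complex_of_real ((F \<circ> h) t))))"
proof -
  have F' [measurable]: "(\<lambda>s. indicator U s *\<^sub>R F s) \<in> borel_measurable borel"
    using F by (simp add: set_borel_measurable_def)
  have eq: "indicator U (h t) *\<^sub>R F (h t) = (F \<circ> h) t" for t using U by (auto simp: indicator_def)
  have "(\<lambda>t. indicator U (h t) *\<^sub>R F (h t)) \<in> borel_measurable lebesgue" by measurable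
  then show m: "(F \<circ> h) \<in> borel_measurable lebesgue" by (simp only: eq)
  show "has_spectral_integral L2 (spectral_projection W h) U F
      (on_carrier (diag_op W (\<lambda>t. complex_of_real ((F \<circ> h) t))))"
    unfolding has_spectral_integral_def
  proof (intro conjI ballI bounded_operator_diag_op W multiplier_of_real m b)
    fix X assume "X \<in> carrier L2"
    then obtain x where X: "X = Rep_l2 x" by (auto simp: L2_simps)
    show "set_integrable (spectral_measure L2 (spectral_projection W h) X) U F"
      unfolding X spectral_measure_diag_op[OF W h] set_integrable_def
      using cinner_mulop_real(1)[OF m b, of "W x"] m F'
      by (subst integrable_distr_eq) (auto simp: eq[unfolded real_scaleR_def o_def] o_def integrable_density)
    show "inprod L2 X (on_carrier (diag_op W (\<lambda>t. complex_of_real ((F \<circ> h) t))) X) =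
      of_real (LINT s:U|spectral_measure L2 (spectral_projection W h) X. F s)"
      unfolding X spectral_measure_diag_op[OF W h] set_lebesgue_integral_def
      using m F' cinner_diag_op_real[OF W m b, of x]
      by (subst integral_distr) (auto simp: eq[unfolded real_scaleR_def o_def] o_def integral_density L2_simps)
  qed
qed

lemma projection_valued_measure_diag_op:
  assumes W: "unitary W" and h [measurable]: "h \<in> borel_measurable lebesgue"
  shows "projection_valued_measure L2 (spectral_projection W h)"
  unfolding projection_valued_measure_def
proof (intro conjI ballI allI impI)
  fix S :: "real set" assume S: "S \<in> sets borel"
  show "self_adjoint L2 (spectral_projection W h S)"
    unfolding spectral_projection_def by (intro self_adjoint_diag_op W indicator_comp h S)
  fix T :: "real set" assume T: "T \<in> sets borel"
  fix X assume "X \<in> carrier L2"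
  then obtain x where X: "X = Rep_l2 x" by (auto simp: L2_simps)
  show "spectral_projection W h (S \<inter> T) X = spectral_projection W h S (spectral_projection W h T X)"
    by (simp add: X spectral_projection_def diag_op_simps W multiplier_of_real indicator_comp h S T
        indicator_inter_arith)
next
  fix X assume "X \<in> carrier L2"
  then obtain x where X: "X = Rep_l2 x" by (auto simp: L2_simps)
  show "spectral_projection W h UNIV X = X"
    by (simp add: X spectral_projection_def diag_op_const[OF W] cscale_simps)
next
  fix S :: "nat \<Rightarrow> real set" and X
  assume S: "range S \<subseteq> sets borel" and d: "disjoint_family S" and "X \<in> carrier L2"
  then obtain x where X: "X = Rep_l2 x" by (auto simp: L2_simps)
  let ?\<phi> = "\<lambda>t. (cmod (rep (W x) t))\<^sup>2"
  have Sn: "S n \<in> sets borel" for n using S by auto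
  then have SU: "(\<Union>n. S n) \<in> sets borel" by auto
  have int: "integrable lebesgue ?\<phi>" by (rule integrable_square_integrable[OF rep_square_integrable])
  have "(\<lambda>n. LINT t|lebesgue. ?\<phi> t * indicator (S n) (h t)) sums
     (LINT t|lebesgue. (\<Sum>n. ?\<phi> t * indicator (S n) (h t)))"
  proof (rule sums_integral)
    show "integrable lebesgue (\<lambda>t. ?\<phi> t * indicator (S n) (h t))" for n
      by (intro cinner_mulop_real indicator_comp h Sn)
    have s: "(\<lambda>n. ?\<phi> t * indicator (S n) (h t)) sums (?\<phi> t * indicator (\<Union>n. S n) (h t))" for t
      by (intro sums_mult indicator_sums d[unfolded disjoint_family_on_def, rule_format]) auto
    show "AE t in lebesgue. summable (\<lambda>n. norm (?\<phi> t * indicator (S n) (h t)))"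
      using s by (auto simp: sums_iff abs_mult)
    show "summable (\<lambda>n. LINT t|lebesgue. norm (?\<phi> t * indicator (S n) (h t)))"
    proof (rule summableI_nonneg_bounded[where x="LINT t|lebesgue. ?\<phi> t"])
      fix n
      have "(\<Sum>i<n. LINT t|lebesgue. norm (?\<phi> t * indicator (S i) (h t))) =
        (LINT t|lebesgue. (\<Sum>i<n. ?\<phi> t * indicator (S i) (h t)))"
        by (subst Bochner_Integration.integral_sum)
           (auto intro!: cinner_mulop_real indicator_comp h Sn)
      also have "\<dots> \<le> (LINT t|lebesgue. ?\<phi> t)"
      proof (rule integral_mono)
        show "integrable lebesgue (\<lambda>t. \<Sum>i<n. ?\<phi> t * indicator (S i) (h t))"
          by (intro Bochner_Integration.integrable_sum cinner_mulop_real indicator_comp h Sn)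
        show "(\<Sum>i<n. ?\<phi> t * indicator (S i) (h t)) \<le> ?\<phi> t" for t
        proof -
          have "(\<Sum>i<n. ?\<phi> t * indicator (S i) (h t)) \<le> ?\<phi> t * indicator (\<Union>n. S n) (h t)"
            using sum_le_suminf[OF sums_summable[OF s[of t]], of "{..<n}"] sums_unique[OF s[of t]] by simp
          also have "\<dots> \<le> ?\<phi> t" by (auto simp: indicator_def)
          finally show ?thesis .
        qed
      qed (rule int)
      finally show "(\<Sum>i<n. LINT t|lebesgue. norm (?\<phi> t * indicator (S i) (h t))) \<le> (LINT t|lebesgue. ?\<phi> t)" .
    qed simp
  qed
  also have "(\<lambda>t. \<Sum>n. ?\<phi> t * indicator (S n) (h t)) = (\<lambda>t. ?\<phi> t * indicator (\<Union>n. S n) (h t))"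
  proof
    fix t
    have "(\<lambda>n. ?\<phi> t * indicator (S n) (h t)) sums (?\<phi> t * indicator (\<Union>n. S n) (h t))"
      by (intro sums_mult indicator_sums d[unfolded disjoint_family_on_def, rule_format]) auto
    then show "(\<Sum>n. ?\<phi> t * indicator (S n) (h t)) = ?\<phi> t * indicator (\<Union>n. S n) (h t)"
      by (simp add: sums_iff)
  qed
  finally show "(\<lambda>n. inprod L2 X (spectral_projection W h (S n) X)) sums
      inprod L2 X (spectral_projection W h (\<Union>n. S n) X)"
    unfolding X spectral_projection_def on_carrier_Rep L2_simps
      cinner_diag_op_real[OF W indicator_comp[OF h Sn]] cinner_diag_op_real[OF W indicator_comp[OF h SU]]
    by (rule sums_of_real)
qed

lemma functional_calculus_diag_op:
  assumes "unitary W" "h \<in> borel_measurable lebesgue" "bounded (range h)"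
    and "set_borel_measurable borel U F" "range h \<subseteq> U" "bounded (range (F \<circ> h))"
  shows "functional_calculus L2 U F (on_carrier (diag_op W (\<lambda>t. complex_of_real (h t))))
    (on_carrier (diag_op W (\<lambda>t. complex_of_real ((F \<circ> h) t))))"
  unfolding functional_calculus_def
proof (intro exI conjI)
  show "has_spectral_integral L2 (spectral_projection W h) UNIV (\<lambda>s. s)
      (on_carrier (diag_op W (\<lambda>t. complex_of_real (h t))))"
    using has_spectral_integral_diag_op(2)[OF assms(1,2), of UNIV "\<lambda>s. s"] assms(3)
    by (simp add: set_borel_measurable_def o_def)
qed (intro projection_valued_measure_diag_op has_spectral_integral_diag_op assms)+

text \<open>
  Off the closure of the range of \<open>h\<close>, a compact set, \<open>h - z\<close> is bounded away from 0, and the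
  multiplication by its inverse is the resolvent.
\<close>

lemma spectrum_diag_op:
  assumes W: "unitary W" and h [measurable]: "h \<in> borel_measurable lebesgue"
    and b: "bounded (range h)" and U: "closure (range h) \<subseteq> U"
  shows "operator_spectrum L2 (on_carrier (diag_op W (\<lambda>t. complex_of_real (h t)))) \<subseteq> of_real ` U"
proof (rule subsetI, rule ccontr)
  fix z assume z: "z \<in> operator_spectrum L2 (on_carrier (diag_op W (\<lambda>t. complex_of_real (h t))))"
    and "z \<notin> of_real ` U"
  then have zn: "z \<notin> complex_of_real ` closure (range h)" using U by auto
  have "compact (complex_of_real ` closure (range h))"
    using b by (intro compact_continuous_image continuous_intros) (simp add: compact_closure)
  then obtain d where d: "d > 0" "\<And>w. w \<in> complex_of_real ` closure (range h) \<Longrightarrow> d \<le> dist z w"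
    using separate_point_closed[OF compact_imp_closed zn] by blast
  have dh: "d \<le> cmod (complex_of_real (h t) - z)" for t
  proof -
    have "h t \<in> closure (range h)" using closure_subset by fast
    then have "d \<le> dist z (complex_of_real (h t))" by (intro d(2)) auto
    then show ?thesis by (simp add: dist_norm norm_minus_commute)
  qed
  then have nz: "complex_of_real (h t) - z \<noteq> 0" for t using d(1) by (metis norm_zero not_less)
  define n where "n t = inverse (complex_of_real (h t) - z)" for t
  have nn: "n t * (complex_of_real (h t) - z) = 1" "(complex_of_real (h t) - z) * n t = 1" for t
    using nz by (simp_all add: n_def)
  have n: "multiplier n"
  proof (rule multiplierI)
    show "n \<in> borel_measurable lebesgue" unfolding n_def by measurable
    show "cmod (n t) \<le> inverse d" for t
      unfolding n_def norm_inverse using dh d(1) by (intro le_imp_inverse_le) auto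
  qed
  have m: "multiplier (\<lambda>t. complex_of_real (h t))" by (rule multiplier_of_real[OF h b])
  have shift: "diag_op W (\<lambda>t. complex_of_real (h t)) x - cscale z x =
      diag_op W (\<lambda>t. complex_of_real (h t) - z) x" for x
  proof -
    have "diag_op W (\<lambda>t. complex_of_real (h t) + - z) x =
      diag_op W (\<lambda>t. complex_of_real (h t)) x + diag_op W (\<lambda>t. - z) x"
      by (intro diag_op_simps(4) W m multiplier_const)
    moreover have "diag_op W (\<lambda>t. - z) x + cscale z x = 0"
      using cscale_simps(2)[of "- z" z x] diag_op_const[OF W, of "- z" x]
        diag_op_const[OF W, of 0 x] diag_op_const[OF W, of 0]
      by (simp add: cscale_def zero_l2_def)
    ultimately show ?thesis by (simp add: algebra_simps eq_neg_iff_add_eq_0)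
  qed
  have mz: "multiplier (\<lambda>t. complex_of_real (h t) - z)"
    using multiplier_add[OF m multiplier_const[of "- z"]] by simp
  have "\<exists>R. bounded_operator L2 R \<and>
     (\<forall>X\<in>carrier L2.
         R (on_carrier (diag_op W (\<lambda>t. complex_of_real (h t))) X \<ominus>\<^bsub>L2\<^esub> z \<odot>\<^bsub>L2\<^esub> X) = X \<and>
         on_carrier (diag_op W (\<lambda>t. complex_of_real (h t))) (R X) \<ominus>\<^bsub>L2\<^esub> z \<odot>\<^bsub>L2\<^esub> R X = X)"
    using nz bounded_operator_diag_op[OF W n]
    by (intro exI[of _ "on_carrier (diag_op W n)"])
       (auto simp: L2_simps L2_minus shift diag_op_simps diag_op_const W n mz nn cscale_simps)
  with z show False unfolding operator_spectrum_def by blast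
qed

text \<open>
  This transfers matrix monotonicity to conjugated multiplications. Two different unitaries
  occur, since the operators to be compared need not commute.
\<close>

lemma matrix_monotone_diag_op:
  assumes F: "matrix_monotone_on U F"
    and V: "unitary V" and h: "h \<in> borel_measurable lebesgue" "bounded (range h)"
      "closure (range h) \<subseteq> U" "bounded (range (F \<circ> h))"
    and W: "unitary W" and k: "k \<in> borel_measurable lebesgue" "bounded (range k)"
      "closure (range k) \<subseteq> U" "bounded (range (F \<circ> k))"
    and le: "\<And>x. inner x (diag_op V (\<lambda>t. complex_of_real (h t)) x)
      \<le> inner x (diag_op W (\<lambda>t. complex_of_real (k t)) x)"
  shows "inner x (diag_op V (\<lambda>t. complex_of_real ((F \<circ> h) t)) x)
      \<le> inner x (diag_op W (\<lambda>t. complex_of_real ((F \<circ> k) t)) x)"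
proof -
  let ?A = "on_carrier (diag_op W (\<lambda>t. complex_of_real (k t)))"
  let ?B = "on_carrier (diag_op V (\<lambda>t. complex_of_real (h t)))"
  let ?FA = "on_carrier (diag_op W (\<lambda>t. complex_of_real ((F \<circ> k) t)))"
  let ?FB = "on_carrier (diag_op V (\<lambda>t. complex_of_real ((F \<circ> h) t)))"
  have rU: "range h \<subseteq> U" "range k \<subseteq> U"
    using order_trans[OF closure_subset h(3)] order_trans[OF closure_subset k(3)] by simp_all
  have Fm: "set_borel_measurable borel U F" using F by (simp add: matrix_monotone_on_def)
  have "operator_le L2 ?B ?A"
    unfolding operator_le_def positive_operator_def
  proof
    fix X assume "X \<in> carrier L2"
    then obtain x where X: "X = Rep_l2 x" by (auto simp: L2_simps)
    show "inprod L2 X (?A X \<ominus>\<^bsub>L2\<^esub> ?B X) \<in> \<real>\<^sub>\<ge>\<^sub>0"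
      using le[of x] by (simp add: X L2_simps L2_minus cinner_diff_right cinner_diag_op_real V W h k inner_l2_def
          complex_nonneg_Reals_iff)
  qed
  moreover have "functional_calculus L2 U F ?A ?FA" "functional_calculus L2 U F ?B ?FB"
    by (intro functional_calculus_diag_op V W h k Fm rU)+
  moreover have "self_adjoint L2 ?A" "self_adjoint L2 ?B"
    by (intro self_adjoint_diag_op V W h k)+
  moreover have "operator_spectrum L2 ?A \<subseteq> of_real ` U" "operator_spectrum L2 ?B \<subseteq> of_real ` U"
    by (intro spectrum_diag_op V W h k)+
  ultimately have "operator_le L2 ?FB ?FA"
    using F hilbert_space_L2 unfolding matrix_monotone_on_def by blast
  then have "inprod L2 (Rep_l2 x) (?FA (Rep_l2 x) \<ominus>\<^bsub>L2\<^esub> ?FB (Rep_l2 x)) \<in> \<real>\<^sub>\<ge>\<^sub>0"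
    unfolding operator_le_def positive_operator_def by (simp add: L2_simps)
  then show ?thesis
    by (simp add: L2_simps L2_minus cinner_diff_right inner_l2_def complex_nonneg_Reals_iff)
qed

lemma l2_nontrivial: "\<exists>x::l2. x \<noteq> 0"
proof -
  let ?\<phi> = "\<lambda>t::real. complex_of_real (indicator {0..1} t)"
  have eq: "(cmod (?\<phi> t))\<^sup>2 = indicator {0..1} t" for t by (simp add: indicator_def)
  have sq: "?\<phi> \<in> square_integrable"
    unfolding square_integrable_def
  proof (intro CollectI conjI)
    show "?\<phi> \<in> borel_measurable lebesgue"
      by (rule measurable_compose[OF borel_measurable_indicator borel_measurable_of_real]) simp
    show "integrable lebesgue (\<lambda>t. (cmod (?\<phi> t))\<^sup>2)"
      unfolding eq by (rule integrable_real_indicator) simp_all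
  qed
  have "(norm (cls ?\<phi>))\<^sup>2 = 1"
    unfolding norm_cls[OF sq] eq by simp
  then show ?thesis by (intro exI[of _ "cls ?\<phi>"]) auto
qed

text \<open>Scalar multiples of the identity are multiplications by constants.\<close>

lemma matrix_monotone_mono_on:
  assumes F: "matrix_monotone_on U F" shows "mono_on U F"
proof (rule mono_onI)
  fix a b assume ab: "a \<in> U" "b \<in> U" "a \<le> b"
  obtain x :: l2 where x: "x \<noteq> 0" using l2_nontrivial by blast
  have c: "inner y (diag_op (\<lambda>x. x) (\<lambda>t. complex_of_real r) y) = r * (norm y)\<^sup>2" for r y
    by (simp add: diag_op_const[OF unitary_id] power2_norm_eq_inner flip: scaleR_cscale)
  have "inner x (diag_op (\<lambda>x. x) (\<lambda>t. complex_of_real ((F \<circ> (\<lambda>_. a)) t)) x)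
      \<le> inner x (diag_op (\<lambda>x. x) (\<lambda>t. complex_of_real ((F \<circ> (\<lambda>_. b)) t)) x)"
    using ab by (intro matrix_monotone_diag_op[OF F] unitary_id)
      (auto simp: c image_constant_conv o_def intro!: mult_right_mono)
  then show "F a \<le> F b" using x by (simp add: c)
qed

text \<open>
  Here it matters that \<open>U\<close> contains the closure of the range: the closure has a least and a greatest
  element, and the values of the increasing function \<open>F\<close> there are bounds.
\<close>

lemma matrix_monotone_bounded:
  assumes F: "matrix_monotone_on U F" and h: "bounded (range h)" "closure (range h) \<subseteq> U"
  shows "bounded (range (F \<circ> h))"
proof -
  have c: "compact (closure (range h))" "closure (range h) \<noteq> {}" using h by (auto simp: compact_closure)
  obtain l where l: "l \<in> closure (range h)" "\<And>s. s \<in> closure (range h) \<Longrightarrow> l \<le> s"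
    using compact_attains_inf[OF c] by blast
  obtain u where u: "u \<in> closure (range h)" "\<And>s. s \<in> closure (range h) \<Longrightarrow> s \<le> u"
    using compact_attains_sup[OF c] by blast
  have "(F \<circ> h) t \<in> {F l..F u}" for t
  proof -
    have "h t \<in> closure (range h)" using closure_subset by fast
    with l u h(2) show ?thesis
      using matrix_monotone_mono_on[OF F] by (auto simp: mono_on_def subset_iff)
  qed
  then show ?thesis by (intro bounded_subset[OF bounded_closed_interval[of "F l" "F u"]]) auto
qed

section \<open>Approximation by continuous functions\<close>

lemma square_integrable_borel_iff:
  assumes "\<phi> \<in> borel_measurable borel"
  shows "\<phi> \<in> square_integrable \<longleftrightarrow> integrable lborel (\<lambda>x. (cmod (\<phi> x))\<^sup>2)"
  using assms by (simp add: square_integrable_def integrable_completion measurable_completion)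

lemma norm_cls_borel:
  assumes "\<phi> \<in> borel_measurable borel" "\<phi> \<in> square_integrable"
  shows "(norm (cls \<phi>))\<^sup>2 = (LINT t|lborel. (cmod (\<phi> t))\<^sup>2)"
  using assms by (simp add: norm_cls integral_completion)

lemma cinner_cls_borel:
  assumes "\<phi> \<in> borel_measurable borel" "\<phi> \<in> square_integrable"
    "\<psi> \<in> borel_measurable borel" "\<psi> \<in> square_integrable"
  shows "cinner (cls \<phi>) (cls \<psi>) = (LINT t|lborel. cnj (\<phi> t) * \<psi> t)"
  using assms by (simp add: cinner_cls integral_completion)

text \<open>
  Borel representatives are needed for product measures and translations: \<open>\<phi> (x + u)\<close> is a
  Borel function of the pair for Borel \<open>\<phi>\<close>, but need not be measurable for the product of Lebesgue
  measures if \<open>\<phi>\<close> is only Lebesgue measurable.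
\<close>

lemma l2_borel_cases:
  obtains \<phi> where "\<phi> \<in> borel_measurable borel" "\<phi> \<in> square_integrable" "x = cls \<phi>"
    "AE t in lebesgue. rep x t = \<phi> t"
proof -
  have "(\<lambda>t. Re (rep x t)) \<in> borel_measurable (completion lborel)"
    "(\<lambda>t. Im (rep x t)) \<in> borel_measurable (completion lborel)" by measurable
  then obtain a b where a: "a \<in> borel_measurable lborel" "AE t in lborel. Re (rep x t) = a t"
    and b: "b \<in> borel_measurable lborel" "AE t in lborel. Im (rep x t) = b t"
    using completion_ex_borel_measurable_real by metis
  have [measurable]: "a \<in> borel_measurable borel" "b \<in> borel_measurable borel"
    using a(1) b(1) by simp_all
  define \<phi> where "\<phi> t = complex_of_real (a t) + \<i> * complex_of_real (b t)" for t
  have \<phi>: "\<phi> \<in> borel_measurable borel" unfolding \<phi>_def by measurable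
  have "AE t in lborel. rep x t = \<phi> t"
    using a(2) b(2) by eventually_elim (simp add: \<phi>_def complex_eq_iff)
  then have ae: "AE t in lebesgue. rep x t = \<phi> t" by (rule AE_completion)
  then have sq: "\<phi> \<in> square_integrable"
    using \<phi> by (intro square_integrable_cong_AE[OF rep_square_integrable[of x]])
      (auto simp: measurable_completion)
  have "cls (rep x) = cls \<phi>" by (rule cls_eqI[OF rep_square_integrable sq ae])
  with \<phi> sq ae show thesis using that by (simp add: cls_rep)
qed

lemma cls_tendsto:
  assumes \<phi>: "\<And>n. \<phi> n \<in> square_integrable" "\<psi> \<in> square_integrable"
    and lim: "AE t in lebesgue. (\<lambda>n. \<phi> n t) \<longlonglongrightarrow> \<psi> t"
    and h: "integrable lebesgue h" "\<And>n. AE t in lebesgue. (cmod (\<phi> n t - \<psi> t))\<^sup>2 \<le> h t"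
  shows "(\<lambda>n. cls (\<phi> n)) \<longlonglongrightarrow> cls \<psi>"
proof -
  note [measurable] = \<phi>(1)[THEN measurable_square_integrable] \<phi>(2)[THEN measurable_square_integrable]
  have "(\<lambda>n. LINT t|lebesgue. (cmod (\<phi> n t - \<psi> t))\<^sup>2) \<longlonglongrightarrow> (LINT (t::real)|lebesgue. (0::real))"
  proof (rule integral_dominated_convergence[where w=h])
    show "integrable lebesgue h" by (rule h(1))
    show "AE t in lebesgue. (\<lambda>n. (cmod (\<phi> n t - \<psi> t))\<^sup>2) \<longlonglongrightarrow> 0"
      using lim
    proof eventually_elim
      fix t assume "(\<lambda>n. \<phi> n t) \<longlonglongrightarrow> \<psi> t"
      then have "(\<lambda>n. cmod (\<phi> n t - \<psi> t)) \<longlonglongrightarrow> 0" by (simp add: LIM_zero tendsto_norm_zero)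
      from tendsto_power[OF this, of 2] show "(\<lambda>n. (cmod (\<phi> n t - \<psi> t))\<^sup>2) \<longlonglongrightarrow> 0" by simp
    qed
    show "AE t in lebesgue. norm ((cmod (\<phi> n t - \<psi> t))\<^sup>2) \<le> h t" for n using h(2)[of n] by simp
  qed measurable
  then have "(\<lambda>n. (norm (cls (\<phi> n) - cls \<psi>))\<^sup>2) \<longlonglongrightarrow> 0"
    using norm_cls[OF square_integrable_diff[OF \<phi>(1) \<phi>(2)]] by (simp add: cls_diff \<phi>)
  from tendsto_real_sqrt[OF this] have "(\<lambda>n. norm (cls (\<phi> n) - cls \<psi>)) \<longlonglongrightarrow> 0" by simp
  then show ?thesis by (simp add: tendsto_norm_zero_iff LIM_zero_iff)
qed

text \<open>The nearest point of the disc of radius \<open>r\<close>.\<close>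

definition clip :: "real \<Rightarrow> complex \<Rightarrow> complex" where
  "clip r z = complex_of_real (r / max r (cmod z)) * z"

definition cutoff :: "real \<Rightarrow> real \<Rightarrow> real" where
  "cutoff r t = max 0 (min 1 (r + 1 - \<bar>t\<bar>))"

lemma clip:
  assumes "r > 0"
  shows "continuous_on UNIV (clip r)" "cmod (clip r z) \<le> r" "cmod (clip r z) \<le> cmod z"
    "cmod z \<le> r \<Longrightarrow> clip r z = z"
proof -
  have "max r (cmod z) \<noteq> 0" for z using assms by auto
  then show "continuous_on UNIV (clip r)"
    unfolding clip_def by (intro continuous_intros) (auto simp: o_def)
  have eq: "cmod (clip r z) = r * cmod z / max r (cmod z)"
  proof -
    have "cmod (clip r z) = \<bar>r / max r (cmod z)\<bar> * cmod z"
      by (simp only: clip_def norm_mult norm_of_real)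
    also have "\<bar>r / max r (cmod z)\<bar> = r / max r (cmod z)" using assms by simp
    finally show ?thesis by simp
  qed
  have "r * cmod z / max r (cmod z) \<le> r"
    using assms by (simp add: divide_le_eq)
  then show "cmod (clip r z) \<le> r" by (simp only: eq)
  have "r * cmod z / max r (cmod z) \<le> cmod z"
    using assms mult_right_mono[of r "max r (cmod z)" "cmod z"] by (simp add: divide_le_eq mult.commute)
  then show "cmod (clip r z) \<le> cmod z" by (simp only: eq)
  show "cmod z \<le> r \<Longrightarrow> clip r z = z" using assms by (simp add: clip_def)
qed

lemma cutoff:
  "0 \<le> cutoff r t" "cutoff r t \<le> 1" "\<bar>t\<bar> \<le> r \<Longrightarrow> cutoff r t = 1" "\<bar>t\<bar> > r + 1 \<Longrightarrow> cutoff r t = 0"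
  "continuous_on UNIV (cutoff r)"
proof -
  show "continuous_on UNIV (cutoff r)"
    unfolding cutoff_def [abs_def] by (intro continuous_intros)
qed (auto simp: cutoff_def max_def min_def)

lemma integrable_const_Icc: "integrable lebesgue (\<lambda>t::real. C * indicator {a..b} t :: real)"
  by (intro integrable_mult_right integrable_real_indicator) (simp_all add: emeasure_lborel_Icc_eq)

lemma borel_measurable_lebesgue_continuous:
  "continuous_on UNIV g \<Longrightarrow> (g :: real \<Rightarrow> complex) \<in> borel_measurable lebesgue"
  by (rule measurable_completion) (simp add: borel_measurable_continuous_onI)

lemma square_integrable_bounded_support:
  assumes "\<phi> \<in> borel_measurable lebesgue" "\<And>t. cmod (\<phi> t) \<le> C" "\<And>t. \<bar>t\<bar> > r \<Longrightarrow> \<phi> t = 0"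
  shows "\<phi> \<in> square_integrable"
proof (rule square_integrable_bound[OF assms(1) integrable_const_Icc[of "C\<^sup>2" "- r" r]])
  have "(cmod (\<phi> t))\<^sup>2 \<le> C\<^sup>2 * indicator {- r..r} t" for t
    using assms(2)[of t] assms(3)[of t] by (auto simp: indicator_def abs_le_iff intro!: power_mono)
  then show "AE t in lebesgue. (cmod (\<phi> t))\<^sup>2 \<le> C\<^sup>2 * indicator {- r..r} t" by auto
qed

text \<open>
  Continuous functions with compact support are dense. A class is the limit of its bounded
  truncations with compact support; each of these is the almost everywhere limit of continuous
  functions, to which the same (continuous) truncation is applied, so that the convergence is dominated.
\<close>

lemma l2_induct_continuous:
  assumes cont: "\<And>\<phi> r. continuous_on UNIV \<phi> \<Longrightarrow> (\<And>t. \<bar>t\<bar> > r \<Longrightarrow> \<phi> t = 0) \<Longrightarrow> P (cls \<phi>)"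
    and lim: "\<And>X x. (\<And>n. P (X n)) \<Longrightarrow> X \<longlonglongrightarrow> x \<Longrightarrow> P x"
  shows "P x"
proof -
  define f where "f n t = complex_of_real (cutoff (real (Suc n)) t) * clip (real (Suc n)) (rep x t)" for n t
  have clip_m [measurable]: "clip (real (Suc n)) \<in> borel_measurable borel" for n
    by (intro borel_measurable_continuous_onI clip) simp
  have cutoff_m [measurable]: "cutoff r \<in> borel_measurable lebesgue" for r
    by (rule measurable_completion) (simp add: borel_measurable_continuous_onI cutoff)
  have f_m: "f n \<in> borel_measurable lebesgue" for n unfolding f_def by measurable
  have bd: "cmod (complex_of_real (cutoff (real (Suc n)) t) * clip (real (Suc n)) z) \<le> real (Suc n)"
    "cmod (complex_of_real (cutoff (real (Suc n)) t) * clip (real (Suc n)) z) \<le> cmod z" for n t z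
    using cutoff(1,2)[of "real (Suc n)" t] clip(2,3)[of "real (Suc n)" z]
    by (auto simp: norm_mult intro: order_trans[OF mult_left_le_one_le])
  have f_sq: "f n \<in> square_integrable" for n
    by (rule square_integrable_bounded_support[OF f_m, where C="real (Suc n)" and r="real (Suc n) + 1"])
       (use bd(1) in \<open>auto simp: f_def cutoff(4)\<close>)
  have f_lim: "(\<lambda>n. cls (f n)) \<longlonglongrightarrow> cls (rep x)"
  proof (rule cls_tendsto[OF f_sq rep_square_integrable])
    show "integrable lebesgue (\<lambda>t. 4 * (cmod (rep x t))\<^sup>2)"
      by (intro integrable_mult_right integrable_square_integrable rep_square_integrable)
    have "(cmod (f n t - rep x t))\<^sup>2 \<le> 4 * (cmod (rep x t))\<^sup>2" for n t
    proof -
      have "cmod (f n t - rep x t) \<le> 2 * cmod (rep x t)"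
        using norm_triangle_ineq4[of "f n t" "rep x t"] bd(2)[of n t "rep x t"] by (simp add: f_def)
      then have "(cmod (f n t - rep x t))\<^sup>2 \<le> (2 * cmod (rep x t))\<^sup>2" by (rule power_mono) simp
      then show ?thesis by (simp add: power_mult_distrib)
    qed
    then show "AE t in lebesgue. (cmod (f n t - rep x t))\<^sup>2 \<le> 4 * (cmod (rep x t))\<^sup>2" for n by auto
    have "(\<lambda>n. f n t) \<longlonglongrightarrow> rep x t" for t
    proof (rule tendsto_eventually)
      obtain k :: nat where k: "max \<bar>t\<bar> (cmod (rep x t)) \<le> real k" using real_arch_simple by blast
      show "\<forall>\<^sub>F n in sequentially. f n t = rep x t"
        using eventually_ge_at_top[of k]
        by eventually_elim (use k in \<open>auto simp: f_def clip(4) cutoff(3)\<close>)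
    qed
    then show "AE t in lebesgue. (\<lambda>n. f n t) \<longlonglongrightarrow> rep x t" by auto
  qed
  have "P (cls (f n))" for n
  proof -
    define r where "r = real (Suc n)"
    have r: "r > 0" by (simp add: r_def)
    have "rep x measurable_on UNIV"
      by (rule lebesgue_measurable_imp_measurable_on) auto
    then obtain N g where N: "negligible N" and g: "\<And>k. continuous_on UNIV (g k)"
      and gN: "\<And>t. t \<notin> N \<Longrightarrow> (\<lambda>k. g k t) \<longlonglongrightarrow> rep x t"
      unfolding measurable_on_def by auto
    define q where "q k t = complex_of_real (cutoff r t) * clip r (g k t)" for k :: nat and t
    have q_c: "continuous_on UNIV (q k)" for k
      unfolding q_def by (intro continuous_intros cutoff continuous_on_compose2[OF clip(1)[OF r] g]) auto
    have q_0: "q k t = 0" if "\<bar>t\<bar> > r + 1" for k t using that by (simp add: q_def cutoff(4))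
    have q_b: "cmod (q k t) \<le> r" for k t unfolding q_def using bd(1)[of n t "g k t"] by (simp add: r_def)
    have q_sq: "q k \<in> square_integrable" for k
      by (rule square_integrable_bounded_support[OF borel_measurable_lebesgue_continuous[OF q_c] q_b q_0])
    have "(\<lambda>k. cls (q k)) \<longlonglongrightarrow> cls (f n)"
    proof (rule cls_tendsto[OF q_sq f_sq _ integrable_const_Icc[of "(2 * r)\<^sup>2" "- (r + 1)" "r + 1"]])
      have "AE t in lebesgue. t \<notin> N" using N by (auto simp: negligible_iff_null_sets intro: AE_not_in)
      then show "AE t in lebesgue. (\<lambda>k. q k t) \<longlonglongrightarrow> f n t"
      proof eventually_elim
        fix t assume "t \<notin> N"
        have "isCont (clip r) (rep x t)"
          using clip(1)[OF r] by (simp add: continuous_on_eq_continuous_at)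
        from isCont_tendsto_compose[OF this gN[OF \<open>t \<notin> N\<close>]]
        show "(\<lambda>k. q k t) \<longlonglongrightarrow> f n t"
          unfolding q_def f_def r_def by (intro tendsto_intros)
      qed
      have "(cmod (q k t - f n t))\<^sup>2 \<le> (2 * r)\<^sup>2 * indicator {- (r + 1)..r + 1} t" for k t
      proof (cases "\<bar>t\<bar> > r + 1")
        case True
        then have "f n t = 0" by (simp add: f_def cutoff(4) r_def)
        with q_0[OF True] show ?thesis by simp
      next
        case False
        have "cmod (q k t - f n t) \<le> 2 * r"
          using norm_triangle_ineq4[of "q k t" "f n t"] q_b[of k t] bd(1)[of n t "rep x t"]
          by (simp add: f_def r_def)
        then have "(cmod (q k t - f n t))\<^sup>2 \<le> (2 * r)\<^sup>2" by (rule power_mono) simp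
        with False show ?thesis by (auto simp: indicator_def)
      qed
      then show "AE t in lebesgue. (cmod (q k t - f n t))\<^sup>2 \<le> (2 * r)\<^sup>2 * indicator {- (r + 1)..r + 1} t" for k
        by auto
    qed
    with lim[of "\<lambda>k. cls (q k)"] cont[OF q_c q_0] show ?thesis by blast
  qed
  with lim[OF _ f_lim] show ?thesis by (simp add: cls_rep)
qed

lemma borel_shift [measurable (raw)]:
  assumes "(\<phi> :: real \<Rightarrow> complex) \<in> borel_measurable borel"
  shows "(\<lambda>t. \<phi> (t + u)) \<in> borel_measurable borel"
  using assms by measurable

lemma square_integrable_shift:
  assumes "\<phi> \<in> borel_measurable borel" "\<phi> \<in> square_integrable"
  shows "(\<lambda>t. \<phi> (t + u)) \<in> square_integrable"
  using assms lborel_integrable_real_affine[of "\<lambda>x. (cmod (\<phi> x))\<^sup>2" 1 u]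
  by (simp add: square_integrable_borel_iff borel_shift add.commute)

lemma norm_cls_shift:
  assumes "\<phi> \<in> borel_measurable borel" "\<phi> \<in> square_integrable"
  shows "norm (cls (\<lambda>t. \<phi> (t + u))) = norm (cls \<phi>)"
proof -
  have "(norm (cls (\<lambda>t. \<phi> (t + u))))\<^sup>2 = (norm (cls \<phi>))\<^sup>2"
    using lborel_integral_real_affine[of 1 "\<lambda>x. (cmod (\<phi> x))\<^sup>2" u] assms
    by (simp add: norm_cls_borel square_integrable_shift borel_shift add.commute)
  then show ?thesis by simp
qed

lemma norm_diff_shift:
  assumes "\<phi> \<in> borel_measurable borel" "\<phi> \<in> square_integrable"
    "\<psi> \<in> borel_measurable borel" "\<psi> \<in> square_integrable"
  shows "norm (cls (\<lambda>t. \<phi> (t + u)) - cls (\<lambda>t. \<psi> (t + u))) = norm (cls \<phi> - cls \<psi>)"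
  using norm_cls_shift[of "\<lambda>t. \<phi> t - \<psi> t" u] assms
  by (simp add: cls_diff square_integrable_shift square_integrable_diff borel_measurable_diff)

text \<open>
  Translations act continuously. They are isometries, so the claim passes to limits, and
  for continuous functions with compact support it is dominated convergence.
\<close>

lemma shift_tendsto:
  assumes u: "u \<longlonglongrightarrow> 0" and \<phi>: "\<phi> \<in> borel_measurable borel" "\<phi> \<in> square_integrable"
  shows "(\<lambda>n. cls (\<lambda>t. \<phi> (t + u n))) \<longlonglongrightarrow> cls \<phi>"
proof -
  define P where "P x \<longleftrightarrow> (\<exists>\<psi>. \<psi> \<in> borel_measurable borel \<and> \<psi> \<in> square_integrable \<and> x = cls \<psi> \<and>
    (\<lambda>n. cls (\<lambda>t. \<psi> (t + u n))) \<longlonglongrightarrow> x)" for x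
  obtain B where B: "\<And>n. \<bar>u n\<bar> \<le> B"
    using convergent_imp_Bseq[OF convergentI[OF u]] by (auto simp: Bseq_def)
  have "P (cls \<phi>)"
  proof (rule l2_induct_continuous)
    fix \<psi> :: "real \<Rightarrow> complex" and r
    assume c: "continuous_on UNIV \<psi>" and 0: "\<And>t. \<bar>t\<bar> > r \<Longrightarrow> \<psi> t = 0"
    have m: "\<psi> \<in> borel_measurable borel" by (rule borel_measurable_continuous_onI[OF c])
    have "bounded (\<psi> ` {- r..r})"
      by (intro compact_imp_bounded compact_continuous_image continuous_on_subset[OF c]) auto
    then obtain M where M: "M > 0" "\<And>t. t \<in> {- r..r} \<Longrightarrow> cmod (\<psi> t) \<le> M"
      unfolding bounded_pos by auto
    have b: "cmod (\<psi> t) \<le> M" for t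
      using M(1) M(2)[of t] 0[of t] by (cases "\<bar>t\<bar> > r") (simp_all add: abs_le_iff not_less)
    have sq: "\<psi> \<in> square_integrable"
      by (rule square_integrable_bounded_support[OF borel_measurable_lebesgue_continuous[OF c] b 0])
    have "(\<lambda>n. cls (\<lambda>t. \<psi> (t + u n))) \<longlonglongrightarrow> cls \<psi>"
    proof (rule cls_tendsto[OF square_integrable_shift[OF m sq] sq _
          integrable_const_Icc[of "(2 * M)\<^sup>2" "- (r + B)" "r + B"]])
      have "(\<lambda>n. \<psi> (t + u n)) \<longlonglongrightarrow> \<psi> (t + 0)" for t
        using c by (intro isCont_tendsto_compose[of _ \<psi>] tendsto_intros u)
          (simp add: continuous_on_eq_continuous_at)
      then show "AE t in lebesgue. (\<lambda>n. \<psi> (t + u n)) \<longlonglongrightarrow> \<psi> t" by simp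
      have "(cmod (\<psi> (t + u n) - \<psi> t))\<^sup>2 \<le> (2 * M)\<^sup>2 * indicator {- (r + B)..r + B} t" for n t
      proof (cases "\<bar>t\<bar> > r + B")
        case True
        then have "\<psi> t = 0" "\<psi> (t + u n) = 0" using B[of n] by (auto intro!: 0)
        then show ?thesis by simp
      next
        case False
        have "cmod (\<psi> (t + u n) - \<psi> t) \<le> 2 * M"
          using norm_triangle_ineq4[of "\<psi> (t + u n)" "\<psi> t"] b[of "t + u n"] b[of t] by simp
        then have "(cmod (\<psi> (t + u n) - \<psi> t))\<^sup>2 \<le> (2 * M)\<^sup>2" by (rule power_mono) simp
        with False show ?thesis by (auto simp: indicator_def)
      qed
      then show "AE t in lebesgue. (cmod (\<psi> (t + u n) - \<psi> t))\<^sup>2 \<le> (2 * M)\<^sup>2 * indicator {- (r + B)..r + B} t" for n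
        by auto
    qed
    with m sq show "P (cls \<psi>)" unfolding P_def by blast
  next
    fix X x assume PX: "\<And>n. P (X n)" and X: "X \<longlonglongrightarrow> x"
    obtain \<psi> where \<psi>: "\<psi> \<in> borel_measurable borel" "\<psi> \<in> square_integrable" "x = cls \<psi>"
      by (metis l2_borel_cases)
    have "(\<lambda>n. cls (\<lambda>t. \<psi> (t + u n))) \<longlonglongrightarrow> cls \<psi>"
    proof (rule metric_LIMSEQ_I)
      fix e :: real assume "e > 0"
      then have "e / 3 > 0" by simp
      from metric_LIMSEQ_D[OF X this] obtain k where k: "dist (X k) x < e / 3" by blast
      obtain \<theta> where \<theta>: "\<theta> \<in> borel_measurable borel" "\<theta> \<in> square_integrable" "X k = cls \<theta>"
        "(\<lambda>n. cls (\<lambda>t. \<theta> (t + u n))) \<longlonglongrightarrow> X k" using PX[of k] unfolding P_def by blast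
      from metric_LIMSEQ_D[OF \<theta>(4) \<open>e / 3 > 0\<close>]
      obtain N where N: "\<And>n. n \<ge> N \<Longrightarrow> dist (cls (\<lambda>t. \<theta> (t + u n))) (X k) < e / 3" by blast
      show "\<exists>no. \<forall>n\<ge>no. dist (cls (\<lambda>t. \<psi> (t + u n))) (cls \<psi>) < e"
      proof (intro exI allI impI)
        fix n assume "n \<ge> N"
        have "dist (cls (\<lambda>t. \<psi> (t + u n))) (cls (\<lambda>t. \<theta> (t + u n))) = dist x (X k)"
          unfolding dist_norm norm_diff_shift[OF \<psi>(1,2) \<theta>(1,2)] by (simp add: \<psi> \<theta>)
        then show "dist (cls (\<lambda>t. \<psi> (t + u n))) (cls \<psi>) < e"
          using N[OF \<open>n \<ge> N\<close>] k
            dist_triangle[of "cls (\<lambda>t. \<psi> (t + u n))" x "cls (\<lambda>t. \<theta> (t + u n))"]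
            dist_triangle[of "cls (\<lambda>t. \<theta> (t + u n))" x "X k"]
          by (simp add: \<psi>(3)[symmetric] dist_commute)
      qed
    qed
    with \<psi> show "P x" unfolding P_def by blast
  qed
  then obtain \<psi> where \<psi>: "\<psi> \<in> borel_measurable borel" "\<psi> \<in> square_integrable" "cls \<phi> = cls \<psi>"
    "(\<lambda>n. cls (\<lambda>t. \<psi> (t + u n))) \<longlonglongrightarrow> cls \<phi>" unfolding P_def by blast
  have "cls (\<lambda>t. \<phi> (t + u n)) = cls (\<lambda>t. \<psi> (t + u n))" for n
    using norm_diff_shift[OF \<phi> \<psi>(1,2), of "u n"] \<psi>(3) by simp
  with \<psi>(4) show ?thesis by simp
qed

section \<open>Plancherel's theorem for integrable functions\<close>

definition fourier_integral :: "(real \<Rightarrow> complex) \<Rightarrow> real \<Rightarrow> complex" where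
  "fourier_integral \<phi> \<xi> = complex_of_real (1 / sqrt (2 * pi)) *
     (LINT x|lborel. exp (- \<i> * complex_of_real \<xi> * complex_of_real x) * \<phi> x)"

lemma cmod_kernel [simp]: "cmod (exp (- \<i> * complex_of_real \<xi> * complex_of_real x)) = 1"
  "cmod (exp (- (\<i> * complex_of_real \<xi> * complex_of_real x))) = 1"
  by (simp_all add: norm_exp_eq_Re)

lemma integrable_kernel:
  assumes "integrable lborel \<phi>"
  shows "integrable lborel (\<lambda>x. exp (- \<i> * complex_of_real \<xi> * complex_of_real x) * \<phi> x)"
proof (rule Bochner_Integration.integrable_bound[OF assms])
  have [measurable]: "\<phi> \<in> borel_measurable borel" using borel_measurable_integrable[OF assms] by simp
  show "(\<lambda>x. exp (- \<i> * complex_of_real \<xi> * complex_of_real x) * \<phi> x) \<in> borel_measurable lborel"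
    by measurable
qed (simp add: norm_mult)

lemma fourier_integral_measurable [measurable]:
  assumes [measurable]: "\<phi> \<in> borel_measurable borel"
  shows "fourier_integral \<phi> \<in> borel_measurable borel"
  unfolding fourier_integral_def[abs_def] by measurable

lemma fourier_integral_bounded:
  "cmod (fourier_integral \<phi> \<xi>) \<le> 1 / sqrt (2 * pi) * (LINT x|lborel. cmod (\<phi> x))"
proof -
  have "cmod (LINT x|lborel. exp (- \<i> * complex_of_real \<xi> * complex_of_real x) * \<phi> x)
    \<le> (LINT x|lborel. cmod (exp (- \<i> * complex_of_real \<xi> * complex_of_real x) * \<phi> x))"
    by (rule integral_norm_bound)
  also have "\<dots> = (LINT x|lborel. cmod (\<phi> x))" by (simp add: norm_mult)
  finally show ?thesis
    unfolding fourier_integral_def norm_mult norm_of_real by (intro mult_mono) auto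
qed

lemma fourier_integral_add:
  "integrable lborel \<phi> \<Longrightarrow> integrable lborel \<psi> \<Longrightarrow>
   fourier_integral (\<lambda>x. \<phi> x + \<psi> x) \<xi> = fourier_integral \<phi> \<xi> + fourier_integral \<psi> \<xi>"
  using integrable_kernel[of \<phi> \<xi>] integrable_kernel[of \<psi> \<xi>]
  by (simp add: fourier_integral_def distrib_left)

lemma fourier_integral_cmult:
  "fourier_integral (\<lambda>x. c * \<phi> x) \<xi> = c * fourier_integral \<phi> \<xi>"
  by (simp add: fourier_integral_def mult.left_commute[of _ c])

lemma fourier_integral_diff:
  "integrable lborel \<phi> \<Longrightarrow> integrable lborel \<psi> \<Longrightarrow>
   fourier_integral (\<lambda>x. \<phi> x - \<psi> x) \<xi> = fourier_integral \<phi> \<xi> - fourier_integral \<psi> \<xi>"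
  using integrable_kernel[of \<phi> \<xi>] integrable_kernel[of \<psi> \<xi>]
  by (simp add: fourier_integral_def right_diff_distrib)

lemma fourier_multiplication_formula:
  assumes \<phi>: "integrable lborel \<phi>" and k: "integrable lborel k"
  shows "(LINT \<xi>|lborel. k \<xi> * fourier_integral \<phi> \<xi>) = (LINT x|lborel. \<phi> x * fourier_integral k x)"
proof -
  have [measurable]: "\<phi> \<in> borel_measurable borel" "k \<in> borel_measurable borel"
    using borel_measurable_integrable[OF \<phi>] borel_measurable_integrable[OF k] by simp_all
  let ?e = "\<lambda>\<xi> x. exp (- \<i> * complex_of_real \<xi> * complex_of_real x)"
  have int: "integrable (lborel \<Otimes>\<^sub>M lborel) (case_prod (\<lambda>x \<xi>. k \<xi> * (?e \<xi> x * \<phi> x)))"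
  proof (rule lborel_pair.Fubini_integrable)
    show "case_prod (\<lambda>x \<xi>. k \<xi> * (?e \<xi> x * \<phi> x)) \<in> borel_measurable (lborel \<Otimes>\<^sub>M lborel)"
      by measurable
    have "(\<lambda>x. LINT \<xi>|lborel. norm (case (x, \<xi>) of (x, \<xi>) \<Rightarrow> k \<xi> * (?e \<xi> x * \<phi> x))) =
      (\<lambda>x. (LINT \<xi>|lborel. cmod (k \<xi>)) * cmod (\<phi> x))"
      by (simp add: norm_mult)
    then show "integrable lborel (\<lambda>x. LINT \<xi>|lborel. norm (case (x, \<xi>) of (x, \<xi>) \<Rightarrow> k \<xi> * (?e \<xi> x * \<phi> x)))"
      using \<phi> by simp
    have "integrable lborel (\<lambda>\<xi>. k \<xi> * (?e \<xi> x * \<phi> x))" for x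
    proof (rule Bochner_Integration.integrable_bound[OF integrable_mult_left[OF k, of "\<phi> x"]])
      show "(\<lambda>\<xi>. k \<xi> * (?e \<xi> x * \<phi> x)) \<in> borel_measurable lborel" by measurable
    qed (simp add: norm_mult)
    then show "AE x in lborel. integrable lborel (\<lambda>\<xi>. case (x, \<xi>) of (x, \<xi>) \<Rightarrow> k \<xi> * (?e \<xi> x * \<phi> x))"
      by simp
  qed
  have "(LINT \<xi>|lborel. LINT x|lborel. k \<xi> * (?e \<xi> x * \<phi> x)) =
    (LINT x|lborel. LINT \<xi>|lborel. k \<xi> * (?e \<xi> x * \<phi> x))"
    by (rule lborel_pair.Fubini_integral[OF int])
  also have "\<dots> = (LINT x|lborel. LINT \<xi>|lborel. \<phi> x * (?e x \<xi> * k \<xi>))"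
    by (simp add: mult_ac)
  finally have "(LINT \<xi>|lborel. k \<xi> * (LINT x|lborel. ?e \<xi> x * \<phi> x)) =
    (LINT x|lborel. \<phi> x * (LINT \<xi>|lborel. ?e x \<xi> * k \<xi>))" by simp
  then show ?thesis
    by (simp add: fourier_integral_def mult.left_commute[of _ "complex_of_real (1 / sqrt (2 * pi))"])
qed

definition gaussian :: "real \<Rightarrow> real \<Rightarrow> real" where
  "gaussian s \<xi> = exp (- (s * \<xi>)\<^sup>2 / 2)"

lemma gaussian_std_normal: "gaussian s \<xi> = sqrt (2 * pi) * std_normal_density (s * \<xi>)"
  by (simp add: gaussian_def std_normal_density_def)

lemma gaussian_measurable [measurable]: "gaussian s \<in> borel_measurable borel"
  unfolding gaussian_def[abs_def] by measurable

lemma gaussian_bounds: "0 < gaussian s \<xi>" "gaussian s \<xi> \<le> 1"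
  by (simp_all add: gaussian_def)

lemma integrable_gaussian:
  assumes "s \<noteq> 0" shows "integrable lborel (gaussian s)"
  unfolding gaussian_std_normal[abs_def]
  using lborel_integrable_real_affine[of std_normal_density s 0] assms by simp

text \<open>
  Up to scaling, the characteristic function of the standard normal distribution: the
  transform of a modulated Gaussian is a translated Gaussian.
\<close>

lemma fourier_integral_gaussian:
  assumes s: "s > 0"
  shows "fourier_integral (\<lambda>\<xi>. exp (\<i> * complex_of_real x * complex_of_real \<xi>) * complex_of_real (gaussian s \<xi>)) y =
    complex_of_real ((1 / s) * exp (- ((y - x) / s)\<^sup>2 / 2))"
proof -
  define \<tau> where "\<tau> = (x - y) / s"
  have "complex_of_real (exp (- \<tau>\<^sup>2 / 2)) = char std_normal_distribution \<tau>"
    by (simp add: char_std_normal_distribution)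
  also have "\<dots> = (LINT v|lborel. std_normal_density v *\<^sub>R exp (\<i> * complex_of_real (\<tau> * v)))"
    unfolding char_def by (rule integral_density) (auto simp: normal_density_nonneg)
  also have "\<dots> = s *\<^sub>R (LINT \<xi>|lborel. std_normal_density (s * \<xi>) *\<^sub>R exp (\<i> * complex_of_real (\<tau> * (s * \<xi>))))"
    using lborel_integral_real_affine[of s "\<lambda>v. std_normal_density v *\<^sub>R exp (\<i> * complex_of_real (\<tau> * v))" 0] s
    by simp
  also have "(\<lambda>\<xi>. std_normal_density (s * \<xi>) *\<^sub>R exp (\<i> * complex_of_real (\<tau> * (s * \<xi>)))) =
    (\<lambda>\<xi>. complex_of_real (1 / sqrt (2 * pi)) * (exp (- \<i> * complex_of_real y * complex_of_real \<xi>) *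
       (exp (\<i> * complex_of_real x * complex_of_real \<xi>) * complex_of_real (gaussian s \<xi>))))"
  proof
    fix \<xi>
    have "\<tau> * s = x - y" using s by (simp add: \<tau>_def)
    then have "\<tau> * (s * \<xi>) = x * \<xi> - y * \<xi>" by (metis left_diff_distrib mult.assoc)
    then have "exp (\<i> * complex_of_real (\<tau> * (s * \<xi>))) =
      exp (- \<i> * complex_of_real y * complex_of_real \<xi>) * exp (\<i> * complex_of_real x * complex_of_real \<xi>)"
      by (simp only: of_real_diff of_real_mult exp_add[symmetric]) (simp add: algebra_simps)
    moreover have "std_normal_density (s * \<xi>) = (1 / sqrt (2 * pi)) * gaussian s \<xi>"
      by (simp add: gaussian_std_normal)
    ultimately show "std_normal_density (s * \<xi>) *\<^sub>R exp (\<i> * complex_of_real (\<tau> * (s * \<xi>))) =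
     complex_of_real (1 / sqrt (2 * pi)) * (exp (- \<i> * complex_of_real y * complex_of_real \<xi>) *
       (exp (\<i> * complex_of_real x * complex_of_real \<xi>) * complex_of_real (gaussian s \<xi>)))"
      by (simp only: scaleR_conv_of_real of_real_mult mult_ac)
  qed
  finally have "complex_of_real (exp (- \<tau>\<^sup>2 / 2)) = s *\<^sub>R
    fourier_integral (\<lambda>\<xi>. exp (\<i> * complex_of_real x * complex_of_real \<xi>) * complex_of_real (gaussian s \<xi>)) y"
    unfolding fourier_integral_def integral_mult_right_zero .
  moreover have "\<tau>\<^sup>2 = ((y - x) / s)\<^sup>2" by (simp add: \<tau>_def power_divide power2_commute)
  ultimately show ?thesis using s by (simp add: scaleR_conv_of_real field_simps)
qed

definition autocorrelation :: "(real \<Rightarrow> complex) \<Rightarrow> real \<Rightarrow> complex" where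
  "autocorrelation \<phi> u = (LINT x|lborel. \<phi> x * cnj (\<phi> (x + u)))"

lemma autocorrelation_integrable:
  assumes "\<phi> \<in> borel_measurable borel" "\<phi> \<in> square_integrable"
  shows "integrable lborel (\<lambda>x. \<phi> x * cnj (\<phi> (x + u)))"
proof -
  have [measurable]: "\<phi> \<in> borel_measurable borel" by fact
  have "integrable lebesgue (\<lambda>x. cnj (\<phi> (x + u)) * \<phi> x)"
    by (intro integrable_cnj_mult square_integrable_shift assms)
  then have "integrable lborel (\<lambda>x. cnj (\<phi> (x + u)) * \<phi> x)"
    by (subst (asm) integrable_completion) auto
  then show ?thesis by (simp add: mult.commute)
qed

lemma autocorrelation_eq_cinner:
  assumes "\<phi> \<in> borel_measurable borel" "\<phi> \<in> square_integrable"
  shows "autocorrelation \<phi> u = cinner (cls (\<lambda>t. \<phi> (t + u))) (cls \<phi>)"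
  using assms by (simp add: autocorrelation_def cinner_cls_borel square_integrable_shift borel_shift mult.commute)

lemma cauchy_schwarz: "cmod (cinner x y) \<le> norm x * norm y"
proof (cases "cinner x y = 0")
  case False
  define c where "c = cnj (cinner x y) / cmod (cinner x y)"
  have "cmod c = 1" using False by (simp add: c_def norm_divide)
  have n: "norm (cscale c y) = norm y"
  proof -
    have "c * cnj c = 1" using complex_norm_square[of c] \<open>cmod c = 1\<close> by simp
    then have "cinner (cscale c y) (cscale c y) = cinner y y"
      by (simp add: cinner_cscale_left cinner_cscale_right mult.assoc[symmetric])
    then show ?thesis by (simp add: norm_eq_sqrt_inner inner_l2_def)
  qed
  have "inner x (cscale c y) = Re (c * cinner x y)" by (simp add: inner_l2_def cinner_cscale_right)
  also have "c * cinner x y = complex_of_real (cmod (cinner x y))"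
    using False complex_norm_square[of "cinner x y"]
    by (simp add: c_def divide_simps mult.commute power2_eq_square)
  finally have "cmod (cinner x y) = inner x (cscale c y)" by simp
  also have "\<dots> \<le> norm x * norm y" using norm_cauchy_schwarz[of x "cscale c y"] by (simp add: n)
  finally show ?thesis .
qed simp

lemma tendsto_cinner:
  assumes "(f \<longlongrightarrow> x) F" "(g \<longlongrightarrow> y) F"
  shows "((\<lambda>n. cinner (f n) (g n)) \<longlongrightarrow> cinner x y) F"
proof -
  have c: "((\<lambda>n. cscale \<i> (f n)) \<longlongrightarrow> cscale \<i> x) F"
  proof -
    have "bounded_linear (mulop (\<lambda>t. \<i>))"
      by (rule clinear_bounded_linear[OF clinear_mulop[OF multiplier_const] norm_mulop[OF multiplier_const, where C=1]]) simp
    from bounded_linear.tendsto[OF this assms(1)] show ?thesis by (simp add: mulop_const)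
  qed
  have eq: "cinner x y = Complex (inner x y) (inner (cscale \<i> x) y)" for x y
    using Im_cinner[of x y] by (simp add: complex_eq_iff inner_l2_def)
  show ?thesis unfolding eq by (intro tendsto_Complex tendsto_inner assms c)
qed

lemma autocorrelation_measurable [measurable]:
  assumes [measurable]: "\<phi> \<in> borel_measurable borel"
  shows "autocorrelation \<phi> \<in> borel_measurable borel"
  unfolding autocorrelation_def[abs_def] by measurable

text \<open>
  The Gaussian factor makes \<open>|\<phi>^|\<^sup>2\<close> integrable, so the multiplication formula can move the transform
  twice: first from \<open>\<phi>\<close> to the conjugate of \<open>\<phi>^\<close> times the Gaussian, then, inside the latter, to a
  modulated Gaussian, whose transform is known.
\<close>

lemma regularized_plancherel:
  assumes \<phi>: "integrable lborel \<phi>" and sq: "\<phi> \<in> square_integrable" and s: "s > 0"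
  shows "integrable lborel (\<lambda>\<xi>. (cmod (fourier_integral \<phi> \<xi>))\<^sup>2 * gaussian s \<xi>)"
    and "complex_of_real (LINT \<xi>|lborel. (cmod (fourier_integral \<phi> \<xi>))\<^sup>2 * gaussian s \<xi>) =
    (LINT u|lborel. std_normal_density u *\<^sub>R autocorrelation \<phi> (s * u))"
proof -
  have m [measurable]: "\<phi> \<in> borel_measurable borel" using borel_measurable_integrable[OF \<phi>] by simp
  define C where "C = 1 / sqrt (2 * pi) * (LINT x|lborel. cmod (\<phi> x))"
  have C: "cmod (fourier_integral \<phi> \<xi>) \<le> C" for \<xi> unfolding C_def by (rule fourier_integral_bounded)
  have Cg: "integrable lborel (\<lambda>\<xi>. C * gaussian s \<xi>)" "integrable lborel (\<lambda>\<xi>. C\<^sup>2 * gaussian s \<xi>)"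
    using s by (auto intro!: integrable_mult_right integrable_gaussian)
  show "integrable lborel (\<lambda>\<xi>. (cmod (fourier_integral \<phi> \<xi>))\<^sup>2 * gaussian s \<xi>)"
    by (rule Bochner_Integration.integrable_bound[OF Cg(2)])
      (use C gaussian_bounds(1)[of s] in \<open>auto simp: abs_mult less_imp_le intro!: mult_right_mono power_mono\<close>)
  define k where "k \<xi> = complex_of_real (gaussian s \<xi>) * cnj (fourier_integral \<phi> \<xi>)" for \<xi>
  have k: "integrable lborel k"
  proof (rule Bochner_Integration.integrable_bound[OF Cg(1)])
    show "k \<in> borel_measurable lborel" unfolding k_def by measurable
    have "norm (k \<xi>) \<le> norm (C * gaussian s \<xi>)" for \<xi>
    proof -
      have "norm (k \<xi>) = cmod (fourier_integral \<phi> \<xi>) * gaussian s \<xi>"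
        using gaussian_bounds(1)[of s \<xi>] by (simp add: k_def norm_mult)
      also have "\<dots> \<le> C * gaussian s \<xi>"
        using gaussian_bounds(1)[of s \<xi>] by (intro mult_right_mono C) simp
      also have "\<dots> \<le> norm (C * gaussian s \<xi>)" by simp
      finally show ?thesis .
    qed
    then show "AE \<xi> in lborel. norm (k \<xi>) \<le> norm (C * gaussian s \<xi>)" by simp
  qed
  have "complex_of_real (LINT \<xi>|lborel. (cmod (fourier_integral \<phi> \<xi>))\<^sup>2 * gaussian s \<xi>) =
    (LINT \<xi>|lborel. k \<xi> * fourier_integral \<phi> \<xi>)"
    unfolding integral_complex_of_real[symmetric]
    by (intro Bochner_Integration.integral_cong refl)
       (simp only: k_def of_real_mult complex_norm_square mult_ac)
  also have "\<dots> = (LINT x|lborel. \<phi> x * fourier_integral k x)"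
    by (rule fourier_multiplication_formula[OF \<phi> k])
  also have "\<dots> = (LINT x|lborel. LINT u|lborel. std_normal_density u *\<^sub>R (\<phi> x * cnj (\<phi> (x + s * u))))"
  proof (rule Bochner_Integration.integral_cong[OF refl])
    fix x
    let ?g = "\<lambda>\<xi>. exp (\<i> * complex_of_real x * complex_of_real \<xi>) * complex_of_real (gaussian s \<xi>)"
    have g: "integrable lborel ?g"
      by (rule Bochner_Integration.integrable_bound[OF integrable_gaussian[of s]])
        (use s in \<open>auto simp: norm_mult norm_exp_eq_Re\<close>)
    have "fourier_integral k x = complex_of_real (1 / sqrt (2 * pi)) *
       (LINT \<xi>|lborel. cnj (?g \<xi> * fourier_integral \<phi> \<xi>))"
    proof -
      have "exp (- \<i> * complex_of_real x * complex_of_real \<xi>) * k \<xi> =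
        cnj (?g \<xi> * fourier_integral \<phi> \<xi>)" for \<xi>
        by (simp add: k_def exp_cnj mult_ac)
      then show ?thesis by (simp only: fourier_integral_def[of k])
    qed
    also have "\<dots> = cnj (complex_of_real (1 / sqrt (2 * pi)) * (LINT \<xi>|lborel. ?g \<xi> * fourier_integral \<phi> \<xi>))"
      unfolding Bochner_Integration.integral_cnj
      by (simp only: complex_cnj_mult complex_cnj_complex_of_real)
    also have "(LINT \<xi>|lborel. ?g \<xi> * fourier_integral \<phi> \<xi>) = (LINT y|lborel. \<phi> y * fourier_integral ?g y)"
      by (rule fourier_multiplication_formula[OF \<phi> g])
    also have "\<dots> = (LINT y|lborel. \<phi> y * complex_of_real ((1 / s) * exp (- ((y - x) / s)\<^sup>2 / 2)))"
      by (simp only: fourier_integral_gaussian[OF s])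
    also have "\<dots> = s *\<^sub>R (LINT u|lborel. \<phi> (x + s * u) * complex_of_real ((1 / s) * exp (- (((x + s * u) - x) / s)\<^sup>2 / 2)))"
      using lborel_integral_real_affine[of s "\<lambda>y. \<phi> y * complex_of_real ((1 / s) * exp (- ((y - x) / s)\<^sup>2 / 2))" x] s
      by simp
    also have "\<dots> = (LINT u|lborel. s *\<^sub>R (\<phi> (x + s * u) * complex_of_real ((1 / s) * exp (- (((x + s * u) - x) / s)\<^sup>2 / 2))))"
      by (rule integral_scaleR_right[symmetric])
    also have "\<dots> = (LINT u|lborel. \<phi> (x + s * u) * complex_of_real (exp (- u\<^sup>2 / 2)))"
      using s by (intro Bochner_Integration.integral_cong refl) (simp add: scaleR_conv_of_real)
    finally have "fourier_integral k x = (LINT u|lborel. cnj (complex_of_real (1 / sqrt (2 * pi)) *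
        (\<phi> (x + s * u) * complex_of_real (exp (- u\<^sup>2 / 2)))))"
      by (simp only: Bochner_Integration.integral_cnj integral_mult_right_zero)
    then have "\<phi> x * fourier_integral k x = (LINT u|lborel. \<phi> x * cnj (complex_of_real (1 / sqrt (2 * pi)) *
        (\<phi> (x + s * u) * complex_of_real (exp (- u\<^sup>2 / 2)))))"
      by (simp only: integral_mult_right_zero)
    also have "\<dots> = (LINT u|lborel. std_normal_density u *\<^sub>R (\<phi> x * cnj (\<phi> (x + s * u))))"
      by (intro Bochner_Integration.integral_cong refl)
        (simp add: std_normal_density_def scaleR_conv_of_real)
    finally show "\<phi> x * fourier_integral k x =
      (LINT u|lborel. std_normal_density u *\<^sub>R (\<phi> x * cnj (\<phi> (x + s * u))))" .
  qed
  also have "\<dots> = (LINT u|lborel. LINT x|lborel. std_normal_density u *\<^sub>R (\<phi> x * cnj (\<phi> (x + s * u))))"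
  proof (rule lborel_pair.Fubini_integral, rule lborel_pair.Fubini_integrable)
    let ?h = "\<lambda>u x. std_normal_density u *\<^sub>R (\<phi> x * cnj (\<phi> (x + s * u)))"
    show "case_prod ?h \<in> borel_measurable (lborel \<Otimes>\<^sub>M lborel)" by measurable
    have int: "integrable lborel (\<lambda>x. ?h u x)" for u
      by (intro integrable_scaleR_right autocorrelation_integrable m sq)
    then show "AE u in lborel. integrable lborel (\<lambda>x. case (u, x) of (u, x) \<Rightarrow> ?h u x)" by simp
    have bd: "(LINT x|lborel. norm (?h u x)) \<le> std_normal_density u * (norm (cls \<phi>))\<^sup>2" for u
    proof -
      \<comment> \<open>The autocorrelation of the modulus of \<open>\<phi>\<close> is bounded by the Cauchy--Schwarz inequality.\<close>
      let ?a = "\<lambda>x. complex_of_real (cmod (\<phi> x))"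
      have a: "?a \<in> borel_measurable borel" "?a \<in> square_integrable"
        using sq by (auto simp: square_integrable_borel_iff m)
      have "(norm (cls ?a))\<^sup>2 = (norm (cls \<phi>))\<^sup>2"
        by (simp add: norm_cls_borel[OF a] norm_cls_borel[OF m sq])
      then have n: "norm (cls ?a) = norm (cls \<phi>)" by simp
      have I: "complex_of_real (LINT x|lborel. cmod (\<phi> x * cnj (\<phi> (x + s * u)))) = autocorrelation ?a (s * u)"
        by (simp add: autocorrelation_def norm_mult flip: integral_complex_of_real)
      have "cmod (autocorrelation ?a (s * u)) \<le> norm (cls ?a) * norm (cls ?a)"
        using cauchy_schwarz[of "cls (\<lambda>t. ?a (t + s * u))" "cls ?a"]
        by (simp only: autocorrelation_eq_cinner[OF a] norm_cls_shift[OF a])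
      then have "cmod (complex_of_real (LINT x|lborel. cmod (\<phi> x * cnj (\<phi> (x + s * u)))))
        \<le> (norm (cls \<phi>))\<^sup>2"
        by (simp only: I n power2_eq_square)
      then have "(LINT x|lborel. cmod (\<phi> x * cnj (\<phi> (x + s * u)))) \<le> (norm (cls \<phi>))\<^sup>2"
        by (simp only: norm_of_real abs_le_iff)
      then have "std_normal_density u * (LINT x|lborel. cmod (\<phi> x * cnj (\<phi> (x + s * u))))
        \<le> std_normal_density u * (norm (cls \<phi>))\<^sup>2"
        by (rule mult_left_mono) simp
      then show ?thesis by (simp only: norm_scaleR integral_mult_right_zero abs_of_nonneg[OF normal_density_nonneg])
    qed
    show "integrable lborel (\<lambda>u. LINT x|lborel. norm (case (u, x) of (u, x) \<Rightarrow> ?h u x))"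
    proof (rule Bochner_Integration.integrable_bound)
      show "integrable lborel (\<lambda>u. std_normal_density u * (norm (cls \<phi>))\<^sup>2)"
        by simp
      show "AE u in lborel. norm (LINT x|lborel. norm (case (u, x) of (u, x) \<Rightarrow> ?h u x))
         \<le> norm (std_normal_density u * (norm (cls \<phi>))\<^sup>2)"
        using bd by (auto intro!: AE_I2 simp del: norm_scaleR)
    qed measurable
  qed
  also have "\<dots> = (LINT u|lborel. std_normal_density u *\<^sub>R autocorrelation \<phi> (s * u))"
    by (simp only: integral_scaleR_right autocorrelation_def)
  finally show "complex_of_real (LINT \<xi>|lborel. (cmod (fourier_integral \<phi> \<xi>))\<^sup>2 * gaussian s \<xi>) =
    (LINT u|lborel. std_normal_density u *\<^sub>R autocorrelation \<phi> (s * u))" .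
qed

text \<open>
  Let the width \<open>s = 1 / (n + 1)\<close> tend to 0 in the regularized formula. The Gaussian factors increase to 1,
  so the left side converges monotonically; the autocorrelation is bounded and continuous at 0, so
  the right side converges to its value at 0, the squared norm of \<open>\<phi>\<close>.
\<close>

theorem plancherel:
  assumes \<phi>: "integrable lborel \<phi>" and sq: "\<phi> \<in> square_integrable"
  shows "fourier_integral \<phi> \<in> square_integrable"
    and "norm (cls (fourier_integral \<phi>)) = norm (cls \<phi>)"
proof -
  have m [measurable]: "\<phi> \<in> borel_measurable borel" using borel_measurable_integrable[OF \<phi>] by simp
  let ?s = "\<lambda>n. 1 / real (Suc n)"
  let ?f = "\<lambda>n \<xi>. (cmod (fourier_integral \<phi> \<xi>))\<^sup>2 * gaussian (?s n) \<xi>"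
  have s0: "?s \<longlonglongrightarrow> 0" using LIMSEQ_inverse_real_of_nat by (simp add: inverse_eq_divide)
  have "(\<lambda>n. LINT u|lborel. std_normal_density u *\<^sub>R autocorrelation \<phi> (?s n * u)) \<longlonglongrightarrow>
    (LINT u|lborel. std_normal_density u *\<^sub>R autocorrelation \<phi> 0)"
  proof (rule integral_dominated_convergence[where w="\<lambda>u. std_normal_density u * (norm (cls \<phi>))\<^sup>2"])
    show "integrable lborel (\<lambda>u. std_normal_density u * (norm (cls \<phi>))\<^sup>2)" by simp
    have "(\<lambda>n. autocorrelation \<phi> (?s n * u)) \<longlonglongrightarrow> autocorrelation \<phi> 0" for u
    proof -
      have "(\<lambda>n. ?s n * u) \<longlonglongrightarrow> 0" using tendsto_mult_right[OF s0, of u] by simp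
      from shift_tendsto[OF this m sq]
      have "(\<lambda>n. cinner (cls (\<lambda>t. \<phi> (t + ?s n * u))) (cls \<phi>)) \<longlonglongrightarrow> cinner (cls \<phi>) (cls \<phi>)"
        by (intro tendsto_cinner tendsto_const)
      then show ?thesis by (simp add: autocorrelation_eq_cinner[OF m sq])
    qed
    then show "AE u in lborel. (\<lambda>n. std_normal_density u *\<^sub>R autocorrelation \<phi> (?s n * u)) \<longlonglongrightarrow>
        std_normal_density u *\<^sub>R autocorrelation \<phi> 0"
      by (intro AE_I2 tendsto_intros)
    have "cmod (autocorrelation \<phi> v) \<le> (norm (cls \<phi>))\<^sup>2" for v
      using cauchy_schwarz[of "cls (\<lambda>t. \<phi> (t + v))" "cls \<phi>"]
      by (simp add: autocorrelation_eq_cinner[OF m sq] norm_cls_shift[OF m sq] power2_eq_square)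
    then show "AE u in lborel. norm (std_normal_density u *\<^sub>R autocorrelation \<phi> (?s n * u))
      \<le> std_normal_density u * (norm (cls \<phi>))\<^sup>2" for n
      by (intro AE_I2) (auto intro!: mult_left_mono)
  qed measurable
  also have "(LINT u|lborel. std_normal_density u *\<^sub>R autocorrelation \<phi> 0) = autocorrelation \<phi> 0"
    by simp
  also have "\<dots> = complex_of_real ((norm (cls \<phi>))\<^sup>2)"
    by (simp add: autocorrelation_eq_cinner[OF m sq] cinner_self_norm)
  also have "(\<lambda>n. LINT u|lborel. std_normal_density u *\<^sub>R autocorrelation \<phi> (?s n * u)) =
    (\<lambda>n. complex_of_real (LINT \<xi>|lborel. ?f n \<xi>))"
    by (rule ext, rule regularized_plancherel(2)[OF \<phi> sq, symmetric]) simp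
  finally have lim: "(\<lambda>n. LINT \<xi>|lborel. ?f n \<xi>) \<longlonglongrightarrow> (norm (cls \<phi>))\<^sup>2"
    by (simp only: tendsto_of_real_iff)
  have mono: "mono (\<lambda>n. ?f n \<xi>)" for \<xi>
  proof (rule monoI)
    fix i j :: nat assume "i \<le> j"
    then have "\<bar>?s j * \<xi>\<bar> \<le> \<bar>?s i * \<xi>\<bar>"
      unfolding abs_mult by (intro mult_right_mono) (auto simp: divide_simps)
    then have "(?s j * \<xi>)\<^sup>2 \<le> (?s i * \<xi>)\<^sup>2" by (simp only: abs_le_square_iff)
    then show "?f i \<xi> \<le> ?f j \<xi>" unfolding gaussian_def by (intro mult_left_mono) auto
  qed
  have flim: "(\<lambda>n. ?f n \<xi>) \<longlonglongrightarrow> (cmod (fourier_integral \<phi> \<xi>))\<^sup>2" for \<xi>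
  proof -
    have "(\<lambda>n. (cmod (fourier_integral \<phi> \<xi>))\<^sup>2 * exp (- (?s n * \<xi>)\<^sup>2 / 2)) \<longlonglongrightarrow>
      (cmod (fourier_integral \<phi> \<xi>))\<^sup>2 * exp (- (0 * \<xi>)\<^sup>2 / 2)"
      by (intro tendsto_intros s0) auto
    then show ?thesis by (simp add: gaussian_def)
  qed
  have fi: "integrable lborel (?f n)" for n
    by (intro regularized_plancherel(1)[OF \<phi> sq]) simp
  note mc = integral_monotone_convergence_nonneg[OF fi AE_I2[OF mono] AE_I2 AE_I2[OF flim] lim]
  have i: "integrable lborel (\<lambda>\<xi>. (cmod (fourier_integral \<phi> \<xi>))\<^sup>2)"
    by (rule mc(1)) (use gaussian_bounds(1) in \<open>auto simp: less_imp_le\<close>)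
  have v: "(LINT \<xi>|lborel. (cmod (fourier_integral \<phi> \<xi>))\<^sup>2) = (norm (cls \<phi>))\<^sup>2"
    by (rule mc(2)) (use gaussian_bounds(1) in \<open>auto simp: less_imp_le\<close>)
  show sqF: "fourier_integral \<phi> \<in> square_integrable"
    using i by (simp add: square_integrable_borel_iff fourier_integral_measurable m)
  have "(norm (cls (fourier_integral \<phi>)))\<^sup>2 = (norm (cls \<phi>))\<^sup>2"
    using v by (simp add: norm_cls_borel sqF fourier_integral_measurable m)
  then show "norm (cls (fourier_integral \<phi>)) = norm (cls \<phi>)" by simp
qed

section \<open>The unitary Fourier transform\<close>

definition trunc :: "nat \<Rightarrow> (real \<Rightarrow> complex) \<Rightarrow> real \<Rightarrow> complex" where
  "trunc n \<phi> t = indicator {- real n..real n} t *\<^sub>R \<phi> t"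

lemma trunc_measurable [measurable]:
  "\<phi> \<in> borel_measurable borel \<Longrightarrow> trunc n \<phi> \<in> borel_measurable borel"
  unfolding trunc_def[abs_def] by measurable

lemma trunc_arith:
  "trunc n (\<lambda>t. \<phi> t + \<psi> t) = (\<lambda>t. trunc n \<phi> t + trunc n \<psi> t)"
  "trunc n (\<lambda>t. c * \<phi> t) = (\<lambda>t. c * trunc n \<phi> t)"
  by (auto simp: trunc_def fun_eq_iff scaleR_right_distrib)

lemma trunc_square_integrable:
  assumes "\<phi> \<in> borel_measurable borel" "\<phi> \<in> square_integrable"
  shows "trunc n \<phi> \<in> square_integrable"
proof (rule square_integrable_bound[OF _ integrable_square_integrable[OF assms(2)]])
  show "trunc n \<phi> \<in> borel_measurable lebesgue"
    using trunc_measurable[OF assms(1)] by (simp add: measurable_completion)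
qed (auto simp: trunc_def indicator_def)

lemma trunc_integrable:
  assumes "\<phi> \<in> borel_measurable borel" "\<phi> \<in> square_integrable"
  shows "integrable lborel (trunc n \<phi>)"
proof (rule Bochner_Integration.integrable_bound)
  show "integrable lborel (\<lambda>t. indicator {- real n..real n} t + (cmod (\<phi> t))\<^sup>2)"
    using assms by (intro Bochner_Integration.integrable_add integrable_real_indicator)
      (auto simp: square_integrable_borel_iff emeasure_lborel_Icc_eq)
  have "c \<le> 1 + c\<^sup>2" for c :: real
    using zero_le_power2[of "c - 1/2"] by (simp add: power2_eq_square algebra_simps)
  then show "AE t in lborel. norm (trunc n \<phi> t) \<le> norm (indicator {- real n..real n} t + (cmod (\<phi> t))\<^sup>2)"
    by (auto simp: trunc_def indicator_def)
qed (use assms in measurable)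

lemma trunc_tendsto:
  assumes "\<phi> \<in> borel_measurable borel" "\<phi> \<in> square_integrable"
  shows "(\<lambda>n. cls (trunc n \<phi>)) \<longlonglongrightarrow> cls \<phi>"
proof (rule cls_tendsto[OF trunc_square_integrable[OF assms] assms(2) _ integrable_square_integrable[OF assms(2)]])
  have "(\<lambda>n. trunc n \<phi> t) \<longlonglongrightarrow> \<phi> t" for t
  proof (rule tendsto_eventually)
    obtain k :: nat where k: "\<bar>t\<bar> \<le> real k" using real_arch_simple by blast
    show "\<forall>\<^sub>F n in sequentially. trunc n \<phi> t = \<phi> t"
      using eventually_ge_at_top[of k]
      by eventually_elim (use k in \<open>auto simp: trunc_def indicator_def\<close>)
  qed
  then show "AE t in lebesgue. (\<lambda>n. trunc n \<phi> t) \<longlonglongrightarrow> \<phi> t" by simp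
qed (auto simp: trunc_def indicator_def)

lemma truncated_fourier_eq:
  assumes \<phi> [measurable]: "\<phi> \<in> borel_measurable borel" and ae: "AE t in lebesgue. rep x t = \<phi> t"
  shows "truncated_fourier n (rep x) = fourier_integral (trunc n \<phi>)"
proof
  fix \<xi>
  let ?e = "\<lambda>t. exp (- \<i> * complex_of_real \<xi> * complex_of_real t)"
  have e [measurable]: "?e \<in> borel_measurable lebesgue"
    by (rule measurable_completion) measurable
  have tm: "trunc n \<phi> \<in> borel_measurable lborel" by measurable
  then have [measurable]: "trunc n \<phi> \<in> borel_measurable lebesgue" by (rule measurable_completion)
  have "(LINT t:{- real n..real n}|lebesgue. ?e t * rep x t) = (LINT t|lebesgue. ?e t * trunc n \<phi> t)"
    unfolding set_lebesgue_integral_def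
  proof (rule integral_cong_AE)
    show "AE t in lebesgue. indicator {- real n..real n} t *\<^sub>R (?e t * rep x t) = ?e t * trunc n \<phi> t"
      using ae by eventually_elim (simp add: trunc_def)
    show "(\<lambda>t. indicator {- real n..real n} t *\<^sub>R (?e t * rep x t)) \<in> borel_measurable lebesgue"
      by (intro borel_measurable_scaleR borel_measurable_indicator borel_measurable_times[OF e] measurable_rep) simp
    show "(\<lambda>t. ?e t * trunc n \<phi> t) \<in> borel_measurable lebesgue"
      by (intro borel_measurable_times[OF e]) measurable
  qed
  also have "\<dots> = (LINT t|lborel. ?e t * trunc n \<phi> t)"
    by (rule integral_completion) measurable
  finally show "truncated_fourier n (rep x) \<xi> = fourier_integral (trunc n \<phi>) \<xi>"
    by (simp only: truncated_fourier_def fourier_integral_def)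
qed

definition fourier_op :: "l2 \<Rightarrow> l2" where
  "fourier_op x = lim (\<lambda>n. cls (truncated_fourier n (rep x)))"

lemma truncated_fourier_square_integrable: "truncated_fourier n (rep x) \<in> square_integrable"
proof -
  obtain \<phi> where "\<phi> \<in> borel_measurable borel" "\<phi> \<in> square_integrable" "AE t in lebesgue. rep x t = \<phi> t"
    using l2_borel_cases[of x] by blast
  then show ?thesis
    by (simp add: truncated_fourier_eq plancherel trunc_integrable trunc_square_integrable)
qed

text \<open>
  The truncations of a function form a Cauchy sequence, and Plancherel's theorem carries
  their distances over to their transforms.
\<close>

lemma fourier_op_tendsto: "(\<lambda>n. cls (truncated_fourier n (rep x))) \<longlonglongrightarrow> fourier_op x"
proof -
  obtain \<phi> where \<phi>: "\<phi> \<in> borel_measurable borel" "\<phi> \<in> square_integrable" "x = cls \<phi>"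
    "AE t in lebesgue. rep x t = \<phi> t"
    using l2_borel_cases[of x] by blast
  note * = trunc_integrable[OF \<phi>(1,2)] trunc_square_integrable[OF \<phi>(1,2)]
  have "Cauchy (\<lambda>n. cls (truncated_fourier n (rep x)))"
  proof (rule metric_CauchyI)
    fix e :: real assume "0 < e"
    have "Cauchy (\<lambda>n. cls (trunc n \<phi>))"
      using trunc_tendsto[OF \<phi>(1,2)] by (rule LIMSEQ_imp_Cauchy)
    from metric_CauchyD[OF this \<open>0 < e\<close>]
    obtain M where M: "\<And>m n. m \<ge> M \<Longrightarrow> n \<ge> M \<Longrightarrow> dist (cls (trunc m \<phi>)) (cls (trunc n \<phi>)) < e" by blast
    have eq: "dist (cls (truncated_fourier m (rep x))) (cls (truncated_fourier n (rep x))) =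
      dist (cls (trunc m \<phi>)) (cls (trunc n \<phi>))" for m n
    proof -
      have "norm (cls (fourier_integral (trunc m \<phi>)) - cls (fourier_integral (trunc n \<phi>))) =
        norm (cls (fourier_integral (\<lambda>t. trunc m \<phi> t - trunc n \<phi> t)))"
        by (simp add: cls_diff plancherel * fourier_integral_diff[OF *(1) *(1), abs_def] )
      also have "\<dots> = norm (cls (\<lambda>t. trunc m \<phi> t - trunc n \<phi> t))"
        by (intro plancherel(2) Bochner_Integration.integrable_diff square_integrable_diff *)
      also have "\<dots> = norm (cls (trunc m \<phi>) - cls (trunc n \<phi>))" by (simp add: cls_diff *)
      finally show ?thesis by (simp add: dist_norm truncated_fourier_eq[OF \<phi>(1,4)])
    qed
    show "\<exists>M. \<forall>m\<ge>M. \<forall>n\<ge>M. dist (cls (truncated_fourier m (rep x))) (cls (truncated_fourier n (rep x))) < e"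
      using M by (auto simp: eq)
  qed
  then show ?thesis
    unfolding fourier_op_def by (simp add: Cauchy_convergent_iff convergent_LIMSEQ_iff)
qed

lemma fourier_op_tendsto_borel:
  assumes "\<phi> \<in> borel_measurable borel" "\<phi> \<in> square_integrable"
  shows "(\<lambda>n. cls (fourier_integral (trunc n \<phi>))) \<longlonglongrightarrow> fourier_op (cls \<phi>)"
  using fourier_op_tendsto[of "cls \<phi>"] truncated_fourier_eq[OF assms(1) rep_cls[OF assms(2)]] by simp

lemma norm_fourier_op: "norm (fourier_op x) = norm x"
proof -
  obtain \<phi> where \<phi>: "\<phi> \<in> borel_measurable borel" "\<phi> \<in> square_integrable" "x = cls \<phi>"
    by (metis l2_borel_cases)
  have "(\<lambda>n. norm (cls (fourier_integral (trunc n \<phi>)))) \<longlonglongrightarrow> norm (fourier_op x)"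
    unfolding \<phi>(3) by (intro tendsto_norm fourier_op_tendsto_borel \<phi>)
  moreover have "(\<lambda>n. norm (cls (trunc n \<phi>))) \<longlonglongrightarrow> norm x"
    unfolding \<phi>(3) by (intro tendsto_norm trunc_tendsto \<phi>)
  ultimately show ?thesis
    using plancherel(2)[OF trunc_integrable[OF \<phi>(1,2)] trunc_square_integrable[OF \<phi>(1,2)]]
    by (simp add: LIMSEQ_unique)
qed

lemma clinear_fourier_op: "clinear fourier_op"
  unfolding clinear_def
proof (intro conjI allI)
  fix x y c
  obtain \<phi> where \<phi>: "\<phi> \<in> borel_measurable borel" "\<phi> \<in> square_integrable" "x = cls \<phi>"
    by (metis l2_borel_cases)
  obtain \<psi> where \<psi>: "\<psi> \<in> borel_measurable borel" "\<psi> \<in> square_integrable" "y = cls \<psi>"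
    by (metis l2_borel_cases)
  note [measurable] = \<phi>(1) \<psi>(1)
  note * = trunc_integrable[OF \<phi>(1,2)] trunc_square_integrable[OF \<phi>(1,2)]
    trunc_integrable[OF \<psi>(1,2)] trunc_square_integrable[OF \<psi>(1,2)]
  have "(\<lambda>n. cls (fourier_integral (trunc n (\<lambda>t. \<phi> t + \<psi> t)))) \<longlonglongrightarrow> fourier_op (cls (\<lambda>t. \<phi> t + \<psi> t))"
    by (intro fourier_op_tendsto_borel square_integrable_add \<phi> \<psi>) measurable
  moreover have "cls (fourier_integral (trunc n (\<lambda>t. \<phi> t + \<psi> t))) =
      cls (fourier_integral (trunc n \<phi>)) + cls (fourier_integral (trunc n \<psi>))" for n
    by (simp add: trunc_arith fourier_integral_add[OF *(1,3), abs_def] cls_add plancherel *)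
  moreover have "(\<lambda>n. cls (fourier_integral (trunc n \<phi>)) + cls (fourier_integral (trunc n \<psi>)))
      \<longlonglongrightarrow> fourier_op x + fourier_op y"
    unfolding \<phi>(3) \<psi>(3) by (intro tendsto_add fourier_op_tendsto_borel \<phi> \<psi>)
  ultimately show "fourier_op (x + y) = fourier_op x + fourier_op y"
    by (simp add: LIMSEQ_unique \<phi> \<psi> cls_add)
  have "(\<lambda>n. cls (fourier_integral (trunc n (\<lambda>t. c * \<phi> t)))) \<longlonglongrightarrow> fourier_op (cls (\<lambda>t. c * \<phi> t))"
    by (intro fourier_op_tendsto_borel square_integrable_cmult \<phi>) measurable
  moreover have "cls (fourier_integral (trunc n (\<lambda>t. c * \<phi> t))) =
      cscale c (cls (fourier_integral (trunc n \<phi>)))" for n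
    by (simp add: trunc_arith fourier_integral_cmult[abs_def] cls_cscale plancherel *)
  moreover have "(\<lambda>n. cscale c (cls (fourier_integral (trunc n \<phi>)))) \<longlonglongrightarrow> cscale c (fourier_op x)"
  proof -
    have "bounded_linear (mulop (\<lambda>t. c))"
      by (rule clinear_bounded_linear[OF clinear_mulop[OF multiplier_const]
            norm_mulop[OF multiplier_const, where C="cmod c"]]) simp
    from bounded_linear.tendsto[OF this fourier_op_tendsto_borel[OF \<phi>(1,2)]]
    show ?thesis by (simp add: mulop_const \<phi>)
  qed
  ultimately show "fourier_op (cscale c x) = cscale c (fourier_op x)"
    by (simp add: LIMSEQ_unique \<phi> cls_cscale)
qed

text \<open>Polarization.\<close>

lemma cinner_preserved:
  assumes "clinear T" "\<And>x. norm (T x) = norm x"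
  shows "cinner (T x) (T y) = cinner x y"
proof -
  have inner: "inner (T x) (T y) = inner x y" for x y
    using assms(2)[of "x + y"] by (simp add: dot_norm clinearD(1)[OF assms(1)] assms(2))
  then have "Im (cinner (T x) (T y)) = Im (cinner x y)"
    by (simp add: Im_cinner inner flip: clinearD(2)[OF assms(1)])
  with inner[of x y] show ?thesis by (simp add: complex_eq_iff inner_l2_def)
qed

definition conj_l2 :: "l2 \<Rightarrow> l2" where
  "conj_l2 x = cls (\<lambda>t. cnj (rep x t))"

lemma conj_l2_cls: "\<phi> \<in> square_integrable \<Longrightarrow> conj_l2 (cls \<phi>) = cls (\<lambda>t. cnj (\<phi> t))"
  unfolding conj_l2_def
proof (rule cls_eqI)
  assume "\<phi> \<in> square_integrable"
  from rep_cls[OF this] show "AE t in lebesgue. cnj (rep (cls \<phi>) t) = cnj (\<phi> t)"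
    by eventually_elim simp
qed (auto intro: square_integrable_cnj rep_square_integrable)

lemma conj_l2_simps:
  "conj_l2 (conj_l2 x) = x" "norm (conj_l2 x) = norm x" "conj_l2 (x - y) = conj_l2 x - conj_l2 y"
proof -
  obtain \<phi> \<psi> where *: "\<phi> \<in> square_integrable" "x = cls \<phi>" "\<psi> \<in> square_integrable" "y = cls \<psi>"
    by (metis l2_cases)
  then show "conj_l2 (conj_l2 x) = x" "conj_l2 (x - y) = conj_l2 x - conj_l2 y"
    by (simp_all add: conj_l2_cls square_integrable_cnj cls_diff square_integrable_diff)
  have "(norm (conj_l2 x))\<^sup>2 = (norm x)\<^sup>2"
    using * by (simp add: conj_l2_cls square_integrable_cnj norm_cls)
  then show "norm (conj_l2 x) = norm x" by simp
qed

lemma tendsto_conj_l2: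
  assumes "X \<longlonglongrightarrow> x" shows "(\<lambda>n. conj_l2 (X n)) \<longlonglongrightarrow> conj_l2 x"
proof -
  have "(\<lambda>n. norm (X n - x)) \<longlonglongrightarrow> 0" using assms by (simp add: LIM_zero tendsto_norm_zero)
  then have "(\<lambda>n. norm (conj_l2 (X n) - conj_l2 x)) \<longlonglongrightarrow> 0"
    by (simp add: conj_l2_simps(2) flip: conj_l2_simps(3))
  then show ?thesis by (simp add: tendsto_norm_zero_iff LIM_zero_iff)
qed

text \<open>The multiplication formula says that the Fourier transform is its own transpose.\<close>

lemma fourier_op_transpose: "cinner (conj_l2 (fourier_op x)) y = cinner (conj_l2 x) (fourier_op y)"
proof -
  obtain \<phi> where \<phi>: "\<phi> \<in> borel_measurable borel" "\<phi> \<in> square_integrable" "x = cls \<phi>"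
    by (metis l2_borel_cases)
  obtain \<psi> where \<psi>: "\<psi> \<in> borel_measurable borel" "\<psi> \<in> square_integrable" "y = cls \<psi>"
    by (metis l2_borel_cases)
  note [measurable] = \<phi>(1) \<psi>(1)
  note * = trunc_integrable[OF \<phi>(1,2)] trunc_square_integrable[OF \<phi>(1,2)]
    trunc_integrable[OF \<psi>(1,2)] trunc_square_integrable[OF \<psi>(1,2)]
  have "cinner (conj_l2 (cls (fourier_integral (trunc n \<phi>)))) (cls (trunc n \<psi>)) =
    cinner (conj_l2 (cls (trunc n \<phi>))) (cls (fourier_integral (trunc n \<psi>)))" for n
  proof -
    have m: "fourier_integral (trunc n \<phi>) \<in> borel_measurable borel" "trunc n \<phi> \<in> borel_measurable borel"
      "fourier_integral (trunc n \<psi>) \<in> borel_measurable borel" "trunc n \<psi> \<in> borel_measurable borel"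
      by measurable
    have "cinner (conj_l2 (cls (fourier_integral (trunc n \<phi>)))) (cls (trunc n \<psi>)) =
      (LINT t|lborel. trunc n \<psi> t * fourier_integral (trunc n \<phi>) t)"
      by (simp add: conj_l2_cls cinner_cls_borel plancherel * m square_integrable_cnj borel_measurable_cnj mult.commute)
    also have "\<dots> = (LINT t|lborel. trunc n \<phi> t * fourier_integral (trunc n \<psi>) t)"
      by (rule fourier_multiplication_formula[OF *(1,3)])
    also have "\<dots> = cinner (conj_l2 (cls (trunc n \<phi>))) (cls (fourier_integral (trunc n \<psi>)))"
      by (simp add: conj_l2_cls cinner_cls_borel plancherel * m square_integrable_cnj borel_measurable_cnj)
    finally show ?thesis .
  qed
  moreover have "(\<lambda>n. cinner (conj_l2 (cls (fourier_integral (trunc n \<phi>)))) (cls (trunc n \<psi>)))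
      \<longlonglongrightarrow> cinner (conj_l2 (fourier_op x)) y"
    unfolding \<phi>(3) \<psi>(3)
    by (intro tendsto_cinner tendsto_conj_l2 fourier_op_tendsto_borel trunc_tendsto \<phi> \<psi>)
  moreover have "(\<lambda>n. cinner (conj_l2 (cls (trunc n \<phi>))) (cls (fourier_integral (trunc n \<psi>))))
      \<longlonglongrightarrow> cinner (conj_l2 x) (fourier_op y)"
    unfolding \<phi>(3) \<psi>(3)
    by (intro tendsto_cinner tendsto_conj_l2 fourier_op_tendsto_borel trunc_tendsto \<phi> \<psi>)
  ultimately show ?thesis by (simp add: LIMSEQ_unique)
qed

text \<open>
  By the previous lemma the adjoint is the conjugate of the Fourier transform by complex conjugation,
  so it is an isometry as well. A preimage of \<open>y\<close> is its value \<open>z\<close> at \<open>y\<close>: the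
  transform of \<open>z\<close> has the norm of \<open>y\<close>, and its inner product with \<open>y\<close> is that norm squared.
\<close>

lemma surj_fourier_op: "surj fourier_op"
proof (rule surjI)
  fix y
  define z where "z = conj_l2 (fourier_op (conj_l2 y))"
  have nz: "norm z = norm y" by (simp add: z_def conj_l2_simps norm_fourier_op)
  have "cinner y (fourier_op z) = cinner (conj_l2 (conj_l2 y)) (fourier_op z)"
    by (simp add: conj_l2_simps)
  also have "\<dots> = cinner z z"
    by (subst fourier_op_transpose[symmetric]) (simp add: z_def)
  finally have "inner y (fourier_op z) = (norm y)\<^sup>2"
    by (simp add: inner_l2_def cinner_self_norm nz)
  then have "(norm (fourier_op z - y))\<^sup>2 = 0"
    using norm_fourier_op[of z]
    by (simp add: power2_norm_eq_inner inner_diff_left inner_diff_right inner_commute[of "fourier_op z" y] nz)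
       (simp add: nz flip: power2_norm_eq_inner)
  then show "fourier_op (conj_l2 (fourier_op (conj_l2 y))) = y" by (simp add: z_def)
qed

lemma unitary_fourier_op: "unitary fourier_op"
  unfolding unitary_def
  by (intro conjI allI clinear_fourier_op surj_fourier_op cinner_preserved norm_fourier_op)

lemma fourier_Rep: "fourier (Rep_l2 x) = Rep_l2 (fourier_op x)"
proof -
  have eq: "hnorm L2 (ae_class (truncated_fourier n (ae_rep (Rep_l2 x))) \<ominus>\<^bsub>L2\<^esub> Rep_l2 y) =
    norm (cls (truncated_fourier n (rep x)) - y)" for n y
  proof -
    have "ae_class (truncated_fourier n (ae_rep (Rep_l2 x))) = Rep_l2 (cls (truncated_fourier n (rep x)))"
      by (simp add: Rep_cls truncated_fourier_square_integrable) (simp add: rep_def)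
    then show ?thesis by (simp only: L2_minus hnorm_L2)
  qed
  show ?thesis
    unfolding fourier_def
  proof (rule the_equality)
    have "(\<lambda>n. norm (cls (truncated_fourier n (rep x)) - fourier_op x)) \<longlonglongrightarrow> 0"
      by (intro tendsto_norm_zero LIM_zero fourier_op_tendsto)
    then show "Rep_l2 (fourier_op x) \<in> carrier L2 \<and> (\<lambda>n. hnorm L2 (ae_class (truncated_fourier n (ae_rep (Rep_l2 x))) \<ominus>\<^bsub>L2\<^esub> Rep_l2 (fourier_op x))) \<longlonglongrightarrow> 0"
      by (simp only: eq L2_simps) simp
    fix Y
    assume Y: "Y \<in> carrier L2 \<and> (\<lambda>n. hnorm L2 (ae_class (truncated_fourier n (ae_rep (Rep_l2 x))) \<ominus>\<^bsub>L2\<^esub> Y)) \<longlonglongrightarrow> 0"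
    then obtain y where y: "Y = Rep_l2 y" by (auto simp: L2_simps)
    have "(\<lambda>n. norm (cls (truncated_fourier n (rep x)) - y)) \<longlonglongrightarrow> 0" using Y by (simp only: y eq)
    then have "(\<lambda>n. cls (truncated_fourier n (rep x))) \<longlonglongrightarrow> y"
      by (simp add: tendsto_norm_zero_iff LIM_zero_iff)
    from LIMSEQ_unique[OF this fourier_op_tendsto] show "Y = Rep_l2 (fourier_op x)" by (simp add: y)
  qed
qed

lemma function_of_Q_Rep:
  assumes "g \<in> borel_measurable lebesgue" "bounded (range g)"
  shows "function_of_Q g (Rep_l2 x) = Rep_l2 (mulop (\<lambda>t. complex_of_real (g t)) x)"
proof -
  have "(\<lambda>t. complex_of_real (g t) * rep x t) \<in> square_integrable"
    by (intro sq_mult multiplier_of_real assms rep_square_integrable)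
  then show ?thesis by (simp add: function_of_Q_def mulop_def Rep_cls) (simp add: rep_def)
qed

lemma function_of_Q_diag_op:
  assumes "g \<in> borel_measurable lebesgue" "bounded (range g)"
  shows "function_of_Q g (Rep_l2 x) = Rep_l2 (diag_op (\<lambda>x. x) (\<lambda>t. complex_of_real (g t)) x)"
  by (simp add: function_of_Q_Rep[OF assms] diag_op_def)

lemma function_of_P_diag_op:
  assumes "f \<in> borel_measurable lebesgue" "bounded (range f)"
  shows "function_of_P f (Rep_l2 x) = Rep_l2 (diag_op fourier_op (\<lambda>t. complex_of_real (f t)) x)"
proof -
  have "inv_into (carrier L2) fourier (Rep_l2 y) = Rep_l2 (adj fourier_op y)" for y
  proof (rule inv_into_f_eq)
    have "inj fourier_op" using unitary_bij[OF unitary_fourier_op] by (simp add: bij_def)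
    then show "inj_on fourier (carrier L2)"
      by (auto simp: inj_on_def L2_simps fourier_Rep Rep_l2_inject)
  qed (simp_all add: L2_simps fourier_Rep unitary_fourier_op)
  then show ?thesis
    by (simp add: function_of_P_def fourier_Rep function_of_Q_Rep[OF assms] diag_op_def)
qed

section \<open>Positive commutators\<close>

definition i_comm :: "(l2 \<Rightarrow> l2) \<Rightarrow> (l2 \<Rightarrow> l2) \<Rightarrow> l2 \<Rightarrow> l2" where
  "i_comm A B x = cscale \<i> (A (B x) - B (A x))"

text \<open>The unitary group \<open>exp (-i t B)\<close>, where \<open>B\<close> is the conjugate under \<open>V\<close> of the multiplication by \<open>b\<close>.\<close>

definition propagator :: "(l2 \<Rightarrow> l2) \<Rightarrow> (real \<Rightarrow> real) \<Rightarrow> real \<Rightarrow> l2 \<Rightarrow> l2" where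
  "propagator V b t = diag_op V (\<lambda>s. exp (- \<i> * complex_of_real t * complex_of_real (b s)))"

lemma multiplier_exp:
  assumes [measurable]: "b \<in> borel_measurable lebesgue"
  shows "multiplier (\<lambda>s. exp (- \<i> * complex_of_real t * complex_of_real (b s)))"
proof (rule multiplierI)
  show "(\<lambda>s. exp (- \<i> * complex_of_real t * complex_of_real (b s))) \<in> borel_measurable lebesgue"
    by measurable
  show "cmod (exp (- \<i> * complex_of_real t * complex_of_real (b s))) \<le> 1" for s by simp
qed

lemma unitary_propagator:
  assumes "unitary V" "b \<in> borel_measurable lebesgue"
  shows "unitary (propagator V b t)"
  unfolding propagator_def by (intro diag_op_unimodular(1) multiplier_exp assms) simp

lemma propagator_0: "unitary V \<Longrightarrow> propagator V b 0 x = x"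
  by (simp add: propagator_def diag_op_const cscale_simps)

text \<open>
  Boundedness of \<open>b\<close> makes the Taylor estimate \<open>|exp (i y) - 1 - i y| \<le> y\<^sup>2 / 2\<close> uniform over the line,
  so the group is differentiable in norm, with derivative \<open>-i B exp (-i t B)\<close>.
\<close>

lemma propagator_has_derivative:
  assumes V: "unitary V" and b [measurable]: "b \<in> borel_measurable lebesgue" and bb: "bounded (range b)"
  shows "((\<lambda>t. propagator V b t x) has_derivative
    (\<lambda>h. h *\<^sub>R cscale (- \<i>) (diag_op V (\<lambda>s. complex_of_real (b s)) (propagator V b t x)))) (at t)"
proof -
  obtain C where C: "\<And>s. \<bar>b s\<bar> \<le> C" using bb by (auto simp: bounded_iff)
  let ?e = "\<lambda>t s. exp (- \<i> * complex_of_real t * complex_of_real (b s))"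
  let ?D = "cscale (- \<i>) (diag_op V (\<lambda>s. complex_of_real (b s)) (propagator V b t x))"
  note m = multiplier_exp[OF b] multiplier_of_real[OF b bb] multiplier_const multiplier_mult multiplier_add
  have eq: "propagator V b (t + h) x - propagator V b t x - h *\<^sub>R ?D =
    diag_op V (\<lambda>s. ?e (t + h) s + (- 1 * ?e t s + (\<i> * complex_of_real h) * (complex_of_real (b s) * ?e t s))) x" for h
  proof -
    have "diag_op V (\<lambda>s. ?e (t + h) s + (- 1 * ?e t s + (\<i> * complex_of_real h) * (complex_of_real (b s) * ?e t s))) x =
      propagator V b (t + h) x + (cscale (- 1) (propagator V b t x) +
        cscale (\<i> * complex_of_real h) (diag_op V (\<lambda>s. complex_of_real (b s)) (propagator V b t x)))"
      unfolding propagator_def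
      by (simp only: m V diag_op_simps(4) diag_op_const[OF V, symmetric] diag_op_simps(3))
    also have "cscale (- 1) (propagator V b t x) = - propagator V b t x"
      using scaleR_cscale[of "- 1" "propagator V b t x"] by simp
    also have "cscale (\<i> * complex_of_real h) (diag_op V (\<lambda>s. complex_of_real (b s)) (propagator V b t x)) = - (h *\<^sub>R ?D)"
      using scaleR_cscale[of "- h" ?D] by (simp add: cscale_simps(3) mult.commute)
    finally show ?thesis by simp
  qed
  have bd: "norm (propagator V b (t + h) x - propagator V b t x - h *\<^sub>R ?D) \<le> ((h * C)\<^sup>2 / 2) * norm x" for h
    unfolding eq
  proof (rule norm_diag_op[OF V])
    show "multiplier (\<lambda>s. ?e (t + h) s + (- 1 * ?e t s + (\<i> * complex_of_real h) * (complex_of_real (b s) * ?e t s)))"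
      by (intro m)
    fix s
    let ?y = "- (h * b s)"
    have "?e (t + h) s = ?e t s * exp (\<i> * complex_of_real ?y)"
      by (simp add: exp_add[symmetric] algebra_simps)
    then have "?e (t + h) s + (- 1 * ?e t s + (\<i> * complex_of_real h) * (complex_of_real (b s) * ?e t s)) =
      ?e t s * (exp (\<i> * complex_of_real ?y) - (1 + \<i> * complex_of_real ?y))"
      by (simp add: algebra_simps)
    moreover have "cmod (exp (\<i> * complex_of_real ?y) - (1 + \<i> * complex_of_real ?y)) \<le> ?y\<^sup>2 / 2"
      using iexp_approx1[of ?y 1] by (simp add: power2_eq_square)
    moreover have "?y\<^sup>2 / 2 \<le> (h * C)\<^sup>2 / 2"
      using C[of s] order_trans[OF abs_ge_zero C[of s]]
      by (auto simp: power_mult_distrib abs_le_square_iff[symmetric] intro!: mult_left_mono)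
    ultimately show "cmod (?e (t + h) s + (- 1 * ?e t s + (\<i> * complex_of_real h) * (complex_of_real (b s) * ?e t s)))
      \<le> (h * C)\<^sup>2 / 2"
      by (simp only: norm_mult cmod_kernel)
  qed
  show ?thesis
    unfolding has_derivative_at
  proof (intro conjI)
    show "bounded_linear (\<lambda>h. h *\<^sub>R ?D)" by (rule bounded_linear_scaleR_left)
    show "(\<lambda>h. norm (propagator V b (t + h) x - propagator V b t x - h *\<^sub>R ?D) / norm h) \<midarrow>0\<rightarrow> 0"
    proof (rule tendsto_sandwich)
      show "\<forall>\<^sub>F h in at 0. 0 \<le> norm (propagator V b (t + h) x - propagator V b t x - h *\<^sub>R ?D) / norm h" by simp
      have "norm (propagator V b (t + h) x - propagator V b t x - h *\<^sub>R ?D) / norm h \<le> \<bar>h\<bar> * (C\<^sup>2 / 2 * norm x)" for h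
      proof (cases "h = 0")
        case False
        have "((h * C)\<^sup>2 / 2) * norm x = \<bar>h\<bar> * (C\<^sup>2 / 2 * norm x) * \<bar>h\<bar>"
          by (simp add: power2_eq_square mult_ac)
        with bd[of h] have "norm (propagator V b (t + h) x - propagator V b t x - h *\<^sub>R ?D)
          \<le> \<bar>h\<bar> * (C\<^sup>2 / 2 * norm x) * \<bar>h\<bar>" by (simp only:)
        moreover have "0 < \<bar>h\<bar>" using False by simp
        ultimately show ?thesis by (simp only: real_norm_def pos_divide_le_eq)
      qed simp
      then show "\<forall>\<^sub>F h in at 0. norm (propagator V b (t + h) x - propagator V b t x - h *\<^sub>R ?D) / norm h
         \<le> \<bar>h\<bar> * (C\<^sup>2 / 2 * norm x)" by simp
      show "(\<lambda>h::real. \<bar>h\<bar> * (C\<^sup>2 / 2 * norm x)) \<midarrow>0\<rightarrow> 0"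
      proof -
        have "(\<lambda>h::real. \<bar>h\<bar> * (C\<^sup>2 / 2 * norm x)) \<midarrow>0\<rightarrow> \<bar>0\<bar> * (C\<^sup>2 / 2 * norm x)"
          by (intro tendsto_intros)
        then show ?thesis by simp
      qed
    qed simp
  qed
qed

text \<open>
  The Heisenberg equation in quadratic form: the derivative of \<open>exp (i t B) T exp (-i t B)\<close> is
  \<open>- exp (i t B) i[T, B] exp (-i t B)\<close>.
\<close>

lemma heisenberg_derivative:
  assumes V: "unitary V" and b: "b \<in> borel_measurable lebesgue" "bounded (range b)"
    and T: "clinear T" "bounded_linear T"
  defines "B \<equiv> diag_op V (\<lambda>s. complex_of_real (b s))"
  shows "((\<lambda>t. inner (propagator V b t x) (T (propagator V b t x))) has_real_derivative
    - inner (propagator V b t x) (i_comm T B (propagator V b t x))) (at t)"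
proof -
  let ?y = "\<lambda>t. propagator V b t x"
  let ?D = "cscale (- \<i>) (B (?y t))"
  have d: "(?y has_derivative (\<lambda>h. h *\<^sub>R ?D)) (at t)"
    unfolding B_def by (rule propagator_has_derivative[OF V b])
  have dT: "((\<lambda>t. T (?y t)) has_derivative (\<lambda>h. T (h *\<^sub>R ?D))) (at t)"
    by (rule bounded_linear.has_derivative[OF T(2) d])
  have sym: "cinner (B u) v = cinner u (B v)" for u v
    unfolding B_def by (subst diag_op_simps(5)[OF V multiplier_of_real[OF b]]) simp
  have "cinner (?y t) (T ?D) + cinner ?D (T (?y t)) = - cinner (?y t) (i_comm T B (?y t))"
  proof -
    show ?thesis
      by (simp add: i_comm_def cinner_cscale_right cinner_cscale_left clinearD(2)[OF T(1)] sym cinner_diff_right algebra_simps)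
  qed
  then have eq: "inner (?y t) (T ?D) + inner ?D (T (?y t)) = - inner (?y t) (i_comm T B (?y t))"
    unfolding inner_l2_def by (metis plus_complex.sel(1) uminus_complex.sel(1))
  have "((\<lambda>t. inner (?y t) (T (?y t))) has_derivative
    (\<lambda>h. inner (?y t) (T (h *\<^sub>R ?D)) + inner (h *\<^sub>R ?D) (T (?y t)))) (at t)"
    by (rule has_derivative_inner[OF d dT])
  then show ?thesis
    unfolding has_field_derivative_def
    by (rule has_derivative_eq_rhs)
      (simp add: fun_eq_iff clinearD(4)[OF T(1)] eq[symmetric] algebra_simps)
qed

text \<open>
  If \<open>i[A, B] \<ge> 0\<close>, then \<open>A\<^sub>t = exp (i t B) A exp (-i t B)\<close> decreases with \<open>t\<close>, hence \<open>F(A\<^sub>t) \<le> F(A)\<close> for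
  \<open>t \<ge> 0\<close>. The left side is the conjugate of \<open>F(A)\<close>, and its derivative at 0, which is \<open>- i[F(A), B]\<close>,
  cannot be positive on any vector.
\<close>

theorem positive_commutator_matrix_monotone:
  assumes W: "unitary W" and a: "a \<in> borel_measurable lebesgue" "bounded (range a)" "closure (range a) \<subseteq> U"
    and V: "unitary V" and b: "b \<in> borel_measurable lebesgue" "bounded (range b)"
    and F: "matrix_monotone_on U F"
  defines "A \<equiv> diag_op W (\<lambda>s. complex_of_real (a s))" and "B \<equiv> diag_op V (\<lambda>s. complex_of_real (b s))"
    and "FA \<equiv> diag_op W (\<lambda>s. complex_of_real ((F \<circ> a) s))"
  assumes pos: "\<And>x. 0 \<le> inner x (i_comm A B x)"
  shows "0 \<le> inner x (i_comm FA B x)"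
proof (rule ccontr)
  have Fa: "bounded (range (F \<circ> a))" by (rule matrix_monotone_bounded[OF F a(2,3)])
  have Fm: "(F \<circ> a) \<in> borel_measurable lebesgue"
    using F order_trans[OF closure_subset a(3)] Fa
    by (intro has_spectral_integral_diag_op(1)[OF W a(1)]) (auto simp: matrix_monotone_on_def)
  let ?y = "\<lambda>t. propagator V b t"
  have conj: "inner (?y t x) (diag_op W m (?y t x)) = inner x (diag_op (W \<circ> ?y t) m x)" for t x m
    using unitary_cinner[OF unitary_propagator[OF V b(1), of t], of x "adj (?y t) (diag_op W m (?y t x))"]
    by (simp add: inner_l2_def diag_op_comp unitary_propagator V b W)
  have dec: "inner x (diag_op (W \<circ> ?y t) (\<lambda>s. complex_of_real (a s)) x) \<le> inner x (A x)" if "0 \<le> t" for t x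
  proof -
    have "inner (?y t x) (A (?y t x)) \<le> inner (?y 0 x) (A (?y 0 x))"
    proof (rule DERIV_nonpos_imp_nonincreasing[OF that, of "\<lambda>t. inner (?y t x) (A (?y t x))"])
      fix s
      show "\<exists>d. ((\<lambda>t. inner (?y t x) (A (?y t x))) has_real_derivative d) (at s) \<and> d \<le> 0"
        unfolding A_def
        using heisenberg_derivative[OF V b
            clinear_diag_op[OF W multiplier_of_real[OF a(1,2)]]
            bounded_linear_diag_op[OF W multiplier_of_real[OF a(1,2)]], of x s] pos[of "?y s x"]
        unfolding A_def B_def by (intro exI conjI) auto
    qed
    then show ?thesis by (simp add: A_def conj propagator_0 V)
  qed
  have decF: "inner (?y t x) (FA (?y t x)) \<le> inner x (FA x)" if "0 \<le> t" for t
    unfolding FA_def conj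
    by (rule matrix_monotone_diag_op[OF F unitary_comp[OF W unitary_propagator[OF V b(1)]] a Fa W a Fa])
      (use dec[OF that] in \<open>simp add: A_def\<close>)
  assume "\<not> 0 \<le> inner x (i_comm FA B x)"
  moreover have "((\<lambda>t. inner (?y t x) (FA (?y t x))) has_real_derivative - inner x (i_comm FA B x)) (at 0)"
    using heisenberg_derivative[OF V b
            clinear_diag_op[OF W multiplier_of_real[OF Fm Fa]]
            bounded_linear_diag_op[OF W multiplier_of_real[OF Fm Fa]], of x 0]
    unfolding FA_def B_def by (simp add: propagator_0 V)
  ultimately obtain d where d: "d > 0"
    "\<And>h. h > 0 \<Longrightarrow> h < d \<Longrightarrow> inner (?y 0 x) (FA (?y 0 x)) < inner (?y (0 + h) x) (FA (?y (0 + h) x))"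
    using DERIV_pos_inc_right[of "\<lambda>t. inner (?y t x) (FA (?y t x))" "- inner x (i_comm FA B x)" 0] by auto
  have "inner x (FA x) < inner (?y (d/2) x) (FA (?y (d/2) x))"
    using d(2)[of "d/2"] d(1) by (simp add: propagator_0 V)
  moreover have "inner (?y (d/2) x) (FA (?y (d/2) x)) \<le> inner x (FA x)" using d(1) by (intro decF) simp
  ultimately show False by simp
qed

text \<open>
  The quadratic form of \<open>i[A, B]\<close> is real for self-adjoint \<open>A\<close> and \<open>B\<close>, so its positivity is a
  statement about real parts.
\<close>

lemma positive_i_commutator_PQ_iff:
  assumes f: "f \<in> borel_measurable lebesgue" "bounded (range f)"
    and g: "g \<in> borel_measurable lebesgue" "bounded (range g)"
  shows "positive_operator L2 (i_commutator_PQ f g) \<longleftrightarrow>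
    (\<forall>x. 0 \<le> inner x (i_comm (diag_op fourier_op (\<lambda>s. complex_of_real (f s)))
       (diag_op (\<lambda>x. x) (\<lambda>s. complex_of_real (g s))) x))"
proof -
  let ?A = "diag_op fourier_op (\<lambda>s. complex_of_real (f s))"
  let ?B = "diag_op (\<lambda>x. x) (\<lambda>s. complex_of_real (g s))"
  have "i_commutator_PQ f g (Rep_l2 x) = Rep_l2 (i_comm ?A ?B x)" for x
    by (simp add: i_commutator_PQ_def commutator_def function_of_P_diag_op[OF f] function_of_Q_diag_op[OF g]
        L2_minus L2_simps i_comm_def)
  moreover have "Im (cinner x (i_comm ?A ?B x)) = 0" for x
  proof -
    have "cinner x (?A (?B x)) = cinner (?A x) (?B x)" "cinner x (?B (?A x)) = cinner (?B x) (?A x)"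
      by (simp_all add: diag_op_simps(5) unitary_fourier_op unitary_id multiplier_of_real f g)
    then have "cinner x (i_comm ?A ?B x) = \<i> * (cinner (?A x) (?B x) - cnj (cinner (?A x) (?B x)))"
      by (simp add: i_comm_def cinner_cscale_right cinner_diff_right cinner_commute[of "?B x" "?A x", symmetric])
    then show ?thesis by simp
  qed
  ultimately show ?thesis
    unfolding positive_operator_def by (simp add: L2_simps complex_nonneg_Reals_iff inner_l2_def)
qed

text \<open>
  With the identity \<open>[A, -B] = [B, A]\<close> the positivity theorem, which changes the first operator, applies
  to the second one.
\<close>

lemma i_comm_swap:
  assumes V: "unitary V" and b: "b \<in> borel_measurable lebesgue" "bounded (range b)"
    and A: "clinear A"
  shows "i_comm A (diag_op V (\<lambda>s. complex_of_real (- b s))) x = i_comm (diag_op V (\<lambda>s. complex_of_real (b s))) A x"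
proof -
  have "diag_op V (\<lambda>s. complex_of_real (- b s)) y = - diag_op V (\<lambda>s. complex_of_real (b s)) y" for y
  proof -
    have "diag_op V (\<lambda>s. complex_of_real (- b s)) y = diag_op V (\<lambda>s. - 1 * complex_of_real (b s)) y"
      by simp
    also have "\<dots> = cscale (- 1) (diag_op V (\<lambda>s. complex_of_real (b s)) y)"
      by (subst diag_op_simps(3)[OF V multiplier_const multiplier_of_real[OF b], symmetric])
        (simp add: diag_op_const V)
    finally show ?thesis using scaleR_cscale[of "- 1" "diag_op V (\<lambda>s. complex_of_real (b s)) y"] by simp
  qed
  moreover have "A (- y) = - A y" for y using clinearD(4)[OF A, of "- 1" y] by simp
  ultimately show ?thesis by (simp add: i_comm_def)
qed

theorem theorem1p2:
  fixes f g F G :: "real \<Rightarrow> real" and U V :: "real set"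
  assumes "f \<in> borel_measurable lebesgue" and "bounded (range f)"
    and "g \<in> borel_measurable lebesgue" and "bounded (range g)"
    and "positive_operator L2 (i_commutator_PQ f g)"
    and "\<exists>X\<in>carrier L2. i_commutator_PQ f g X \<noteq> \<zero>\<^bsub>L2\<^esub>"
    and "open U" and "is_interval U" and "closure (range f) \<subseteq> U"
    and "open V" and "is_interval V" and "closure (range g) \<subseteq> V"
    and "matrix_monotone_on U F"
    and "matrix_monotone_on V G"
  shows "positive_operator L2 (i_commutator_PQ (F \<circ> f) (G \<circ> g))"
proof -
  note f = assms(1,2) and g = assms(3,4)
  have Ff: "(F \<circ> f) \<in> borel_measurable lebesgue" "bounded (range (F \<circ> f))"
  proof -
    show b: "bounded (range (F \<circ> f))" by (rule matrix_monotone_bounded[OF assms(13,2,9)])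
    show "(F \<circ> f) \<in> borel_measurable lebesgue"
      using assms(13) order_trans[OF closure_subset assms(9)] b
      by (intro has_spectral_integral_diag_op(1)[OF unitary_id f(1)]) (auto simp: matrix_monotone_on_def)
  qed
  have Gg: "(G \<circ> g) \<in> borel_measurable lebesgue" "bounded (range (G \<circ> g))"
  proof -
    show b: "bounded (range (G \<circ> g))" by (rule matrix_monotone_bounded[OF assms(14,4,12)])
    show "(G \<circ> g) \<in> borel_measurable lebesgue"
      using assms(14) order_trans[OF closure_subset assms(12)] b
      by (intro has_spectral_integral_diag_op(1)[OF unitary_id g(1)]) (auto simp: matrix_monotone_on_def)
  qed
  let ?P = "\<lambda>h. diag_op fourier_op (\<lambda>s. complex_of_real (h s))"
  let ?Q = "\<lambda>h. diag_op (\<lambda>x. x) (\<lambda>s. complex_of_real (h s))"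
  have nFf: "(\<lambda>s. - (F \<circ> f) s) \<in> borel_measurable lebesgue" "bounded (range (\<lambda>s. - (F \<circ> f) s))"
    using borel_measurable_uminus[OF Ff(1)] Ff(2) by (simp_all add: bounded_iff o_def)
  have "0 \<le> inner x (i_comm (?P f) (?Q g) x)" for x
    using assms(5) by (simp add: positive_i_commutator_PQ_iff f g)
  then have "0 \<le> inner x (i_comm (?P (F \<circ> f)) (?Q g) x)" for x
    by (rule positive_commutator_matrix_monotone[OF unitary_fourier_op f assms(9) unitary_id g assms(13)])
  then have "0 \<le> inner x (i_comm (?Q g) (?P (\<lambda>s. - (F \<circ> f) s)) x)" for x
    by (simp only: i_comm_swap[OF unitary_fourier_op Ff clinear_diag_op[OF unitary_id multiplier_of_real[OF g]]])
  then have "0 \<le> inner x (i_comm (?Q (G \<circ> g)) (?P (\<lambda>s. - (F \<circ> f) s)) x)" for x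
    by (rule positive_commutator_matrix_monotone[OF unitary_id g assms(12) unitary_fourier_op nFf assms(14)])
  then have "0 \<le> inner x (i_comm (?P (F \<circ> f)) (?Q (G \<circ> g)) x)" for x
    by (simp only: i_comm_swap[OF unitary_fourier_op Ff clinear_diag_op[OF unitary_id multiplier_of_real[OF Gg]]])
  then show ?thesis by (simp add: positive_i_commutator_PQ_iff[OF Ff Gg])
qed

end
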